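(* Let $\sigma:\mathbb{R}\to\mathbb{R}$ be of locally bounded variation such that either $\sigma(x)\ge 0$ for all $x\in\mathbb{R}$ or $\sigma(x)\le 0$ for all $x\in\mathbb{R}$, and such that $\frac1\sigma$ is locally integrable. Let $Y=(Y_t)_{t\in[0,T]}$ be a real-valued stochastic process, let $X_0$ be a (possibly random) initial condition, and for a fixed $a\in\mathbb{R}$ let $\Lambda(x)=\int_a^x\frac{1}{\sigma(y)}\,dy$, with inverse $\Lambda^{-1}$. Suppose that the process $Z_t=\Lambda(X_0)+Y_t-Y_0$ satisfies the variability assumption (A). Then the stochastic differential equation $dX_t=\sigma(X_t)\,dY_t$ with initial condition $X_0$ admits a solution, given by $$X_t=\Lambda^{-1}\big(\Lambda(X_0)+Y_t-Y_0\big),\qquad t\in[0,T].$$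
   Context: Fix $0<T<\infty$; all processes are real-valued, indexed by $[0,T]$, on a common probability space. Variability assumption (A) for a process $X$: there is $\alpha\in(\frac12,1)$ such that $X$ has (almost surely) $\alpha$-Hölder continuous paths, and there exist $\beta\in(1-\alpha,\alpha)$ and $\epsilon>0$ such that $\sup_{y\in\mathbb{R}}\mathbb{E}\int_0^T|X_t-y|^{-\frac{\beta+\epsilon}{\alpha}}\,dt<\infty$. Pathwise integral. For $\theta\in(0,1)$, $W_{\theta,1}$ is the space of measurable $f:(0,T)\to\mathbb{R}$ with $\|f\|_{\theta,1}=\int_0^T\frac{|f(t)|}{t^\theta}dt+\int_0^T\int_0^t\frac{|f(t)-f(s)|}{|t-s|^{1+\theta}}ds\,dt<\infty$, and $W_{\theta,\infty}$ is the space of measurable $g:(0,T)\to\mathbb{R}$ such that the limit $g(T-)\in\mathbb{R}$ exists and $\sup_{t}\frac{|g(T-)-g(t)|}{(T-t)^\theta}+\sup_{t}\int_t^T\frac{|g(t)-g(s)|}{|t-s|^{1+\theta}}ds<\infty$ (suprema over $t\in(0,T)$). Put $D^\theta_{0+}f(t)=\frac{1}{\Gamma(1-\theta)}\Big(\frac{f(t)}{t^\theta}+\theta\int_0^t\frac{f(t)-f(s)}{(t-s)^{\theta+1}}ds\Big)$ and $D^\theta_{T-}g(t)=\frac{(-1)^\theta}{\Gamma(1-\theta)}\Big(\frac{g(t)}{(T-t)^\theta}+\theta\int_t^T\frac{g(t)-g(s)}{(s-t)^{\theta+1}}ds\Big)$, with $(-1)^\theta=e^{i\pi\theta}$. If $f\in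 W_{\theta,1}$ and $g\in W_{1-\theta,\infty}$ for some $\theta\in(0,1)$, the integral is $\int_0^Tf_t\,dg_t=(-1)^\theta\int_0^TD^\theta_{0+}f(t)\,D^{1-\theta}_{T-}(g-g(T-))(t)\,dt$, and $\int_0^tf_s\,dg_s=\int_0^T\mathbf{1}_{[0,t]}(s)f_s\,dg_s$ for $t\in[0,T]$. A solution of $dX_t=\sigma(X_t)\,dY_t$ with initial condition $X_0$ is a process $X$ such that, almost surely, the path $s\mapsto\sigma(X_s)$ belongs to $W_{\theta,1}$ and the path of $Y$ belongs to $W_{1-\theta,\infty}$ for some $\theta\in(0,1)$ (so that the pathwise integral $\int_0^t\sigma(X_s)\,dY_s$ exists), and $X_t=X_0+\int_0^t\sigma(X_s)\,dY_s$ for $t\in[0,T]$.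
   Formalization: The formal theorem also assumes that almost surely Λ(X_0)+Y_t−Y_0 lies in the range of Λ for all t in [0,T]; otherwise (e.g. σ(x)=1+x², where Λ has bounded range) the formula Λ^{-1}(Λ(X_0)+Y_t−Y_0) is undefined. *)

theory Defs
  imports "HOL-Probability.Probability"
begin

section \<open>Conditions on the coefficient\<close>

text \<open>Partitions are given by their points \<open>x 0 \<le> x 1 \<le> \<dots> \<le> x n\<close> in \<open>{a..b}\<close>.\<close>

definition bounded_variation_on :: "real \<Rightarrow> real \<Rightarrow> (real \<Rightarrow> real) \<Rightarrow> bool" where
  "bounded_variation_on a b f \<longleftrightarrow>
     (\<exists>V. \<forall>(n::nat) (x::nat \<Rightarrow> real).
        (\<forall>i\<le>n. x i \<in> {a..b}) \<and> (\<forall>i<n. x i \<le> x (Suc i)) \<longrightarrow>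
        (\<Sum>i<n. \<bar>f (x (Suc i)) - f (x i)\<bar>) \<le> V)"

definition locally_bounded_variation :: "(real \<Rightarrow> real) \<Rightarrow> bool" where
  "locally_bounded_variation f \<longleftrightarrow> (\<forall>a b. bounded_variation_on a b f)"

text \<open>
  Local integrability of \<open>1 / f\<close>, where \<open>1 / 0\<close> means \<open>\<infinity>\<close>: the zero set of \<open>f\<close> has to be
  stated to be null separately, because \<open>1 / 0 = 0\<close> in the type of reals.
\<close>

definition locally_integrable_reciprocal :: "(real \<Rightarrow> real) \<Rightarrow> bool" where
  "locally_integrable_reciprocal f \<longleftrightarrow>
     (AE x in lborel. f x \<noteq> 0) \<and> (\<forall>a b. set_integrable lborel {a..b} (\<lambda>x. 1 / f x))"

text \<open>The interval integral is oriented, i.e. it changes sign when \<open>x < a\<close>.\<close>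

definition Lam :: "(real \<Rightarrow> real) \<Rightarrow> real \<Rightarrow> real \<Rightarrow> real" where
  "Lam \<sigma> a x = (LBINT y=ereal a..ereal x. 1 / \<sigma> y)"

section \<open>The variability assumption\<close>

definition stochastic_process :: "'w measure \<Rightarrow> real \<Rightarrow> (real \<Rightarrow> 'w \<Rightarrow> real) \<Rightarrow> bool" where
  "stochastic_process M T X \<longleftrightarrow> (\<forall>t\<in>{0..T}. X t \<in> borel_measurable M)"

definition holder_path :: "real \<Rightarrow> real \<Rightarrow> (real \<Rightarrow> real) \<Rightarrow> bool" where
  "holder_path \<alpha> T f \<longleftrightarrow>
     (\<exists>C. \<forall>s\<in>{0..T}. \<forall>t\<in>{0..T}. \<bar>f t - f s\<bar> \<le> C * \<bar>t - s\<bar> powr \<alpha>)"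

text \<open>
  The negative power is the inverse in \<^typ>\<open>ennreal\<close>, so that it is \<open>\<infinity>\<close> when \<open>X t \<omega> = y\<close>;
  in the reals, \<open>0 powr (- p)\<close> would be \<open>0\<close>.
\<close>

definition variability_assumption ::
  "'w measure \<Rightarrow> real \<Rightarrow> (real \<Rightarrow> 'w \<Rightarrow> real) \<Rightarrow> bool" where
  "variability_assumption M T X \<longleftrightarrow>
     (\<exists>\<alpha>. 1/2 < \<alpha> \<and> \<alpha> < 1 \<and>
        (AE \<omega> in M. holder_path \<alpha> T (\<lambda>t. X t \<omega>)) \<and>
        (\<exists>\<beta> \<epsilon>. 1 - \<alpha> < \<beta> \<and> \<beta> < \<alpha> \<and> 0 < \<epsilon> \<and>
           (SUP y::real. \<integral>\<^sup>+\<omega>. (\<integral>\<^sup>+t\<in>{0..T}.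
               inverse (ennreal (\<bar>X t \<omega> - y\<bar> powr ((\<beta> + \<epsilon>) / \<alpha>))) \<partial>lborel) \<partial>M) < \<infinity>))"

section \<open>The pathwise integral\<close>

text \<open>Paths are total functions on the reals; only their values on \<open>(0,T)\<close> matter here.\<close>

definition W_one :: "real \<Rightarrow> real \<Rightarrow> (real \<Rightarrow> real) set" where
  "W_one \<theta> T = {f. set_borel_measurable lborel {0<..<T} f \<and>
     (\<integral>\<^sup>+t\<in>{0<..<T}. ennreal (\<bar>f t\<bar> / t powr \<theta>) \<partial>lborel)
     + (\<integral>\<^sup>+t\<in>{0<..<T}. (\<integral>\<^sup>+s\<in>{0<..<t}.
          ennreal (\<bar>f t - f s\<bar> / \<bar>t - s\<bar> powr (1 + \<theta>)) \<partial>lborel) \<partial>lborel) < \<infinity>}"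

definition left_lim :: "(real \<Rightarrow> real) \<Rightarrow> real \<Rightarrow> real" where
  "left_lim g T = Lim (at_left T) g"

definition W_infty :: "real \<Rightarrow> real \<Rightarrow> (real \<Rightarrow> real) set" where
  "W_infty \<theta> T = {g. set_borel_measurable lborel {0<..<T} g \<and>
     (\<exists>l. (g \<longlongrightarrow> l) (at_left T)) \<and>
     (SUP t\<in>{0<..<T}. ennreal (\<bar>left_lim g T - g t\<bar> / (T - t) powr \<theta>))
     + (SUP t\<in>{0<..<T}. \<integral>\<^sup>+s\<in>{t<..<T}.
          ennreal (\<bar>g t - g s\<bar> / \<bar>t - s\<bar> powr (1 + \<theta>)) \<partial>lborel) < \<infinity>}"

definition D_left :: "real \<Rightarrow> (real \<Rightarrow> real) \<Rightarrow> real \<Rightarrow> real" where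
  "D_left \<theta> f t = 1 / Gamma (1 - \<theta>) *
     (f t / t powr \<theta>
      + \<theta> * (LINT s:{0<..<t}|lborel. (f t - f s) / (t - s) powr (\<theta> + 1)))"

text \<open>\<open>(-1)\<^sup>\<theta> = exp (i \<pi> \<theta>)\<close> is \<^term>\<open>cis (pi * \<theta>)\<close>.\<close>

definition D_right :: "real \<Rightarrow> real \<Rightarrow> (real \<Rightarrow> real) \<Rightarrow> real \<Rightarrow> complex" where
  "D_right \<theta> T g t = cis (pi * \<theta>) / complex_of_real (Gamma (1 - \<theta>)) *
     complex_of_real (g t / (T - t) powr \<theta>
      + \<theta> * (LINT s:{t<..<T}|lborel. (g t - g s) / (s - t) powr (\<theta> + 1)))"

definition pathwise_integrable ::
  "real \<Rightarrow> real \<Rightarrow> (real \<Rightarrow> real) \<Rightarrow> (real \<Rightarrow> real) \<Rightarrow> bool" where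
  "pathwise_integrable \<theta> T f g \<longleftrightarrow>
     0 < \<theta> \<and> \<theta> < 1 \<and> f \<in> W_one \<theta> T \<and> g \<in> W_infty (1 - \<theta>) T"

definition pathwise_integral ::
  "real \<Rightarrow> real \<Rightarrow> (real \<Rightarrow> real) \<Rightarrow> (real \<Rightarrow> real) \<Rightarrow> complex" where
  "pathwise_integral \<theta> T f g = cis (pi * \<theta>) *
     (CLBINT t:{0<..<T}. complex_of_real (D_left \<theta> f t)
        * D_right (1 - \<theta>) T (\<lambda>s. g s - left_lim g T) t)"

section \<open>Solutions\<close>

text \<open>
  One order \<open>\<theta>\<close>, possibly depending on \<open>\<omega>\<close>, serves for all \<open>t\<close>. The integral over \<open>[0,t]\<close> is that
  of \<open>\<one>\<^bsub>[0,t]\<^esub> \<sigma>(X)\<close> over \<open>[0,T]\<close>, whose existence is demanded explicitly. The equation holds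
  in the complex numbers, so it includes that the integral is real.
\<close>

definition sde_solution ::
  "'w measure \<Rightarrow> real \<Rightarrow> (real \<Rightarrow> real) \<Rightarrow> (real \<Rightarrow> 'w \<Rightarrow> real) \<Rightarrow> ('w \<Rightarrow> real)
     \<Rightarrow> (real \<Rightarrow> 'w \<Rightarrow> real) \<Rightarrow> bool" where
  "sde_solution M T \<sigma> Y X0 X \<longleftrightarrow>
     stochastic_process M T X \<and>
     (AE \<omega> in M. \<exists>\<theta>.
        pathwise_integrable \<theta> T (\<lambda>s. \<sigma> (X s \<omega>)) (\<lambda>s. Y s \<omega>) \<and>
        (\<forall>t\<in>{0..T}.
           pathwise_integrable \<theta> T (\<lambda>s. indicator {0..t} s * \<sigma> (X s \<omega>)) (\<lambda>s. Y s \<omega>) \<and>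
           complex_of_real (X t \<omega>) = complex_of_real (X0 \<omega>) +
             pathwise_integral \<theta> T (\<lambda>s. indicator {0..t} s * \<sigma> (X s \<omega>)) (\<lambda>s. Y s \<omega>)))"

end

theory Submission
  imports Defs
begin

text \<open>
  The fractional derivative in the integrand is inverted by an Abel transform; approximating
  the integrator by its forward averages then gives the pathwise integral as the limit of
  \<open>n \<integral> f(s) (Y(s + 1/n) - Y(s)) ds\<close>. Hence it is enough to compare, to first order, the increment
  of \<open>X = \<Lambda>\<^sup>-\<^sup>1(Z)\<close> with \<open>\<sigma>(X) (Y(s + 1/n) - Y(s))\<close>. As \<open>\<Lambda>' = 1 / \<sigma>\<close>, the difference is at most
  the increment of \<open>Y\<close> times the variation of \<open>\<sigma>\<close> between \<open>X(s)\<close> and \<open>X(s + 1/n)\<close>. Transporting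
  the variation of \<open>\<sigma>\<close> by \<open>\<Lambda>\<close> to a finite measure \<open>\<nu>\<close>, the latter is bounded by
  \<open>\<nu> {y. \<bar>Z(s) - y\<bar> \<le> C / n powr \<alpha>}\<close>, hence by Markov's inequality by a multiple of
  \<open>n powr - (\<beta> + \<epsilon>)\<close> times \<open>\<integral> \<bar>Z(s) - y\<bar> powr (- (\<beta> + \<epsilon>) / \<alpha>) d\<nu>(y)\<close>, and the variability assumption makes
  the last integral integrable in \<open>s\<close> almost surely. Since \<open>\<alpha> + \<beta> > 1\<close>, the errors vanish in the
  limit; the same bound puts \<open>\<sigma>(X)\<close> into \<open>W\<^bsub>\<beta>,1\<^esub>\<close>.
\<close>

section \<open>Power kernels and iterated integrals\<close>

text \<open>What survives is an estimate weighted by a random integrable density. A step of length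
  \<delta> costs \<delta> powr \<alpha> from Y times \<delta> powr (\<beta> + \<epsilon>) from the
  \<nu>-measure of the values near Z, and division by \<delta> leaves the positive exponent \<alpha>
  + \<beta> + \<epsilon> - 1. The order of the fractional calculus is \<beta> itself: \<beta> <
  \<beta> + \<epsilon> leaves room for the singular kernel acting on \<sigma>(X), and 1 - \<beta> <
  \<alpha> does so for the kernel acting on Y. Only the integrator is smoothed, because \<sigma>(X)
  has merely an averaged fractional regularity. The bound uniform in y of the variability assumption
  is spent on averaging over y against the finite measure \<nu>. As X has no bound common to all
  \<omega>, one measure is attached to each interval \<open>{- real n..real n}\<close>: these
  countably many measures share one exceptional null set, and each path stays in one of the
  intervals.\<close>

lemma pred_in_interval [measurable (raw)]:
  fixes f g h :: "'a \<Rightarrow> real"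
  assumes [measurable]: "f \<in> borel_measurable M" "g \<in> borel_measurable M" "h \<in> borel_measurable M"
  shows "Measurable.pred M (\<lambda>x. f x \<in> {g x<..<h x})"
    and "Measurable.pred M (\<lambda>x. f x \<in> {g x..<h x})"
    and "Measurable.pred M (\<lambda>x. f x \<in> {g x..h x})"
  by (simp_all only: greaterThanLessThan_iff atLeastLessThan_iff atLeastAtMost_iff) measurable

lemma has_integral_indicator_UNIV:
  fixes f :: "real \<Rightarrow> real"
  assumes "(f has_integral I) A"
  shows "((\<lambda>x. indicator A x * f x) has_integral I) UNIV"
proof -
  have "(\<lambda>x. indicator A x * f x) = (\<lambda>x. if x \<in> A then f x else 0)" by auto
  then show ?thesis using assms by (simp only: has_integral_restrict_UNIV)
qed

lemma has_bochner_integral_powr_Ioo_0: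
  fixes r c :: real
  assumes "r > -1" "c \<ge> 0"
  shows "has_bochner_integral lborel (\<lambda>x. indicator {0<..<c} x * x powr r) (c powr (r + 1) / (r + 1))"
proof -
  have "((\<lambda>x. x powr r) has_integral (c powr (r + 1) / (r + 1))) {0<..<c}"
    using has_integral_powr_from_0[OF assms] by (simp add: has_integral_Icc_iff_Ioo)
  then have "((\<lambda>x. indicator {0<..<c} x * x powr r) has_integral (c powr (r + 1) / (r + 1))) UNIV"
    by (rule has_integral_indicator_UNIV)
  then have "(\<integral>\<^sup>+x. ennreal (indicator {0<..<c} x * x powr r) \<partial>lborel) = ennreal (c powr (r + 1) / (r + 1))"
    by (intro nn_integral_has_integral_lborel) auto
  then show ?thesis
    using assms by (intro has_bochner_integral_nn_integral) auto
qed

lemma has_bochner_integral_powr_left: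
  fixes r a u :: real
  assumes "r > -1" "a \<le> u"
  shows "has_bochner_integral lborel (\<lambda>x. indicator {a<..<u} x * (u - x) powr r) ((u - a) powr (r + 1) / (r + 1))"
proof -
  have "has_bochner_integral lborel (\<lambda>x. indicator {0<..<u-a} (u + (-1) * x) * (u + (-1) * x) powr r)
          (((u - a) powr (r + 1) / (r + 1)) /\<^sub>R \<bar>-1\<bar>)"
    by (rule lborel_has_bochner_integral_real_affine_iff[of "-1", THEN iffD1])
       (use assms has_bochner_integral_powr_Ioo_0[of r "u - a"] in auto)
  moreover have "(\<lambda>x. indicator {0<..<u-a} (u + (-1) * x) * (u + (-1) * x) powr r)
      = (\<lambda>x. indicator {a<..<u} x * (u - x) powr r)"
    by (auto simp: indicator_def fun_eq_iff)
  ultimately show ?thesis by simp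
qed

lemma has_bochner_integral_powr_right:
  fixes r a u :: real
  assumes "r > -1" "a \<le> u"
  shows "has_bochner_integral lborel (\<lambda>x. indicator {a<..<u} x * (x - a) powr r) ((u - a) powr (r + 1) / (r + 1))"
proof -
  have "has_bochner_integral lborel (\<lambda>x. indicator {0<..<u-a} (-a + 1 * x) * (-a + 1 * x) powr r)
          (((u - a) powr (r + 1) / (r + 1)) /\<^sub>R \<bar>1\<bar>)"
    by (rule lborel_has_bochner_integral_real_affine_iff[of "1", THEN iffD1])
       (use assms has_bochner_integral_powr_Ioo_0[of r "u - a"] in auto)
  moreover have "(\<lambda>x. indicator {0<..<u-a} (-a + 1 * x) * (-a + 1 * x) powr r)
      = (\<lambda>x. indicator {a<..<u} x * (x - a) powr r)"
    by (auto simp: indicator_def fun_eq_iff)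
  ultimately show ?thesis by simp
qed

lemma has_bochner_integral_powr_Ico:
  fixes r a b :: real
  assumes "r \<noteq> -1" "0 < a" "a \<le> b"
  shows "has_bochner_integral lborel (\<lambda>x. indicator {a..<b} x * x powr r)
           ((b powr (r + 1) - a powr (r + 1)) / (r + 1))"
proof -
  have "has_bochner_integral lborel (\<lambda>x. (x powr r) * indicator {a..b} x)
           (b powr (r + 1) / (r + 1) - a powr (r + 1) / (r + 1))"
  proof (rule has_bochner_integral_FTC_Icc_real[where F="\<lambda>x. x powr (r + 1) / (r + 1)"])
    fix x assume "a \<le> x" "x \<le> b"
    with assms have "x > 0" by simp
    then show "((\<lambda>x. x powr (r + 1) / (r + 1)) has_real_derivative x powr r) (at x)"
      using assms by (auto intro!: derivative_eq_intros)
    show "isCont (\<lambda>x. x powr r) x" using \<open>x > 0\<close> by (auto intro!: continuous_intros)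
  qed (use assms in auto)
  then show ?thesis
    by (subst has_bochner_integral_cong_AE[where g="\<lambda>x. (x powr r) * indicator {a..b} x"])
       (use AE_lborel_singleton[of b] in \<open>auto simp: diff_divide_distrib indicator_def\<close>)
qed

lemma has_bochner_integral_powr_Ico_right:
  fixes r a b t :: real
  assumes "r \<noteq> -1" "t < a" "a \<le> b"
  shows "has_bochner_integral lborel (\<lambda>x. indicator {a..<b} x * (x - t) powr r)
           (((b - t) powr (r + 1) - (a - t) powr (r + 1)) / (r + 1))"
proof -
  have "has_bochner_integral lborel (\<lambda>x. indicator {a-t..<b-t} (-t + 1 * x) * (-t + 1 * x) powr r)
          ((((b - t) powr (r + 1) - (a - t) powr (r + 1)) / (r + 1)) /\<^sub>R \<bar>1\<bar>)"
    by (rule lborel_has_bochner_integral_real_affine_iff[of "1", THEN iffD1])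
       (use assms has_bochner_integral_powr_Ico[of r "a - t" "b - t"] in auto)
  moreover have "(\<lambda>x. indicator {a-t..<b-t} (-t + 1 * x) * (-t + 1 * x) powr r)
      = (\<lambda>x. indicator {a..<b} x * (x - t) powr r)"
    by (auto simp: indicator_def fun_eq_iff)
  ultimately show ?thesis by simp
qed

lemma has_bochner_integral_Beta_Ioo:
  fixes a b s u :: real
  assumes "a > 0" "b > 0" "s < u"
  shows "has_bochner_integral lborel
    (\<lambda>w. indicator {s<..<u} w * ((w - s) powr (a - 1) * (u - w) powr (b - 1)))
    ((u - s) powr (a + b - 1) * Beta a b)"
proof -
  have "((\<lambda>t. t powr (a - 1) * (1 - t) powr (b - 1)) has_integral Beta a b) {0<..<1}"
    using has_integral_Beta_real[OF assms(1,2)] by (simp add: has_integral_Icc_iff_Ioo)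
  then have "((\<lambda>x. indicator {0<..<1} x * (x powr (a - 1) * (1 - x) powr (b - 1))) has_integral Beta a b) UNIV"
    by (rule has_integral_indicator_UNIV)
  then have "(\<integral>\<^sup>+x. ennreal (indicator {0<..<1} x * (x powr (a - 1) * (1 - x) powr (b - 1))) \<partial>lborel) = ennreal (Beta a b)"
    by (intro nn_integral_has_integral_lborel) auto
  moreover have "Beta a b \<ge> 0" using assms by (simp add: Beta_def Gamma_real_nonneg)
  ultimately have "has_bochner_integral lborel (\<lambda>x. indicator {0<..<1} x * (x powr (a - 1) * (1 - x) powr (b - 1))) (Beta a b)"
    by (intro has_bochner_integral_nn_integral) auto
  \<comment> \<open>The Beta integral on the unit interval is pulled back along w -> (w - s) / (u -
    s). The prefactor undoes the scaling of the two powers, and the Jacobian raises its exponent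
    from a + b - 2 to a + b - 1.\<close>
  then have 1: "has_bochner_integral lborel
     (\<lambda>w. (u - s) powr (a + b - 2) * (indicator {0<..<1} (-s/(u-s) + (1/(u-s)) * w) *
        ((-s/(u-s) + (1/(u-s)) * w) powr (a - 1) * (1 - (-s/(u-s) + (1/(u-s)) * w)) powr (b - 1))))
     ((u - s) powr (a + b - 2) * (Beta a b /\<^sub>R \<bar>1/(u-s)\<bar>))"
    by (intro has_bochner_integral_mult_right lborel_has_bochner_integral_real_affine_iff[THEN iffD1])
       (use assms in auto)
  have 2: "(u - s) powr (a + b - 2) * (indicator {0<..<1} (-s/(u-s) + (1/(u-s)) * w) *
        ((-s/(u-s) + (1/(u-s)) * w) powr (a - 1) * (1 - (-s/(u-s) + (1/(u-s)) * w)) powr (b - 1)))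
      = indicator {s<..<u} w * ((w - s) powr (a - 1) * (u - w) powr (b - 1))" for w
  proof -
    have x: "-s/(u-s) + (1/(u-s)) * w = (w - s) / (u - s)"
      by (simp add: diff_divide_distrib)
    have y: "1 - (w - s) / (u - s) = (u - w) / (u - s)" using assms by (simp add: field_simps)
    have p: "(u - s) powr (a + b - 2) = (u - s) powr (a - 1) * (u - s) powr (b - 1)"
      by (simp add: powr_add[symmetric])
    have i: "(w - s) / (u - s) \<in> {0<..<1} \<longleftrightarrow> w \<in> {s<..<u}"
      using assms by (auto simp: field_simps)
    show ?thesis
    proof (cases "w \<in> {s<..<u}")
      case True
      then have "(w - s) / (u - s) \<in> {0<..<1}" using i by blast
      then show ?thesis
        unfolding x y p using True assms by (simp add: powr_divide field_simps)
    next
      case False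
      then have "(w - s) / (u - s) \<notin> {0<..<1}" using i by blast
      then show ?thesis unfolding x using False by simp
    qed
  qed
  have 3: "(u - s) powr (a + b - 2) * (Beta a b /\<^sub>R \<bar>1/(u-s)\<bar>) = (u - s) powr (a + b - 1) * Beta a b"
  proof -
    have "(u - s) powr (a + b - 1) = (u - s) powr (a + b - 2) * (u - s)"
      using assms powr_add[of "u - s" "a + b - 2" 1] by simp
    then show ?thesis using assms by simp
  qed
  show ?thesis using 1 unfolding 2 3 .
qed

section \<open>Absolute integrability on the plane and uniqueness of densities\<close>

lemma integrable_pair_lborel:
  fixes h :: "real \<Rightarrow> real \<Rightarrow> real"
  assumes [measurable]: "case_prod h \<in> borel_measurable (borel \<Otimes>\<^sub>M borel)"
    and fin: "(\<integral>\<^sup>+x. \<integral>\<^sup>+y. ennreal \<bar>h x y\<bar> \<partial>lborel \<partial>lborel) < \<infinity>"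
  shows "integrable (lborel \<Otimes>\<^sub>M lborel) (case_prod h)"
proof (rule integrableI_bounded)
  show "case_prod h \<in> borel_measurable (lborel \<Otimes>\<^sub>M lborel)" by simp
  have "(\<integral>\<^sup>+z. ennreal (norm (case_prod h z)) \<partial>(lborel \<Otimes>\<^sub>M lborel))
     = (\<integral>\<^sup>+x. \<integral>\<^sup>+y. ennreal \<bar>h x y\<bar> \<partial>lborel \<partial>lborel)"
    by (subst lborel.nn_integral_fst[symmetric]) auto
  then show "(\<integral>\<^sup>+z. ennreal (norm (case_prod h z)) \<partial>(lborel \<Otimes>\<^sub>M lborel)) < \<infinity>"
    using fin by simp
qed

lemma integrable_pair_lborel':
  fixes h :: "real \<Rightarrow> real \<Rightarrow> real"
  assumes [measurable]: "case_prod h \<in> borel_measurable (borel \<Otimes>\<^sub>M borel)"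
    and fin: "(\<integral>\<^sup>+y. \<integral>\<^sup>+x. ennreal \<bar>h x y\<bar> \<partial>lborel \<partial>lborel) < \<infinity>"
  shows "integrable (lborel \<Otimes>\<^sub>M lborel) (case_prod h)"
proof (rule integrable_pair_lborel)
  show "(\<integral>\<^sup>+x. \<integral>\<^sup>+y. ennreal \<bar>h x y\<bar> \<partial>lborel \<partial>lborel) < \<infinity>"
    using fin by (subst (asm) lborel_pair.Fubini'[symmetric]) auto
qed simp

lemma integrable_pair_lborel_dominated:
  fixes h :: "real \<Rightarrow> real \<Rightarrow> real"
  assumes m: "case_prod h \<in> borel_measurable (borel \<Otimes>\<^sub>M borel)"
    and bnd: "\<And>x. (\<integral>\<^sup>+y. ennreal \<bar>h x y\<bar> \<partial>lborel) \<le> ennreal (w x)"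
    and w: "integrable lborel w"
  shows "integrable (lborel \<Otimes>\<^sub>M lborel) (case_prod h)"
proof (rule integrable_pair_lborel[OF m])
  have "(\<integral>\<^sup>+x. \<integral>\<^sup>+y. ennreal \<bar>h x y\<bar> \<partial>lborel \<partial>lborel) \<le> (\<integral>\<^sup>+x. ennreal (norm (w x)) \<partial>lborel)"
    by (intro nn_integral_mono order_trans[OF bnd] ennreal_leI) auto
  also have "\<dots> < \<infinity>" using w by (simp add: integrable_iff_bounded)
  finally show "(\<integral>\<^sup>+x. \<integral>\<^sup>+y. ennreal \<bar>h x y\<bar> \<partial>lborel \<partial>lborel) < \<infinity>" .
qed

lemma integrable_pair_lborel_dominated':
  fixes h :: "real \<Rightarrow> real \<Rightarrow> real"
  assumes m: "case_prod h \<in> borel_measurable (borel \<Otimes>\<^sub>M borel)"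
    and bnd: "\<And>y. (\<integral>\<^sup>+x. ennreal \<bar>h x y\<bar> \<partial>lborel) \<le> ennreal (w y)"
    and w: "integrable lborel w"
  shows "integrable (lborel \<Otimes>\<^sub>M lborel) (case_prod h)"
proof (rule integrable_pair_lborel'[OF m])
  have "(\<integral>\<^sup>+y. \<integral>\<^sup>+x. ennreal \<bar>h x y\<bar> \<partial>lborel \<partial>lborel) \<le> (\<integral>\<^sup>+y. ennreal (norm (w y)) \<partial>lborel)"
    by (intro nn_integral_mono order_trans[OF bnd] ennreal_leI) auto
  also have "\<dots> < \<infinity>" using w by (simp add: integrable_iff_bounded)
  finally show "(\<integral>\<^sup>+y. \<integral>\<^sup>+x. ennreal \<bar>h x y\<bar> \<partial>lborel \<partial>lborel) < \<infinity>" .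
qed

lemma nn_integral_abs_cmult:
  fixes g :: "'a \<Rightarrow> real"
  assumes g: "has_bochner_integral M g I" and nn: "\<And>x. 0 \<le> g x"
  shows "(\<integral>\<^sup>+x. ennreal \<bar>c * g x\<bar> \<partial>M) = ennreal (\<bar>c\<bar> * I)"
proof -
  have "has_bochner_integral M (\<lambda>x. \<bar>c\<bar> * g x) (\<bar>c\<bar> * I)"
    by (rule has_bochner_integral_mult_right[OF g])
  then have "(\<integral>\<^sup>+x. ennreal (\<bar>c\<bar> * g x) \<partial>M) = ennreal (\<bar>c\<bar> * I)"
    using nn by (subst nn_integral_eq_integral) (auto simp: has_bochner_integral_iff)
  then show ?thesis using nn by (simp add: abs_mult)
qed

text \<open>The open half-lines form an intersection-stable generator of the Borel sets, so
  vanishing of the integral spreads from them to every Borel set, and an integrable function with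
  this property is null.\<close>

lemma AE_zero_if_integral_lessThan_zero:
  fixes d :: "real \<Rightarrow> real"
  assumes d: "integrable lborel d" and z: "\<And>u. (LINT x:{..<u}|lborel. d x) = 0"
  shows "AE x in lborel. d x = 0"
proof (rule density_unique_real[OF d])
  have int: "set_integrable lborel A d" if "A \<in> sets borel" for A
    using integrable_mult_indicator[OF _ d, of A] that by (simp add: set_integrable_def)
  \<comment> \<open>The whole line is exhausted by half-lines, so the total integral vanishes; this
    is what the complement case of the induction needs.\<close>
  have "(\<lambda>n. LINT x:{..<real n}|lborel. d x) \<longlonglongrightarrow> (LINT x:(\<Union>n. {..<real n})|lborel. d x)"
    by (intro set_integral_cont_up int) (auto simp: incseq_def)
  moreover have "(\<Union>n. {..<real n}) = UNIV" using reals_Archimedean2 by auto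
  ultimately have tot: "(LINT x:UNIV|lborel. d x) = 0"
    using z LIMSEQ_unique[OF tendsto_const, of 0] by fastforce
  fix A assume "A \<in> sets (lborel :: real measure)"
  then have A: "A \<in> sigma_sets UNIV (range (\<lambda>a::real. {..<a}))"
    by (simp add: borel_Iio)
  have stable: "Int_stable (range (\<lambda>a::real. {..<a}))"
  proof (rule Int_stableI)
    fix A B assume "A \<in> range (\<lambda>a::real. {..<a})" "B \<in> range (\<lambda>a::real. {..<a})"
    then obtain a b :: real where "A = {..<a}" "B = {..<b}" by auto
    then have "A \<inter> B = {..<min a b}" by auto
    then show "A \<inter> B \<in> range (\<lambda>a::real. {..<a})" by blast
  qed
  have "range (\<lambda>a::real. {..<a}) \<subseteq> Pow UNIV" by simp
  from stable this A have "(LINT x:A|lborel. d x) = 0"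
  proof (induct rule: sigma_sets_induct_disjoint)
    case (basic A) then show ?case using z by auto
  next
    case (compl A)
    then have A: "A \<in> sets borel" by (simp add: borel_Iio)
    have "(LINT x:UNIV|lborel. d x) = (LINT x:A \<union> (UNIV - A)|lborel. d x)" by simp
    also have "\<dots> = (LINT x:A|lborel. d x) + (LINT x:UNIV - A|lborel. d x)"
      by (rule set_integral_Un) (use A int in auto)
    finally show ?case using tot compl by simp
  next
    case (union A)
    then have "range A \<subseteq> sets borel" by (simp add: borel_Iio)
    then have A: "\<And>i. A i \<in> sets borel" by auto
    have "(LINT x:(\<Union>i. A i)|lborel. d x) = (\<Sum>i. LINT x:A i|lborel. d x)"
    proof (rule lebesgue_integral_countable_add)
      show "A i \<inter> A j = {}" if "i \<noteq> j" for i j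
        using union(1) that by (auto simp: disjoint_family_on_def)
    qed (use A int in auto)
    then show ?case using union(3) by simp
  qed (auto simp: set_lebesgue_integral_def)
  then show "(LINT x:A|lborel. d x) = (LINT x:A|lborel. 0)" by simp
qed simp

lemma integrable_mult_bounded:
  fixes f k :: "real \<Rightarrow> real"
  assumes k: "integrable lborel k" and f[measurable]: "f \<in> borel_measurable borel"
    and b: "\<And>x. \<bar>f x\<bar> \<le> B"
  shows "integrable lborel (\<lambda>x. f x * k x)"
proof (rule Bochner_Integration.integrable_bound)
  show "integrable lborel (\<lambda>x. B * k x)" using k by simp
  have [measurable]: "k \<in> borel_measurable borel" using k by auto
  show "(\<lambda>x. f x * k x) \<in> borel_measurable lborel" by measurable
  have "0 \<le> B" using b[of 0] by linarith
  then show "AE x in lborel. norm (f x * k x) \<le> norm (B * k x)"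
    using b by (auto simp: abs_mult intro!: mult_right_mono)
qed

section \<open>Inversion of the left-sided fractional derivative\<close>

text \<open>Boundedness makes the product of \<open>f\<close> with any integrable power integrable.
  The diagonal singularity of the difference quotient is left to the double integral in
  \<open>W_one\<close>.\<close>

locale bounded_W_one =
  fixes \<theta> T B :: real and f :: "real \<Rightarrow> real"
  assumes \<theta>: "0 < \<theta>" "\<theta> < 1" and T: "0 < T"
    and f_borel [measurable]: "f \<in> borel_measurable borel"
    and f_bounded: "\<And>x. \<bar>f x\<bar> \<le> B"
    and f_W: "f \<in> W_one \<theta> T"
begin

definition marchaud_kernel :: "real \<Rightarrow> real \<Rightarrow> real" where
  "marchaud_kernel t s = indicator {0<..<T} t * indicator {0<..<t} s * ((f t - f s) / (t - s) powr (\<theta> + 1))"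

text \<open>This is the fractional derivative in Marchaud form, freed of the factor 1/\<Gamma>(1 -
  \<theta>) and extended by zero beyond (0,T), so that all integrals can run over the line.\<close>

definition marchaud :: "real \<Rightarrow> real" where
  "marchaud t = indicator {0<..<T} t * (f t * t powr (-\<theta>)) + \<theta> * (LINT s|lborel. marchaud_kernel t s)"

lemma D_left_eq_marchaud: "t \<in> {0<..<T} \<Longrightarrow> D_left \<theta> f t = marchaud t / Gamma (1 - \<theta>)"
  by (simp add: D_left_def marchaud_def marchaud_kernel_def set_lebesgue_integral_def powr_minus_divide)

lemma marchaud_outside: "t \<notin> {0<..<T} \<Longrightarrow> marchaud t = 0"
  by (simp add: marchaud_def marchaud_kernel_def)

lemma marchaud_kernel_measurable [measurable]:
  "case_prod marchaud_kernel \<in> borel_measurable (borel \<Otimes>\<^sub>M borel)"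
  unfolding marchaud_kernel_def by measurable

lemma nn_integral_marchaud_kernel_finite:
  "(\<integral>\<^sup>+t. \<integral>\<^sup>+s. ennreal \<bar>marchaud_kernel t s\<bar> \<partial>lborel \<partial>lborel) < \<infinity>"
proof -
  have "(\<integral>\<^sup>+t. \<integral>\<^sup>+s. ennreal \<bar>marchaud_kernel t s\<bar> \<partial>lborel \<partial>lborel)
    = (\<integral>\<^sup>+t\<in>{0<..<T}. (\<integral>\<^sup>+s\<in>{0<..<t}. ennreal (\<bar>f t - f s\<bar> / \<bar>t - s\<bar> powr (1 + \<theta>)) \<partial>lborel) \<partial>lborel)"
  proof (rule nn_integral_cong)
    fix t
    have "(\<integral>\<^sup>+s. ennreal \<bar>marchaud_kernel t s\<bar> \<partial>lborel)
      = (\<integral>\<^sup>+s. (ennreal (\<bar>f t - f s\<bar> / \<bar>t - s\<bar> powr (1 + \<theta>)) * indicator {0<..<t} s) * indicator {0<..<T} t \<partial>lborel)"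
      by (rule nn_integral_cong) (auto simp: marchaud_kernel_def indicator_def abs_mult add.commute)
    also have "\<dots> = (\<integral>\<^sup>+s. ennreal (\<bar>f t - f s\<bar> / \<bar>t - s\<bar> powr (1 + \<theta>)) * indicator {0<..<t} s \<partial>lborel) * indicator {0<..<T} t"
      by (rule nn_integral_multc) measurable
    finally show "(\<integral>\<^sup>+s. ennreal \<bar>marchaud_kernel t s\<bar> \<partial>lborel) = \<dots>" .
  qed
  also have "\<dots> < \<infinity>"
    using f_W by (auto simp: W_one_def less_top)
  finally show ?thesis .
qed

lemma integrable_marchaud_kernel: "integrable (lborel \<Otimes>\<^sub>M lborel) (case_prod marchaud_kernel)"
  by (rule integrable_pair_lborel[OF _ nn_integral_marchaud_kernel_finite]) measurable

lemma integrable_f_indicator: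
  assumes "A \<in> sets borel" "A \<subseteq> {a..b}"
  shows "integrable lborel (\<lambda>t. indicator A t * f t)"
proof -
  have fin: "emeasure lborel A < \<infinity>"
    by (rule emeasure_bounded_finite) (rule bounded_subset[OF bounded_closed_interval assms(2)])
  have "integrable lborel (\<lambda>t. f t * indicator A t)"
    by (intro integrable_mult_bounded[OF _ _ f_bounded] integrable_real_indicator) (use assms fin in auto)
  then show ?thesis by (simp add: mult.commute)
qed

lemma integrable_f_powr: 
  assumes "u \<le> T" shows "integrable lborel (\<lambda>t. indicator {0<..<u} t * (f t * t powr (-\<theta>)))"
proof (cases "u \<ge> 0")
  case True
  then have "integrable lborel (\<lambda>x. f x * (indicator {0<..<u} x * x powr (-\<theta>)))"
    by (intro integrable_mult_bounded[OF _ _ f_bounded] 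
      has_bochner_integral_powr_Ioo_0[THEN integrable.intros]) (use \<theta> in auto)
  then show ?thesis by (simp add: mult_ac)
next
  case False then show ?thesis by simp
qed

lemma integrable_marchaud: "integrable lborel marchaud"
proof -
  have "integrable lborel (\<lambda>t. LINT s|lborel. marchaud_kernel t s)"
    by (rule lborel_pair.integrable_fst[OF integrable_marchaud_kernel])
  then show ?thesis
    unfolding marchaud_def[abs_def] using integrable_f_powr[of T] by auto
qed

lemma borel_measurable_marchaud [measurable]: "marchaud \<in> borel_measurable borel"
  using integrable_marchaud by auto

text \<open>After the substitution \<open>r = t - s\<close> the double integral splits into two absolutely
  convergent ones, so the singularity on the diagonal needs no truncation.\<close>

lemma integral_marchaud_kernel:
  assumes u: "0 < u" "u \<le> T"
  shows "\<theta> * (LINT t|lborel. LINT s|lborel. indicator {0<..<u} t * marchaud_kernel t s)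
    = (LINT t|lborel. indicator {0<..<u} t * (f t * (u - t) powr (-\<theta>)))
     - (LINT t|lborel. indicator {0<..<u} t * (f t * t powr (-\<theta>)))"
proof -
  define k where "k r t = indicator {0<..<u} t * (indicator {0<..<t} r * (f t - f (t - r)) * r powr (-\<theta>-1))" for r t
  \<comment> \<open>For fixed r in (0,u), integrating \<open>k r t\<close> over t gives r powr
    (-\<theta>-1) times the integral of \<open>f\<close> over (r,u) minus that over (0,u-r).
    Cancelling the common part leaves the integral over the last stretch (u-r,u) minus that over the
    first stretch (0,r), and \<open>A\<close> and \<open>C\<close> are these two. Each stretch has
    length r, which tames the singularity at r = 0.\<close>
  define A where "A r t = indicator {0<..<u} t * f t * (indicator {u-t..<u} r * r powr (-\<theta>-1))" for r t
  define C where "C r t = indicator {0<..<u} t * f t * (indicator {t..<u} r * r powr (-\<theta>-1))" for r t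
  have [measurable]: "case_prod A \<in> borel_measurable (borel \<Otimes>\<^sub>M borel)" unfolding A_def by measurable
  have [measurable]: "case_prod C \<in> borel_measurable (borel \<Otimes>\<^sub>M borel)" unfolding C_def by measurable
  have [measurable]: "case_prod k \<in> borel_measurable (borel \<Otimes>\<^sub>M borel)" unfolding k_def by measurable
  have k_eq: "k (t + -1 * s) t = indicator {0<..<u} t * marchaud_kernel t s" for t s
    using u powr_minus[of "t - s" "\<theta> + 1"]
    by (auto simp: k_def marchaud_kernel_def indicator_def divide_inverse minus_diff_commute)
  have sgn: "(u powr (-\<theta>-1+1) - x powr (-\<theta>-1+1)) / (-\<theta>-1+1) = (x powr (-\<theta>) - u powr (-\<theta>)) / \<theta>" for x
    using \<theta> by (simp add: field_simps)
  have gA: "has_bochner_integral lborel (\<lambda>r. indicator {u-t..<u} r * r powr (-\<theta>-1)) (((u - t) powr (-\<theta>) - u powr (-\<theta>)) / \<theta>)"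
    if "t \<in> {0<..<u}" for t
    using has_bochner_integral_powr_Ico[of "-\<theta>-1" "u - t" u] that \<theta> unfolding sgn by simp
  have gC: "has_bochner_integral lborel (\<lambda>r. indicator {t..<u} r * r powr (-\<theta>-1)) ((t powr (-\<theta>) - u powr (-\<theta>)) / \<theta>)"
    if "t \<in> {0<..<u}" for t
    using has_bochner_integral_powr_Ico[of "-\<theta>-1" t u] that \<theta> unfolding sgn by simp
  have hA: "has_bochner_integral lborel (\<lambda>r. A r t) (indicator {0<..<u} t * f t * (((u - t) powr (-\<theta>) - u powr (-\<theta>)) / \<theta>))" for t
    unfolding A_def using has_bochner_integral_mult_right[where c="f t", OF gA[of t]] by (cases "t \<in> {0<..<u}") auto
  have hC: "has_bochner_integral lborel (\<lambda>r. C r t) (indicator {0<..<u} t * f t * ((t powr (-\<theta>) - u powr (-\<theta>)) / \<theta>))" for t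
    unfolding C_def using has_bochner_integral_mult_right[where c="f t", OF gC[of t]] by (cases "t \<in> {0<..<u}") auto
  have i0: "integrable lborel (\<lambda>t. indicator {0<..<u} t * t powr (-\<theta>))"
    "integrable lborel (\<lambda>t. indicator {0<..<u} t * (u - t) powr (-\<theta>))"
    using has_bochner_integral_powr_Ioo_0[of "-\<theta>" u] has_bochner_integral_powr_left[of "-\<theta>" 0 u] \<theta> u
    by (auto intro: integrable.intros)
  have iA: "integrable (lborel \<Otimes>\<^sub>M lborel) (case_prod A)"
  proof (rule integrable_pair_lborel_dominated')
    fix t
    show "(\<integral>\<^sup>+r. ennreal \<bar>A r t\<bar> \<partial>lborel) \<le> ennreal (B / \<theta> * (indicator {0<..<u} t * (u - t) powr (-\<theta>)))"
    proof (cases "t \<in> {0<..<u}")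
      case True
      have "(\<integral>\<^sup>+r. ennreal \<bar>A r t\<bar> \<partial>lborel) = ennreal (\<bar>f t\<bar> * (((u - t) powr (-\<theta>) - u powr (-\<theta>)) / \<theta>))"
        unfolding A_def using nn_integral_abs_cmult[OF gA[OF True], of "indicator {0<..<u} t * f t"] True by simp
      also have "\<dots> \<le> ennreal (B * ((u - t) powr (-\<theta>) / \<theta>))"
        using f_bounded[of t] \<theta> u True powr_mono2'[of "-\<theta>" "u - t" u]
        by (intro ennreal_leI mult_mono divide_right_mono) auto
      finally show ?thesis using True by simp
    qed (simp add: A_def)
    show "integrable lborel (\<lambda>t. B / \<theta> * (indicator {0<..<u} t * (u - t) powr (-\<theta>)))"
      using i0 by simp
  qed simp
  have iC: "integrable (lborel \<Otimes>\<^sub>M lborel) (case_prod C)"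
  proof (rule integrable_pair_lborel_dominated')
    fix t
    show "(\<integral>\<^sup>+r. ennreal \<bar>C r t\<bar> \<partial>lborel) \<le> ennreal (B / \<theta> * (indicator {0<..<u} t * t powr (-\<theta>)))"
    proof (cases "t \<in> {0<..<u}")
      case True
      have "(\<integral>\<^sup>+r. ennreal \<bar>C r t\<bar> \<partial>lborel) = ennreal (\<bar>f t\<bar> * ((t powr (-\<theta>) - u powr (-\<theta>)) / \<theta>))"
        unfolding C_def using nn_integral_abs_cmult[OF gC[OF True], of "indicator {0<..<u} t * f t"] True by simp
      also have "\<dots> \<le> ennreal (B * (t powr (-\<theta>) / \<theta>))"
        using f_bounded[of t] \<theta> u True powr_mono2'[of "-\<theta>" t u]
        by (intro ennreal_leI mult_mono divide_right_mono) auto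
      finally show ?thesis using True by simp
    qed (simp add: C_def)
    show "integrable lborel (\<lambda>t. B / \<theta> * (indicator {0<..<u} t * t powr (-\<theta>)))"
      using i0 by simp
  qed simp
  have ik: "integrable (lborel \<Otimes>\<^sub>M lborel) (case_prod k)"
  proof (rule integrable_pair_lborel')
    have "(\<integral>\<^sup>+t. \<integral>\<^sup>+r. ennreal \<bar>k r t\<bar> \<partial>lborel \<partial>lborel)
       = (\<integral>\<^sup>+t. \<integral>\<^sup>+s. ennreal \<bar>indicator {0<..<u} t * marchaud_kernel t s\<bar> \<partial>lborel \<partial>lborel)"
    proof (rule nn_integral_cong)
      fix t
      have "(\<integral>\<^sup>+r. ennreal \<bar>k r t\<bar> \<partial>lborel) = (\<integral>\<^sup>+s. ennreal \<bar>k (t + -1 * s) t\<bar> \<partial>lborel)"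
        by (subst nn_integral_real_affine[where c="-1" and t=t]) auto
      then show "(\<integral>\<^sup>+r. ennreal \<bar>k r t\<bar> \<partial>lborel) = (\<integral>\<^sup>+s. ennreal \<bar>indicator {0<..<u} t * marchaud_kernel t s\<bar> \<partial>lborel)"
        unfolding k_eq .
    qed
    also have "\<dots> \<le> (\<integral>\<^sup>+t. \<integral>\<^sup>+s. ennreal \<bar>marchaud_kernel t s\<bar> \<partial>lborel \<partial>lborel)"
      by (intro nn_integral_mono ennreal_leI) (auto simp: indicator_def)
    also note nn_integral_marchaud_kernel_finite
    finally show "(\<integral>\<^sup>+t. \<integral>\<^sup>+r. ennreal \<bar>k r t\<bar> \<partial>lborel \<partial>lborel) < \<infinity>" .
  qed simp
  have "(LINT t|lborel. LINT s|lborel. indicator {0<..<u} t * marchaud_kernel t s)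
      = (LINT t|lborel. LINT r|lborel. k r t)"
  proof (rule Bochner_Integration.integral_cong)
    fix t
    have "(LINT r|lborel. k r t) = (LINT s|lborel. k (t + -1 * s) t)"
      by (subst lborel_integral_real_affine[where c="-1" and t=t]) auto
    then show "(LINT s|lborel. indicator {0<..<u} t * marchaud_kernel t s) = (LINT r|lborel. k r t)"
      unfolding k_eq by simp
  qed simp
  \<comment> \<open>The cancellation is visible only when t is integrated first. Once
    \<open>A\<close> and \<open>C\<close> are separated, the order is reversed again, because their
    integrals in r are explicit.\<close>
  also have "\<dots> = (LINT r|lborel. LINT t|lborel. k r t)"
    by (rule lborel_pair.Fubini_integral[OF ik])
  also have "\<dots> = (LINT r|lborel. (LINT t|lborel. A r t) - (LINT t|lborel. C r t))"
  proof (rule Bochner_Integration.integral_cong)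
    fix r :: real
    have F: "integrable lborel (\<lambda>t. indicator {a<..<b} t * f t)"
      "integrable lborel (\<lambda>t. indicator {a<..b} t * f t)"
      "integrable lborel (\<lambda>t. indicator {a..<b} t * f t)" for a b :: real
      by (rule integrable_f_indicator[of _ a b]; auto)+
    show "(LINT t|lborel. k r t) = (LINT t|lborel. A r t) - (LINT t|lborel. C r t)"
    proof (cases "r \<in> {0<..<u}")
      case True
      have "(LINT t|lborel. indicator {r<..<u} t * f (t - r)) = (LINT t|lborel. indicator {0<..<u-r} t * f t)"
      proof -
        have "(LINT t|lborel. indicator {r<..<u} t * f (t - r))
          = \<bar>1\<bar> *\<^sub>R (LINT x|lborel. indicator {r<..<u} (r + 1 * x) * f (r + 1 * x - r))"
          by (rule lborel_integral_real_affine) simp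
        also have "(\<lambda>x. indicator {r<..<u} (r + 1 * x) * f (r + 1 * x - r)) = (\<lambda>x. indicator {0<..<u-r} x * f x)"
          by (auto simp: indicator_def fun_eq_iff)
        finally show ?thesis by simp
      qed
      moreover have "integrable lborel (\<lambda>t. indicator {r<..<u} t * f (t - r))"
      proof -
        have "integrable lborel (\<lambda>t. indicator {0<..<u-r} (-r + 1 * t) * f (-r + 1 * t))"
          by (rule lborel_integrable_real_affine[OF F(1)]) simp
        also have "(\<lambda>t. indicator {0<..<u-r} (-r + 1 * t) * f (-r + 1 * t)) = (\<lambda>t. indicator {r<..<u} t * f (t - r))"
          by (auto simp: indicator_def fun_eq_iff)
        finally show ?thesis .
      qed
      moreover have "(LINT t|lborel. k r t) = (LINT t|lborel. r powr (-\<theta>-1) * (indicator {r<..<u} t * f t - indicator {r<..<u} t * f (t - r)))"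
        by (rule Bochner_Integration.integral_cong)
           (use True in \<open>auto simp: k_def indicator_def left_diff_distrib right_diff_distrib mult_ac\<close>)
      ultimately have k: "(LINT t|lborel. k r t) = r powr (-\<theta>-1) *
          ((LINT t|lborel. indicator {r<..<u} t * f t) - (LINT t|lborel. indicator {0<..<u-r} t * f t))"
        using F by simp
      have A: "(LINT t|lborel. A r t) = r powr (-\<theta>-1) * (LINT t|lborel. indicator {u-r..<u} t * f t)"
      proof -
        have "A r t = r powr (-\<theta>-1) * (indicator {u-r..<u} t * f t)" for t
          using True by (auto simp: A_def indicator_def)
        then show ?thesis by simp
      qed
      have C: "(LINT t|lborel. C r t) = r powr (-\<theta>-1) * (LINT t|lborel. indicator {0<..r} t * f t)"
      proof -
        have "C r t = r powr (-\<theta>-1) * (indicator {0<..r} t * f t)" for t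
          using True by (auto simp: C_def indicator_def)
        then show ?thesis by simp
      qed
      have "(LINT t|lborel. indicator {r<..<u} t * f t) + (LINT t|lborel. indicator {0<..r} t * f t)
          = (LINT t|lborel. indicator {0<..<u} t * f t)"
        by (subst Bochner_Integration.integral_add[symmetric], rule F, rule F, rule Bochner_Integration.integral_cong)
           (use True in \<open>auto simp: indicator_def\<close>)
      moreover have "(LINT t|lborel. indicator {u-r..<u} t * f t) + (LINT t|lborel. indicator {0<..<u-r} t * f t)
          = (LINT t|lborel. indicator {0<..<u} t * f t)"
        by (subst Bochner_Integration.integral_add[symmetric], rule F, rule F, rule Bochner_Integration.integral_cong)
           (use True in \<open>auto simp: indicator_def\<close>)
      ultimately have d: "(LINT t|lborel. indicator {r<..<u} t * f t) - (LINT t|lborel. indicator {0<..<u-r} t * f t)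
        = (LINT t|lborel. indicator {u-r..<u} t * f t) - (LINT t|lborel. indicator {0<..r} t * f t)"
        by linarith
      show ?thesis unfolding k A C d by (rule right_diff_distrib)
    next
      case False
      then have "k r t = 0" "A r t = 0" "C r t = 0" for t
        by (auto simp: k_def A_def C_def indicator_def)
      then show ?thesis by simp
    qed
  qed simp
  also have "\<dots> = (LINT r|lborel. LINT t|lborel. A r t) - (LINT r|lborel. LINT t|lborel. C r t)"
    by (rule Bochner_Integration.integral_diff) (rule lborel_pair.integrable_fst[OF iA] lborel_pair.integrable_fst[OF iC])+
  also have "\<dots> = (LINT t|lborel. LINT r|lborel. A r t) - (LINT t|lborel. LINT r|lborel. C r t)"
    by (simp only: lborel_pair.Fubini_integral[OF iA] lborel_pair.Fubini_integral[OF iC])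
  also have "\<dots> = (LINT t|lborel. indicator {0<..<u} t * f t * (((u - t) powr (-\<theta>) - u powr (-\<theta>)) / \<theta>))
      - (LINT t|lborel. indicator {0<..<u} t * f t * ((t powr (-\<theta>) - u powr (-\<theta>)) / \<theta>))"
    by (simp only: has_bochner_integral_integral_eq[OF hA] has_bochner_integral_integral_eq[OF hC])
  also have "\<dots> = (LINT t|lborel. indicator {0<..<u} t * f t * (((u - t) powr (-\<theta>) - u powr (-\<theta>)) / \<theta>)
      - indicator {0<..<u} t * f t * ((t powr (-\<theta>) - u powr (-\<theta>)) / \<theta>))"
    by (rule Bochner_Integration.integral_diff[symmetric])
       (use lborel_pair.integrable_snd[OF iA] lborel_pair.integrable_snd[OF iC]
         in \<open>simp_all only: has_bochner_integral_integral_eq[OF hA] has_bochner_integral_integral_eq[OF hC]\<close>)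
  also have "\<dots> = (LINT t|lborel. (indicator {0<..<u} t * (f t * (u - t) powr (-\<theta>))
      - indicator {0<..<u} t * (f t * t powr (-\<theta>))) / \<theta>)"
    by (rule Bochner_Integration.integral_cong) (use \<theta> in \<open>auto simp: field_simps\<close>)
  also have "\<dots> = ((LINT t|lborel. indicator {0<..<u} t * (f t * (u - t) powr (-\<theta>)))
      - (LINT t|lborel. indicator {0<..<u} t * (f t * t powr (-\<theta>)))) / \<theta>"
    using integrable_mult_bounded[OF i0(1) f_borel f_bounded] integrable_mult_bounded[OF i0(2) f_borel f_bounded]
    by (simp add: mult.left_commute)
  finally show ?thesis using \<theta> by (simp add: field_simps)
qed

text \<open>The boundary term \<open>f t * t powr (-\<theta>)\<close> of \<open>marchaud\<close>
  cancels the last integral of \<open>integral_marchaud_kernel\<close>. What remains is the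
  fractional integral of \<open>f\<close> of order 1 - \<theta>, up to \<Gamma>(1 -
  \<theta>).\<close>

lemma integral_marchaud:
  assumes u: "0 < u" "u \<le> T"
  shows "(LINT t|lborel. indicator {0<..<u} t * marchaud t)
    = (LINT t|lborel. indicator {0<..<u} t * (f t * (u - t) powr (-\<theta>)))"
proof -
  have eq: "indicator {0<..<u} t * marchaud t = indicator {0<..<u} t * (f t * t powr (-\<theta>))
      + \<theta> * (LINT s|lborel. indicator {0<..<u} t * marchaud_kernel t s)" for t
    using u by (auto simp: marchaud_def indicator_def)
  have "integrable lborel (\<lambda>t. indicator {0<..<u} t * (LINT s|lborel. marchaud_kernel t s))"
    using integrable_mult_indicator[OF _ lborel_pair.integrable_fst[OF integrable_marchaud_kernel], of "{0<..<u}"] by simp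
  then have "(LINT t|lborel. indicator {0<..<u} t * marchaud t) = (LINT t|lborel. indicator {0<..<u} t * (f t * t powr (-\<theta>)))
     + \<theta> * (LINT t|lborel. LINT s|lborel. indicator {0<..<u} t * marchaud_kernel t s)"
    unfolding eq using integrable_f_powr[OF u(2)] by simp
  then show ?thesis using integral_marchaud_kernel[OF u] by simp
qed

text \<open>For v in (0,T), its integral over t is \<Gamma>(\<theta>) times the Riemann-Liouville
  integral of order \<theta> of \<open>marchaud\<close> at v.\<close>

definition abel_kernel :: "real \<Rightarrow> real \<Rightarrow> real" where
  "abel_kernel v t = marchaud t * (indicator {0<..<T} v * indicator {0<..<v} t * (v - t) powr (\<theta> - 1))"

lemma abel_kernel_measurable [measurable]:
  "case_prod abel_kernel \<in> borel_measurable (borel \<Otimes>\<^sub>M borel)"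
  unfolding abel_kernel_def by measurable

lemma has_bochner_integral_abel_kernel:
  assumes "0 < u" "u \<le> T"
  shows "has_bochner_integral lborel (\<lambda>v. indicator {..<u} v * abel_kernel v t)
     (marchaud t * (indicator {0<..<u} t * ((u - t) powr \<theta> / \<theta>)))"
proof -
  have "has_bochner_integral lborel (\<lambda>v. indicator {0<..<u} t * (indicator {t<..<u} v * (v - t) powr (\<theta> - 1)))
      (indicator {0<..<u} t * ((u - t) powr \<theta> / \<theta>))"
    using has_bochner_integral_powr_right[of "\<theta> - 1" t u] \<theta> by (auto simp: indicator_def)
  then have "has_bochner_integral lborel (\<lambda>v. marchaud t * (indicator {0<..<u} t * (indicator {t<..<u} v * (v - t) powr (\<theta> - 1))))
      (marchaud t * (indicator {0<..<u} t * ((u - t) powr \<theta> / \<theta>)))"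
    by (rule has_bochner_integral_mult_right)
  also have "(\<lambda>v. marchaud t * (indicator {0<..<u} t * (indicator {t<..<u} v * (v - t) powr (\<theta> - 1))))
     = (\<lambda>v. indicator {..<u} v * abel_kernel v t)"
    using assms by (auto simp: indicator_def abel_kernel_def fun_eq_iff)
  finally show ?thesis .
qed

lemma integrable_abel_kernel: "integrable (lborel \<Otimes>\<^sub>M lborel) (case_prod abel_kernel)"
proof (rule integrable_pair_lborel_dominated')
  fix t
  have "(\<integral>\<^sup>+v. ennreal \<bar>abel_kernel v t\<bar> \<partial>lborel)
     = (\<integral>\<^sup>+v. ennreal \<bar>marchaud t * (indicator {t<..<T} v * (v - t) powr (\<theta> - 1))\<bar> \<partial>lborel)"
  proof (cases "t \<in> {0<..<T}")
    case True then show ?thesis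
      by (intro nn_integral_cong) (auto simp: abel_kernel_def indicator_def)
  qed (simp add: abel_kernel_def marchaud_outside)
  also have "\<dots> \<le> ennreal (T powr \<theta> / \<theta> * \<bar>marchaud t\<bar>)"
  proof (cases "t \<in> {0<..<T}")
    case True
    have "(\<integral>\<^sup>+v. ennreal \<bar>marchaud t * (indicator {t<..<T} v * (v - t) powr (\<theta> - 1))\<bar> \<partial>lborel)
        = ennreal (\<bar>marchaud t\<bar> * ((T - t) powr (\<theta> - 1 + 1) / (\<theta> - 1 + 1)))"
      by (rule nn_integral_abs_cmult[OF has_bochner_integral_powr_right]) (use True \<theta> in auto)
    also have "\<dots> \<le> ennreal (\<bar>marchaud t\<bar> * (T powr \<theta> / \<theta>))"
      using True \<theta> powr_mono2[of \<theta> "T - t" T] by (intro ennreal_leI mult_left_mono) (auto intro: divide_right_mono)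
    finally show ?thesis by (simp add: mult.commute)
  qed (simp add: marchaud_outside)
  finally show "(\<integral>\<^sup>+v. ennreal \<bar>abel_kernel v t\<bar> \<partial>lborel) \<le> ennreal (T powr \<theta> / \<theta> * \<bar>marchaud t\<bar>)" .
  show "integrable lborel (\<lambda>t. T powr \<theta> / \<theta> * \<bar>marchaud t\<bar>)"
    using integrable_marchaud by simp
qed measurable

text \<open>The weight (u - t) powr \<theta> / \<theta> is the integral of (u - w) powr (\<theta> -
  1) over w in (t,u). Exchanging the integrals brings in \<open>integral_marchaud\<close> at each
  level w; exchanging once more leaves a Beta integral with parameters 1 - \<theta> and \<theta>.
  These add up to 1, so its value does not depend on s and comes out as a constant.\<close>

lemma integral_marchaud_powr:
  assumes u: "0 < u" "u \<le> T"
  shows "(LINT t|lborel. marchaud t * (indicator {0<..<u} t * ((u - t) powr \<theta> / \<theta>)))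
    = Gamma (1 - \<theta>) * Gamma \<theta> * (LINT s|lborel. indicator {0<..<u} s * f s)"
proof -
  define k where "k t w = marchaud t * (indicator {0<..<u} w * indicator {0<..<w} t * (u - w) powr (\<theta> - 1))" for t w
  define j where "j s w = (indicator {0<..<u} s * f s) * (indicator {s<..<u} w * ((w - s) powr (-\<theta>) * (u - w) powr (\<theta> - 1)))" for s w
  have hk: "has_bochner_integral lborel (\<lambda>w. k t w) (marchaud t * (indicator {0<..<u} t * ((u - t) powr \<theta> / \<theta>)))" for t
  proof -
    have "has_bochner_integral lborel (\<lambda>w. indicator {0<..<u} t * (indicator {t<..<u} w * (u - w) powr (\<theta> - 1)))
        (indicator {0<..<u} t * ((u - t) powr \<theta> / \<theta>))"
      using has_bochner_integral_powr_left[of "\<theta> - 1" t u] \<theta> by (auto simp: indicator_def)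
    then have "has_bochner_integral lborel (\<lambda>w. marchaud t * (indicator {0<..<u} t * (indicator {t<..<u} w * (u - w) powr (\<theta> - 1))))
        (marchaud t * (indicator {0<..<u} t * ((u - t) powr \<theta> / \<theta>)))"
      by (rule has_bochner_integral_mult_right)
    also have "(\<lambda>w. marchaud t * (indicator {0<..<u} t * (indicator {t<..<u} w * (u - w) powr (\<theta> - 1)))) = k t"
      by (auto simp: indicator_def k_def fun_eq_iff)
    finally show ?thesis .
  qed
  have ik: "integrable (lborel \<Otimes>\<^sub>M lborel) (case_prod k)"
  proof (rule integrable_pair_lborel_dominated)
    show "case_prod k \<in> borel_measurable (borel \<Otimes>\<^sub>M borel)" unfolding k_def by measurable
    fix t
    show "(\<integral>\<^sup>+w. ennreal \<bar>k t w\<bar> \<partial>lborel) \<le> ennreal (T powr \<theta> / \<theta> * \<bar>marchaud t\<bar>)"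
    proof (cases "t \<in> {0<..<u}")
      case True
      have "(\<integral>\<^sup>+w. ennreal \<bar>k t w\<bar> \<partial>lborel)
        = (\<integral>\<^sup>+w. ennreal \<bar>marchaud t * (indicator {t<..<u} w * (u - w) powr (\<theta> - 1))\<bar> \<partial>lborel)"
        using True by (intro nn_integral_cong) (auto simp: k_def indicator_def)
      also have "\<dots> = ennreal (\<bar>marchaud t\<bar> * ((u - t) powr (\<theta> - 1 + 1) / (\<theta> - 1 + 1)))"
        by (rule nn_integral_abs_cmult[OF has_bochner_integral_powr_left]) (use True \<theta> in auto)
      also have "\<dots> \<le> ennreal (\<bar>marchaud t\<bar> * (T powr \<theta> / \<theta>))"
        using True \<theta> u powr_mono2[of \<theta> "u - t" T] by (intro ennreal_leI mult_left_mono) (auto intro: divide_right_mono)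
      finally show ?thesis by (simp add: mult.commute)
    next
      case False
      then have "k t w = 0" for w by (auto simp: k_def indicator_def)
      then show ?thesis by simp
    qed
    show "integrable lborel (\<lambda>t. T powr \<theta> / \<theta> * \<bar>marchaud t\<bar>)"
      using integrable_marchaud by simp
  qed
  have gj: "has_bochner_integral lborel (\<lambda>w. indicator {s<..<u} w * ((w - s) powr (-\<theta>) * (u - w) powr (\<theta> - 1)))
     (Gamma (1 - \<theta>) * Gamma \<theta>)" if "s < u" for s
    using has_bochner_integral_Beta_Ioo[of "1 - \<theta>" \<theta> s u] that \<theta> by (simp add: Beta_def)
  have hj: "has_bochner_integral lborel (\<lambda>w. j s w) ((indicator {0<..<u} s * f s) * (Gamma (1 - \<theta>) * Gamma \<theta>))" for s
    unfolding j_def by (rule has_bochner_integral_mult_right) (use gj in \<open>auto split: split_indicator_asm\<close>)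
  have ij: "integrable (lborel \<Otimes>\<^sub>M lborel) (case_prod j)"
  proof (rule integrable_pair_lborel_dominated)
    show "case_prod j \<in> borel_measurable (borel \<Otimes>\<^sub>M borel)" unfolding j_def by measurable
    fix s
    show "(\<integral>\<^sup>+w. ennreal \<bar>j s w\<bar> \<partial>lborel) \<le> ennreal (\<bar>indicator {0<..<u} s * f s\<bar> * (Gamma (1 - \<theta>) * Gamma \<theta>))"
    proof (cases "s \<in> {0<..<u}")
      case True
      then show ?thesis unfolding j_def by (subst nn_integral_abs_cmult[OF gj]) auto
    qed (simp add: j_def)
    show "integrable lborel (\<lambda>s. \<bar>indicator {0<..<u} s * f s\<bar> * (Gamma (1 - \<theta>) * Gamma \<theta>))"
      by (intro integrable_mult_left integrable_abs integrable_f_indicator[of _ 0 u]) auto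
  qed
  have "(LINT t|lborel. marchaud t * (indicator {0<..<u} t * ((u - t) powr \<theta> / \<theta>)))
     = (LINT t|lborel. LINT w|lborel. k t w)"
    by (simp only: has_bochner_integral_integral_eq[OF hk])
  also have "\<dots> = (LINT w|lborel. LINT t|lborel. k t w)"
    by (rule lborel_pair.Fubini_integral[OF ik, symmetric])
  also have "\<dots> = (LINT w|lborel. LINT s|lborel. j s w)"
  proof (rule Bochner_Integration.integral_cong)
    fix w :: real
    show "(LINT t|lborel. k t w) = (LINT s|lborel. j s w)"
    proof (cases "w \<in> {0<..<u}")
      case True
      have "k t w = (u - w) powr (\<theta> - 1) * (indicator {0<..<w} t * marchaud t)" for t
        using True by (simp add: k_def)
      moreover have "j s w = (u - w) powr (\<theta> - 1) * (indicator {0<..<w} s * (f s * (w - s) powr (-\<theta>)))" for s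
        using True by (auto simp: j_def indicator_def)
      ultimately show ?thesis
        using integral_marchaud[of w] True u by simp
    next
      case False
      then have "k t w = 0" "j t w = 0" for t by (auto simp: k_def j_def indicator_def)
      then show ?thesis by simp
    qed
  qed simp
  also have "\<dots> = (LINT s|lborel. LINT w|lborel. j s w)"
    by (rule lborel_pair.Fubini_integral[OF ij])
  also have "\<dots> = Gamma (1 - \<theta>) * Gamma \<theta> * (LINT s|lborel. indicator {0<..<u} s * f s)"
    unfolding has_bochner_integral_integral_eq[OF hj] integral_mult_left_zero by (rule mult.commute)
  finally show ?thesis .
qed

text \<open>Both sides have the same indefinite integral: up to the constant, the Abel transform inverts
  the Marchaud derivative because \<open>B(1 - \<theta>, \<theta>) = \<Gamma>(1 - \<theta>) \<Gamma>(\<theta>)\<close>.\<close>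

lemma abel_inversion:
  "AE v in lborel. (LINT t|lborel. abel_kernel v t) = Gamma (1 - \<theta>) * Gamma \<theta> * (indicator {0<..<T} v * f v)"
proof -
  define c where "c = Gamma (1 - \<theta>) * Gamma \<theta>"
  define d where "d v = (LINT t|lborel. abel_kernel v t) - c * (indicator {0<..<T} v * f v)" for v
  have i1: "integrable lborel (\<lambda>v. LINT t|lborel. abel_kernel v t)"
    by (rule lborel_pair.integrable_fst[OF integrable_abel_kernel])
  have i2: "integrable lborel (\<lambda>v. indicator {0<..<T} v * f v)"
    by (rule integrable_f_indicator[of _ 0 T]) auto
  \<comment> \<open>Integrating \<open>abel_kernel\<close> over v < u produces exactly the weight (u
    - t) powr \<theta> / \<theta> of \<open>integral_marchaud_powr\<close>. Other values of u reduce
    to these, since d vanishes off (0,T).\<close>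
  have zero: "(LINT v:{..<u}|lborel. d v) = 0" if u: "0 < u" "u \<le> T" for u
  proof -
    have ik: "integrable (lborel \<Otimes>\<^sub>M lborel) (\<lambda>(v, t). indicator {..<u} v * abel_kernel v t)"
    proof (rule Bochner_Integration.integrable_bound[OF integrable_abel_kernel])
      show "(\<lambda>(v, t). indicator {..<u} v * abel_kernel v t) \<in> borel_measurable (lborel \<Otimes>\<^sub>M lborel)"
        by simp
    qed (auto simp: indicator_def)
    have "(LINT v:{..<u}|lborel. LINT t|lborel. abel_kernel v t)
        = (LINT v|lborel. LINT t|lborel. indicator {..<u} v * abel_kernel v t)"
      by (simp add: set_lebesgue_integral_def)
    also have "\<dots> = (LINT t|lborel. LINT v|lborel. indicator {..<u} v * abel_kernel v t)"
      by (rule lborel_pair.Fubini_integral[OF ik, symmetric])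
    also have "\<dots> = c * (LINT s|lborel. indicator {0<..<u} s * f s)"
      unfolding has_bochner_integral_integral_eq[OF has_bochner_integral_abel_kernel[OF u]]
      using integral_marchaud_powr[OF u] by (simp add: c_def)
    also have "(LINT s|lborel. indicator {0<..<u} s * f s) = (LINT s:{..<u}|lborel. indicator {0<..<T} s * f s)"
      unfolding set_lebesgue_integral_def using u
      by (intro Bochner_Integration.integral_cong) (auto simp: indicator_def)
    finally show ?thesis
      unfolding d_def using integrable_mult_indicator[OF _ i1, of "{..<u}"] integrable_mult_indicator[OF _ integrable_mult_right[OF i2], of "{..<u}" c]
      by (subst set_integral_diff(2)) (auto simp: set_integrable_def)
  qed
  have "AE v in lborel. d v = 0"
  proof (rule AE_zero_if_integral_lessThan_zero)
    show "integrable lborel d" unfolding d_def using i1 i2 by simp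
    have out: "d v = 0" if "v \<notin> {0<..<T}" for v
      using that by (simp add: d_def abel_kernel_def)
    fix u :: real
    consider "u \<le> 0" | "0 < u" "u \<le> T" | "T < u" by linarith
    then show "(LINT v:{..<u}|lborel. d v) = 0"
    proof cases
      case 1
      then have "indicator {..<u} v *\<^sub>R d v = 0" for v using out[of v] by (auto simp: indicator_def)
      then show ?thesis unfolding set_lebesgue_integral_def by (simp only: integral_zero)
    next
      case 3
      then have "indicator {..<u} v *\<^sub>R d v = indicator {..<T} v *\<^sub>R d v" for v
        using out[of v] by (auto simp: indicator_def)
      then show ?thesis using zero[of T] T unfolding set_lebesgue_integral_def by (simp only: order_refl)
    qed (rule zero)
  qed
  then show ?thesis by (simp add: d_def c_def)
qed

text \<open>This is fractional integration by parts. Fubini moves the kernel (u - t) powr (\<theta>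
  - 1) from \<psi> over to \<open>marchaud\<close>, where it forms the Abel transform that
  \<open>abel_inversion\<close> evaluates; boundedness of \<psi> preserves absolute
  integrability.\<close>

lemma integral_marchaud_duality:
  assumes [measurable]: "\<psi> \<in> borel_measurable borel" and C: "\<And>x. \<bar>\<psi> x\<bar> \<le> C"
  shows "(LINT t|lborel. marchaud t * (LINT u|lborel. indicator {t<..<T} u * (\<psi> u * (u - t) powr (\<theta> - 1))))
    = Gamma (1 - \<theta>) * Gamma \<theta> * (LINT u|lborel. indicator {0<..<T} u * (\<psi> u * f u))"
proof -
  have "0 \<le> C" using C[of 0] by linarith
  have i: "integrable (lborel \<Otimes>\<^sub>M lborel) (\<lambda>(u, t). \<psi> u * abel_kernel u t)"
  proof (rule Bochner_Integration.integrable_bound)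
    show "integrable (lborel \<Otimes>\<^sub>M lborel) (\<lambda>x. C * case_prod abel_kernel x)"
      using integrable_abel_kernel by simp
    show "(\<lambda>(u, t). \<psi> u * abel_kernel u t) \<in> borel_measurable (lborel \<Otimes>\<^sub>M lborel)" by simp
    show "AE x in lborel \<Otimes>\<^sub>M lborel. norm (case x of (u, t) \<Rightarrow> \<psi> u * abel_kernel u t) \<le> norm (C * case_prod abel_kernel x)"
      using C \<open>0 \<le> C\<close> by (intro AE_I2) (simp add: abs_mult mult_right_mono split: prod.split)
  qed
  have "marchaud t * (LINT u|lborel. indicator {t<..<T} u * (\<psi> u * (u - t) powr (\<theta> - 1)))
     = (LINT u|lborel. \<psi> u * abel_kernel u t)" for t
  proof (cases "t \<in> {0<..<T}")
    case True
    have "marchaud t * (LINT u|lborel. indicator {t<..<T} u * (\<psi> u * (u - t) powr (\<theta> - 1)))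
      = (LINT u|lborel. marchaud t * (indicator {t<..<T} u * (\<psi> u * (u - t) powr (\<theta> - 1))))" by simp
    also have "\<dots> = (LINT u|lborel. \<psi> u * abel_kernel u t)"
      using True by (intro Bochner_Integration.integral_cong) (auto simp: abel_kernel_def indicator_def)
    finally show ?thesis .
  qed (simp add: abel_kernel_def marchaud_outside)
  then have "(LINT t|lborel. marchaud t * (LINT u|lborel. indicator {t<..<T} u * (\<psi> u * (u - t) powr (\<theta> - 1))))
    = (LINT t|lborel. LINT u|lborel. \<psi> u * abel_kernel u t)" by simp
  also have "\<dots> = (LINT u|lborel. LINT t|lborel. \<psi> u * abel_kernel u t)"
    by (rule lborel_pair.Fubini_integral[OF i])
  also have "\<dots> = (LINT u|lborel. Gamma (1 - \<theta>) * Gamma \<theta> * (indicator {0<..<T} u * (\<psi> u * f u)))"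
    by (rule integral_cong_AE) (use abel_inversion in auto)
  finally show ?thesis by simp
qed

end

section \<open>The pathwise integral as a limit of forward averages\<close>

lemma ex_antiderivative:
  fixes g :: "real \<Rightarrow> real"
  assumes "continuous_on UNIV g"
  obtains G where "\<And>x. (G has_real_derivative g x) (at x)"
proof -
  have "\<exists>F. \<forall>x. -\<infinity> < ereal x \<longrightarrow> ereal x < \<infinity> \<longrightarrow> (F has_vector_derivative g x) (at x)"
    by (rule einterval_antiderivative) (use assms in \<open>auto simp: continuous_on_eq_continuous_at\<close>)
  then show ?thesis using that by (auto simp: has_real_derivative_iff_has_vector_derivative)
qed

lemma continuous_on_holder:
  fixes g :: "real \<Rightarrow> real"
  assumes H: "\<And>s t. s \<in> S \<Longrightarrow> t \<in> S \<Longrightarrow> \<bar>g t - g s\<bar> \<le> C * \<bar>t - s\<bar> powr \<alpha>" and "0 < \<alpha>"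
  shows "continuous_on S g"
  unfolding continuous_on_def
proof
  fix x assume "x \<in> S"
  show "(g \<longlongrightarrow> g x) (at x within S)"
  proof (rule Lim_null_comparison[THEN LIM_zero_cancel])
    show "\<forall>\<^sub>F y in at x within S. norm (g y - g x) \<le> C * \<bar>y - x\<bar> powr \<alpha>"
      using H[OF \<open>x \<in> S\<close>] by (auto simp: eventually_at_filter)
    have "((\<lambda>y. C * \<bar>y - x\<bar> powr \<alpha>) \<longlongrightarrow> C * \<bar>x - x\<bar> powr \<alpha>) (at x within S)"
      by (intro tendsto_intros) (use \<open>0 < \<alpha>\<close> in auto)
    then show "((\<lambda>y. C * \<bar>y - x\<bar> powr \<alpha>) \<longlongrightarrow> 0) (at x within S)" by simp
  qed
qed

text \<open>The order of this right-sided derivative is 1 - \<theta>, not \<theta>. The phase and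
  the factor 1/\<Gamma>(\<theta>) of \<open>D_right\<close> are left out, so that limits are taken
  in the reals.\<close>

definition rmarchaud :: "real \<Rightarrow> real \<Rightarrow> (real \<Rightarrow> real) \<Rightarrow> real \<Rightarrow> real" where
  "rmarchaud \<theta> T h t = h t * (T - t) powr (\<theta> - 1)
     + (1 - \<theta>) * (LINT s|lborel. indicator {t<..<T} s * ((h t - h s) * (s - t) powr (\<theta> - 2)))"

lemma D_right_eq_rmarchaud:
  "D_right (1 - \<theta>) T h t = cis (pi * (1 - \<theta>)) * of_real (rmarchaud \<theta> T h t / Gamma \<theta>)"
proof -
  have "(LINT s:{t<..<T}|lborel. (h t - h s) / (s - t) powr (1 - \<theta> + 1))
     = (LINT s|lborel. indicator {t<..<T} s * ((h t - h s) * (s - t) powr (\<theta> - 2)))"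
    unfolding set_lebesgue_integral_def
  proof (rule Bochner_Integration.integral_cong)
    fix s
    show "indicator {t<..<T} s *\<^sub>R ((h t - h s) / (s - t) powr (1 - \<theta> + 1))
      = indicator {t<..<T} s * ((h t - h s) * (s - t) powr (\<theta> - 2))"
      using powr_minus[of "s - t" "1 - \<theta> + 1"] by (simp add: divide_inverse)
  qed simp
  moreover have "h t / (T - t) powr (1 - \<theta>) = h t * (T - t) powr (\<theta> - 1)"
    using powr_minus[of "T - t" "1 - \<theta>"] by (simp add: divide_inverse)
  ultimately show ?thesis
    unfolding D_right_def rmarchaud_def by (simp add: mult_ac)
qed

lemma rmarchaud_measurable [measurable]:
  assumes [measurable]: "h \<in> borel_measurable borel"
  shows "rmarchaud \<theta> T h \<in> borel_measurable borel"
  unfolding rmarchaud_def[abs_def] by measurable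

text \<open>For an antiderivative \<open>h\<close> of \<psi> vanishing at T, the increment of
  \<open>h\<close> from t to s is the integral of \<psi> between them. Integrating the kernel (s -
  t) powr (\<theta> - 2) over s beyond u lowers the singularity to (u - t) powr (\<theta> - 1), and
  the contribution of the end point T cancels
  \<open>h t * (T - t) powr (\<theta> - 1)\<close>.\<close>

lemma rmarchaud_antiderivative:
  fixes h :: "real \<Rightarrow> real"
  assumes \<theta>: "0 < \<theta>" "\<theta> < 1" and t: "t < T"
    and [measurable]: "\<psi> \<in> borel_measurable borel" and C: "\<And>x. \<bar>\<psi> x\<bar> \<le> C"
    and h: "\<And>s. s \<le> T \<Longrightarrow> h s = - (LINT u|lborel. indicator {s<..<T} u * \<psi> u)"
  shows "rmarchaud \<theta> T h t = - (LINT u|lborel. indicator {t<..<T} u * (\<psi> u * (u - t) powr (\<theta> - 1)))"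
proof -
  \<comment> \<open>The indicators encode t < u \<le> s < T: integrating over u recovers the
    increment of \<open>h\<close>, integrating over s an explicit difference of powers.\<close>
  define k where "k s u = (indicator {t<..<T} u * \<psi> u) * (indicator {u..<T} s * (s - t) powr (\<theta> - 2))" for s u
  have C0: "0 \<le> C" using C[of 0] by linarith
  have [measurable]: "case_prod k \<in> borel_measurable (borel \<Otimes>\<^sub>M borel)" unfolding k_def by measurable
  have g: "has_bochner_integral lborel (\<lambda>s. indicator {u..<T} s * (s - t) powr (\<theta> - 2))
      (((u - t) powr (\<theta> - 1) - (T - t) powr (\<theta> - 1)) / (1 - \<theta>))" if "u \<in> {t<..<T}" for u
  proof -
    have "((T - t) powr (\<theta> - 2 + 1) - (u - t) powr (\<theta> - 2 + 1)) / (\<theta> - 2 + 1)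
      = ((u - t) powr (\<theta> - 1) - (T - t) powr (\<theta> - 1)) / (1 - \<theta>)"
      using \<theta> by (simp add: field_simps)
    then show ?thesis
      using has_bochner_integral_powr_Ico_right[of "\<theta> - 2" t u T] that \<theta> by simp
  qed
  have hk: "has_bochner_integral lborel (\<lambda>s. k s u)
      (indicator {t<..<T} u * \<psi> u * (((u - t) powr (\<theta> - 1) - (T - t) powr (\<theta> - 1)) / (1 - \<theta>)))" for u
    unfolding k_def by (rule has_bochner_integral_mult_right) (use g in \<open>auto split: split_indicator_asm\<close>)
  have i\<psi>: "integrable lborel (\<lambda>u. indicator {a<..<T} u * \<psi> u)" for a
  proof (cases "a \<le> T")
    case True
    have "integrable lborel (\<lambda>u. \<psi> u * indicator {a<..<T} u)"
      by (intro integrable_mult_bounded[OF _ _ C] integrable_real_indicator) (use True in auto)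
    then show ?thesis by (simp add: mult.commute)
  qed simp
  have i1: "integrable lborel (\<lambda>u. indicator {t<..<T} u * (u - t) powr (\<theta> - 1))"
    using has_bochner_integral_powr_right[of "\<theta> - 1" t T] \<theta> t by (auto intro: integrable.intros)
  then have i2: "integrable lborel (\<lambda>u. indicator {t<..<T} u * (\<psi> u * (u - t) powr (\<theta> - 1)))"
    using integrable_mult_bounded[OF i1 _ C] by (simp add: mult.left_commute)
  have ik: "integrable (lborel \<Otimes>\<^sub>M lborel) (case_prod k)"
  proof (rule integrable_pair_lborel_dominated')
    fix u
    show "(\<integral>\<^sup>+s. ennreal \<bar>k s u\<bar> \<partial>lborel) \<le> ennreal (C / (1 - \<theta>) * (indicator {t<..<T} u * (u - t) powr (\<theta> - 1)))"
    proof (cases "u \<in> {t<..<T}")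
      case True
      have "(\<integral>\<^sup>+s. ennreal \<bar>k s u\<bar> \<partial>lborel)
         = ennreal (\<bar>\<psi> u\<bar> * (((u - t) powr (\<theta> - 1) - (T - t) powr (\<theta> - 1)) / (1 - \<theta>)))"
        unfolding k_def using True by (subst nn_integral_abs_cmult[OF g]) auto
      also have "\<dots> \<le> ennreal (C * ((u - t) powr (\<theta> - 1) / (1 - \<theta>)))"
        using C[of u] C0 True \<theta> powr_mono2'[of "\<theta> - 1" "u - t" "T - t"]
        by (intro ennreal_leI mult_mono divide_right_mono) auto
      finally show ?thesis using True by simp
    qed (simp add: k_def)
    show "integrable lborel (\<lambda>u. C / (1 - \<theta>) * (indicator {t<..<T} u * (u - t) powr (\<theta> - 1)))"
      using i1 by simp
  qed simp
  have "(LINT s|lborel. indicator {t<..<T} s * ((h t - h s) * (s - t) powr (\<theta> - 2)))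
    = (LINT s|lborel. - (LINT u|lborel. k s u))"
  proof (rule Bochner_Integration.integral_cong)
    fix s
    show "indicator {t<..<T} s * ((h t - h s) * (s - t) powr (\<theta> - 2)) = - (LINT u|lborel. k s u)"
    proof (cases "s \<in> {t<..<T}")
      case True
      have "(LINT u|lborel. k s u) = (LINT u|lborel. (s - t) powr (\<theta> - 2) *
          (indicator {t<..<T} u * \<psi> u - indicator {s<..<T} u * \<psi> u))"
        using True by (intro Bochner_Integration.integral_cong) (auto simp: k_def indicator_def)
      also have "\<dots> = (s - t) powr (\<theta> - 2) * (h s - h t)"
        using True i\<psi> by (simp add: h)
      finally show ?thesis using True by (simp add: algebra_simps)
    next
      case False
      then have "k s u = 0" for u by (auto simp: k_def indicator_def)
      then show ?thesis using False by simp
    qed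
  qed simp
  also have "\<dots> = - (LINT u|lborel. LINT s|lborel. k s u)"
    using lborel_pair.Fubini_integral[OF ik] by simp
  also have "\<dots> = - (LINT u|lborel. (indicator {t<..<T} u * (\<psi> u * (u - t) powr (\<theta> - 1))
      - (T - t) powr (\<theta> - 1) * (indicator {t<..<T} u * \<psi> u)) / (1 - \<theta>))"
    unfolding has_bochner_integral_integral_eq[OF hk]
    by (intro arg_cong[where f=uminus] Bochner_Integration.integral_cong) (auto simp: algebra_simps diff_divide_distrib)
  also have "\<dots> = - ((LINT u|lborel. indicator {t<..<T} u * (\<psi> u * (u - t) powr (\<theta> - 1))) + (T - t) powr (\<theta> - 1) * h t) / (1 - \<theta>)"
    using i2 i\<psi>[of t] t h[of t] by (simp add: minus_divide_left)
  finally show ?thesis unfolding rmarchaud_def using \<theta> by (simp add: field_simps)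
qed

text \<open>The Hoelder exponent lifts the exponent of the kernel from \<theta> - 2 to \<alpha> +
  \<theta> - 2 > -1. The resulting integrable majorant involves \<open>h\<close> only through the
  constant C.\<close>

lemma holder_kernel_bound:
  fixes h :: "real \<Rightarrow> real"
  assumes \<theta>: "0 < \<theta>" "\<theta> < 1" and \<alpha>: "1 - \<theta> < \<alpha>" and t: "t < T"
    and H: "\<And>s. \<bar>h t - h s\<bar> \<le> C * \<bar>t - s\<bar> powr \<alpha>"
  shows "\<bar>indicator {t<..<T} s * ((h t - h s) * (s - t) powr (\<theta> - 2))\<bar>
     \<le> C * (indicator {t<..<T} s * (s - t) powr (\<alpha> + \<theta> - 2))"
proof (cases "s \<in> {t<..<T}")
  case True
  have "\<bar>h t - h s\<bar> * (s - t) powr (\<theta> - 2) \<le> (C * \<bar>t - s\<bar> powr \<alpha>) * (s - t) powr (\<theta> - 2)"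
    by (rule mult_right_mono[OF H]) simp
  also have "\<dots> = C * (s - t) powr (\<alpha> + \<theta> - 2)"
    using True powr_add[of "s - t" \<alpha> "\<theta> - 2"] by (simp add: abs_minus_commute add_diff_eq)
  finally show ?thesis using True by (simp add: abs_mult)
qed simp

text \<open>The bound depends neither on t nor on \<open>h\<close> beyond its constant C, so it can
  serve as a common majorant for a whole sequence of integrators.\<close>

lemma rmarchaud_bounded:
  fixes h :: "real \<Rightarrow> real"
  assumes \<theta>: "0 < \<theta>" "\<theta> < 1" and \<alpha>: "1 - \<theta> < \<alpha>" and t: "t \<in> {0<..<T}"
    and [measurable]: "h \<in> borel_measurable borel"
    and H: "\<And>s t. \<bar>h t - h s\<bar> \<le> C * \<bar>t - s\<bar> powr \<alpha>" and "h T = 0"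
  shows "\<bar>rmarchaud \<theta> T h t\<bar> \<le> C * T powr (\<alpha> + \<theta> - 1) * (1 + (1 - \<theta>) / (\<alpha> + \<theta> - 1))"
proof -
  have C: "0 \<le> C" using H[of 1 0] by simp
  have hb: "has_bochner_integral lborel (\<lambda>s. indicator {t<..<T} s * (s - t) powr (\<alpha> + \<theta> - 2))
      ((T - t) powr (\<alpha> + \<theta> - 1) / (\<alpha> + \<theta> - 1))"
    using has_bochner_integral_powr_right[of "\<alpha> + \<theta> - 2" t T] \<theta> \<alpha> t by simp
  have bnd: "\<bar>indicator {t<..<T} s * ((h t - h s) * (s - t) powr (\<theta> - 2))\<bar>
     \<le> C * (indicator {t<..<T} s * (s - t) powr (\<alpha> + \<theta> - 2))" for s
    by (rule holder_kernel_bound[OF \<theta> \<alpha>]) (use t H in auto)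
  have iw: "integrable lborel (\<lambda>s. C * (indicator {t<..<T} s * (s - t) powr (\<alpha> + \<theta> - 2)))"
    using hb by (auto intro: integrable.intros)
  have "\<bar>LINT s|lborel. indicator {t<..<T} s * ((h t - h s) * (s - t) powr (\<theta> - 2))\<bar>
     \<le> (LINT s|lborel. C * (indicator {t<..<T} s * (s - t) powr (\<alpha> + \<theta> - 2)))"
    by (rule order_trans[OF integral_abs_bound integral_mono'[OF iw bnd]]) (use C in simp)
  also have "\<dots> = C * ((T - t) powr (\<alpha> + \<theta> - 1) / (\<alpha> + \<theta> - 1))"
    using has_bochner_integral_integral_eq[OF hb] by simp
  finally have 1: "\<bar>LINT s|lborel. indicator {t<..<T} s * ((h t - h s) * (s - t) powr (\<theta> - 2))\<bar> \<le> \<dots>" .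
  \<comment> \<open>Here \<open>h T = 0\<close> matters: it makes \<open>h t\<close> an increment of
    size at most C (T - t) powr \<alpha>, which absorbs the singularity of (T - t) powr (\<theta> -
    1) at T.\<close>
  have "\<bar>h t\<bar> * (T - t) powr (\<theta> - 1) \<le> (C * \<bar>t - T\<bar> powr \<alpha>) * (T - t) powr (\<theta> - 1)"
    using H[of t T] \<open>h T = 0\<close> by (intro mult_right_mono) auto
  also have "\<dots> = C * (T - t) powr (\<alpha> + \<theta> - 1)"
    using t powr_add[of "T - t" \<alpha> "\<theta> - 1"] by (simp add: abs_minus_commute add_diff_eq)
  finally have 2: "\<bar>h t * (T - t) powr (\<theta> - 1)\<bar> \<le> C * (T - t) powr (\<alpha> + \<theta> - 1)"
    by (simp add: abs_mult)
  have "\<bar>rmarchaud \<theta> T h t\<bar> \<le> C * (T - t) powr (\<alpha> + \<theta> - 1)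
      + (1 - \<theta>) * (C * ((T - t) powr (\<alpha> + \<theta> - 1) / (\<alpha> + \<theta> - 1)))"
    unfolding rmarchaud_def using \<theta> 2 mult_left_mono[OF 1, of "1 - \<theta>"]
    by (intro order_trans[OF abs_triangle_ineq] add_mono) (simp_all add: abs_mult)
  also have "\<dots> = C * (T - t) powr (\<alpha> + \<theta> - 1) * (1 + (1 - \<theta>) / (\<alpha> + \<theta> - 1))"
    by (simp add: algebra_simps)
  also have "\<dots> \<le> C * T powr (\<alpha> + \<theta> - 1) * (1 + (1 - \<theta>) / (\<alpha> + \<theta> - 1))"
    using \<theta> \<alpha> t C by (intro mult_right_mono mult_left_mono powr_mono2) auto
  finally show ?thesis .
qed

lemma rmarchaud_LIMSEQ:
  fixes h :: "nat \<Rightarrow> real \<Rightarrow> real"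
  assumes \<theta>: "0 < \<theta>" "\<theta> < 1" and \<alpha>: "1 - \<theta> < \<alpha>" and t: "t < T"
    and [measurable]: "\<And>n. h n \<in> borel_measurable borel" "h' \<in> borel_measurable borel"
    and H: "\<And>n s t. \<bar>h n t - h n s\<bar> \<le> C * \<bar>t - s\<bar> powr \<alpha>"
    and lim: "\<And>s. (\<lambda>n. h n s) \<longlonglongrightarrow> h' s"
  shows "(\<lambda>n. rmarchaud \<theta> T (h n) t) \<longlonglongrightarrow> rmarchaud \<theta> T h' t"
proof -
  have hb: "has_bochner_integral lborel (\<lambda>s. indicator {t<..<T} s * (s - t) powr (\<alpha> + \<theta> - 2))
      ((T - t) powr (\<alpha> + \<theta> - 1) / (\<alpha> + \<theta> - 1))"
    using has_bochner_integral_powr_right[of "\<alpha> + \<theta> - 2" t T] \<theta> \<alpha> t by simp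
  have "(\<lambda>n. LINT s|lborel. indicator {t<..<T} s * ((h n t - h n s) * (s - t) powr (\<theta> - 2)))
    \<longlonglongrightarrow> (LINT s|lborel. indicator {t<..<T} s * ((h' t - h' s) * (s - t) powr (\<theta> - 2)))"
  proof (rule integral_dominated_convergence)
    show "integrable lborel (\<lambda>s. C * (indicator {t<..<T} s * (s - t) powr (\<alpha> + \<theta> - 2)))"
      using hb by (auto intro: integrable.intros)
    show "AE s in lborel. (\<lambda>n. indicator {t<..<T} s * ((h n t - h n s) * (s - t) powr (\<theta> - 2)))
      \<longlonglongrightarrow> indicator {t<..<T} s * ((h' t - h' s) * (s - t) powr (\<theta> - 2))"
      by (intro AE_I2 tendsto_intros lim)
    show "AE s in lborel. norm (indicator {t<..<T} s * ((h n t - h n s) * (s - t) powr (\<theta> - 2)))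
        \<le> C * (indicator {t<..<T} s * (s - t) powr (\<alpha> + \<theta> - 2))" for n
      using holder_kernel_bound[OF \<theta> \<alpha> t H[of n t]] by (intro AE_I2) simp
  qed measurable
  then show ?thesis unfolding rmarchaud_def by (intro tendsto_intros lim)
qed

context bounded_W_one
begin

text \<open>The phases of the integral and of the right derivative multiply to cis \<pi> = -1. This
  is why the integral is real and where the minus sign comes from.\<close>

lemma pathwise_integral_eq_marchaud:
  "pathwise_integral \<theta> T f g = of_real
    (- (LINT t|lborel. marchaud t * rmarchaud \<theta> T (\<lambda>s. g s - left_lim g T) t) / (Gamma (1 - \<theta>) * Gamma \<theta>))"
proof -
  define R where "R = rmarchaud \<theta> T (\<lambda>s. g s - left_lim g T)"
  define I where "I = (LINT t|lborel. marchaud t * R t)"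
  have "(CLBINT t:{0<..<T}. complex_of_real (D_left \<theta> f t) * D_right (1 - \<theta>) T (\<lambda>s. g s - left_lim g T) t)
    = (CLBINT t. (cis (pi * (1 - \<theta>)) / of_real (Gamma (1 - \<theta>) * Gamma \<theta>)) * of_real (marchaud t * R t))"
    unfolding set_lebesgue_integral_def
  proof (rule Bochner_Integration.integral_cong)
    fix t
    show "indicator {0<..<T} t *\<^sub>R (complex_of_real (D_left \<theta> f t) * D_right (1 - \<theta>) T (\<lambda>s. g s - left_lim g T) t)
       = (cis (pi * (1 - \<theta>)) / of_real (Gamma (1 - \<theta>) * Gamma \<theta>)) * of_real (marchaud t * R t)"
      by (cases "t \<in> {0<..<T}")
         (simp_all add: D_left_eq_marchaud D_right_eq_rmarchaud R_def marchaud_outside)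
  qed simp
  also have "\<dots> = (cis (pi * (1 - \<theta>)) / of_real (Gamma (1 - \<theta>) * Gamma \<theta>)) * of_real I"
    unfolding I_def by (simp only: integral_mult_right_zero integral_complex_of_real)
  finally have "pathwise_integral \<theta> T f g = (cis (pi * \<theta>) * cis (pi * (1 - \<theta>))) * of_real (I / (Gamma (1 - \<theta>) * Gamma \<theta>))"
    unfolding pathwise_integral_def by simp
  also have "cis (pi * \<theta>) * cis (pi * (1 - \<theta>)) = -1"
    by (simp add: cis_mult flip: distrib_left)
  finally show ?thesis by (simp add: I_def R_def)
qed

text \<open>The integrator is replaced by its forward averages, which are differentiable and share
  its Hoelder constant, so dominated convergence applies.\<close>

lemma pathwise_integral_LIMSEQ:
  assumes \<alpha>: "1 - \<theta> < \<alpha>" and H: "\<And>s t. \<bar>g t - g s\<bar> \<le> C * \<bar>t - s\<bar> powr \<alpha>"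
  obtains L where "pathwise_integral \<theta> T f g = of_real L"
    "(\<lambda>n. LINT u|lborel. indicator {0<..<T} u * (real (Suc n) * (g (u + 1 / real (Suc n)) - g u) * f u)) \<longlonglongrightarrow> L"
proof -
  define c where "c = Gamma (1 - \<theta>) * Gamma \<theta>"
  have c: "c > 0" unfolding c_def using \<theta> by (intro mult_pos_pos Gamma_real_pos) auto
  have cont: "continuous_on UNIV g" by (rule continuous_on_holder[OF H]) (use \<alpha> \<theta> in auto)
  then have contx: "isCont g x" for x by (simp add: continuous_on_eq_continuous_at)
  have [measurable]: "g \<in> borel_measurable borel" using cont by (rule borel_measurable_continuous_onI)
  have left: "left_lim g T = g T"
    unfolding left_lim_def using contx[of T]
    by (intro tendsto_Lim) (auto simp: isCont_def intro: filterlim_at_split[THEN iffD1, THEN conjunct1])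
  obtain G where G: "\<And>x. (G has_real_derivative g x) (at x)" using ex_antiderivative[OF cont] by blast
  define \<delta> where "\<delta> n = 1 / real (Suc n)" for n
  have \<delta>: "\<delta> n > 0" for n by (simp add: \<delta>_def)
  have \<delta>0: "\<delta> \<longlonglongrightarrow> 0" unfolding \<delta>_def by (rule LIMSEQ_Suc) (rule lim_1_over_n)
  \<comment> \<open>As \<open>G\<close> is a primitive of \<open>g\<close>, \<open>gn n t\<close> is
    the mean of \<open>g\<close> over \<open>{t..t + \<delta> n}\<close> and \<open>\<psi> n\<close>
    is its derivative. Subtracting \<open>gn n T\<close> in \<open>h n\<close> mirrors the
    subtraction of \<open>left_lim g T\<close> in the pathwise integral.\<close>
  define gn where "gn n t = (G (t + \<delta> n) - G t) / \<delta> n" for n t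
  define \<psi> where "\<psi> n t = (g (t + \<delta> n) - g t) / \<delta> n" for n t
  define h where "h n t = gn n t - gn n T" for n t
  define h' where "h' t = g t - g T" for t
  have Gcont: "continuous_on UNIV G" using G by (meson DERIV_continuous_on has_field_derivative_at_within)
  have [measurable]: "G \<in> borel_measurable borel" using Gcont by (rule borel_measurable_continuous_onI)
  have [measurable]: "h n \<in> borel_measurable borel" "\<psi> n \<in> borel_measurable borel" for n
    unfolding h_def[abs_def] gn_def \<psi>_def[abs_def] by measurable
  have [measurable]: "h' \<in> borel_measurable borel" unfolding h'_def[abs_def] by measurable
  have dgn: "(gn n has_real_derivative \<psi> n t) (at t)" for n t
  proof -
    have "((\<lambda>t. G (t + \<delta> n)) has_real_derivative g (t + \<delta> n)) (at t)"
      using DERIV_shift[of G "g (t + \<delta> n)" t "\<delta> n"] G[of "t + \<delta> n"] by simp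
    then show ?thesis unfolding gn_def[abs_def] \<psi>_def
      by (intro DERIV_cdivide DERIV_diff G)
  qed
  have \<psi>cont: "isCont (\<psi> n) t" for n t
    unfolding \<psi>_def[abs_def] using \<delta>[of n]
    by (intro continuous_intros isCont_o2[OF _ contx] contx) auto
  \<comment> \<open>This bound may grow with n. It only justifies the exchange of integrals for each
    fixed n; the passage to the limit rests on the Hoelder constant instead.\<close>
  have \<psi>b: "\<bar>\<psi> n t\<bar> \<le> C * \<delta> n powr \<alpha> / \<delta> n" for n t
    using H[of "t + \<delta> n" t] \<delta>[of n] by (auto simp: \<psi>_def abs_divide intro: divide_right_mono)
  have hint: "h n s = - (LINT u|lborel. indicator {s<..<T} u * \<psi> n u)" if "s \<le> T" for n s
  proof -
    have "(LINT u|lborel. \<psi> n u * indicator {s..T} u) = gn n T - gn n s"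
      using that dgn \<psi>cont by (intro integral_FTC_Icc_real) auto
    moreover have "(LINT u|lborel. \<psi> n u * indicator {s..T} u) = (LINT u|lborel. indicator {s<..<T} u * \<psi> n u)"
      using AE_lborel_singleton[of s] AE_lborel_singleton[of T]
      by (intro integral_cong_AE) (auto simp: indicator_def)
    ultimately show ?thesis by (simp add: h_def)
  qed
  have gnH: "\<bar>gn n t - gn n s\<bar> \<le> C * \<bar>t - s\<bar> powr \<alpha>" for n s t
  proof -
    \<comment> \<open>The mean value theorem for x -> G (t + x) - G (s + x) turns the difference of
      two means into a single increment g (t + z) - g (s + z), so the means inherit the constant C
      unchanged.\<close>
    have "\<exists>z. 0 < z \<and> z < \<delta> n \<and> (G (t + \<delta> n) - G (s + \<delta> n)) - (G (t + 0) - G (s + 0)) = (\<delta> n - 0) * (g (t + z) - g (s + z))"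
    proof (rule MVT2[OF \<delta>])
      fix x
      show "((\<lambda>x. G (t + x) - G (s + x)) has_real_derivative g (t + x) - g (s + x)) (at x)"
        using DERIV_shift[of G "g (t + x)" x t] DERIV_shift[of G "g (s + x)" x s] G[of "x + t"] G[of "x + s"]
        by (intro DERIV_diff) (simp_all add: add.commute)
    qed
    then obtain z where "(G (t + \<delta> n) - G (s + \<delta> n)) - (G t - G s) = \<delta> n * (g (t + z) - g (s + z))" by auto
    moreover have "gn n t - gn n s = ((G (t + \<delta> n) - G (s + \<delta> n)) - (G t - G s)) / \<delta> n"
      by (simp add: gn_def diff_divide_distrib)
    ultimately have "gn n t - gn n s = g (t + z) - g (s + z)"
      using \<delta>[of n] by simp
    then show ?thesis using H[of "t + z" "s + z"] by simp
  qed
  then have hH: "\<bar>h n t - h n s\<bar> \<le> C * \<bar>t - s\<bar> powr \<alpha>" for n s t by (simp add: h_def)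
  have hT: "h n T = 0" for n by (simp add: h_def)
  have "(\<lambda>n. gn n t) \<longlonglongrightarrow> g t" for t
  proof -
    have "((\<lambda>d. (G (t + d) - G t) / d) \<longlongrightarrow> g t) (at 0)" using G[of t] by (simp add: DERIV_def)
    moreover have "filterlim \<delta> (at 0) sequentially"
      using \<delta>0 \<delta> by (auto simp: filterlim_at less_imp_neq[symmetric] intro!: always_eventually)
    ultimately show ?thesis unfolding gn_def by (rule filterlim_compose)
  qed
  then have hlim: "(\<lambda>n. h n t) \<longlonglongrightarrow> h' t" for t unfolding h_def h'_def by (intro tendsto_intros)
  define D where "D = C * T powr (\<alpha> + \<theta> - 1) * (1 + (1 - \<theta>) / (\<alpha> + \<theta> - 1))"
  have "(\<lambda>n. LINT t|lborel. marchaud t * rmarchaud \<theta> T (h n) t) \<longlonglongrightarrow> (LINT t|lborel. marchaud t * rmarchaud \<theta> T h' t)"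
  proof (rule integral_dominated_convergence)
    show "integrable lborel (\<lambda>t. D * \<bar>marchaud t\<bar>)" using integrable_marchaud by simp
    show "AE t in lborel. (\<lambda>n. marchaud t * rmarchaud \<theta> T (h n) t) \<longlonglongrightarrow> marchaud t * rmarchaud \<theta> T h' t"
    proof (rule AE_I2)
      fix t
      show "(\<lambda>n. marchaud t * rmarchaud \<theta> T (h n) t) \<longlonglongrightarrow> marchaud t * rmarchaud \<theta> T h' t"
      proof (cases "t \<in> {0<..<T}")
        case True
        then show ?thesis by (intro tendsto_intros rmarchaud_LIMSEQ[OF \<theta> \<alpha> _ _ _ hH hlim]) auto
      qed (simp add: marchaud_outside)
    qed
    show "AE t in lborel. norm (marchaud t * rmarchaud \<theta> T (h n) t) \<le> D * \<bar>marchaud t\<bar>" for n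
    proof (rule AE_I2)
      fix t
      show "norm (marchaud t * rmarchaud \<theta> T (h n) t) \<le> D * \<bar>marchaud t\<bar>"
      proof (cases "t \<in> {0<..<T}")
        case True
        have "\<bar>rmarchaud \<theta> T (h n) t\<bar> \<le> D"
          unfolding D_def by (rule rmarchaud_bounded[OF \<theta> \<alpha> True _ hH hT]) measurable
        then have "\<bar>marchaud t\<bar> * \<bar>rmarchaud \<theta> T (h n) t\<bar> \<le> \<bar>marchaud t\<bar> * D"
          by (rule mult_left_mono) simp
        then show ?thesis by (simp add: abs_mult mult.commute)
      qed (simp add: marchaud_outside)
    qed
  qed measurable
  \<comment> \<open>For each n the integral is evaluated exactly: the right derivative of
    \<open>h n\<close> is minus the Abel integral of \<open>\<psi> n\<close>, and duality returns
    \<open>f\<close>. The factor -c cancels later against the one in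
    \<open>pathwise_integral_eq_marchaud\<close>.\<close>
  moreover have "(LINT t|lborel. marchaud t * rmarchaud \<theta> T (h n) t)
      = - c * (LINT u|lborel. indicator {0<..<T} u * (\<psi> n u * f u))" for n
  proof -
    have "(LINT t|lborel. marchaud t * rmarchaud \<theta> T (h n) t)
      = (LINT t|lborel. - (marchaud t * (LINT u|lborel. indicator {t<..<T} u * (\<psi> n u * (u - t) powr (\<theta> - 1)))))"
    proof (rule Bochner_Integration.integral_cong)
      fix t
      show "marchaud t * rmarchaud \<theta> T (h n) t
        = - (marchaud t * (LINT u|lborel. indicator {t<..<T} u * (\<psi> n u * (u - t) powr (\<theta> - 1))))"
      proof (cases "t \<in> {0<..<T}")
        case True
        have "rmarchaud \<theta> T (h n) t = - (LINT u|lborel. indicator {t<..<T} u * (\<psi> n u * (u - t) powr (\<theta> - 1)))"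
          by (rule rmarchaud_antiderivative[OF \<theta> _ _ \<psi>b hint]) (use True in auto)
        then show ?thesis by simp
      qed (simp add: marchaud_outside)
    qed simp
    also have "\<dots> = - c * (LINT u|lborel. indicator {0<..<T} u * (\<psi> n u * f u))"
      using integral_marchaud_duality[OF _ \<psi>b, of n] by (simp add: c_def)
    finally show ?thesis .
  qed
  ultimately have "(\<lambda>n. - c * (LINT u|lborel. indicator {0<..<T} u * (\<psi> n u * f u)))
     \<longlonglongrightarrow> (LINT t|lborel. marchaud t * rmarchaud \<theta> T h' t)" by simp
  then have "(\<lambda>n. (- c * (LINT u|lborel. indicator {0<..<T} u * (\<psi> n u * f u))) / (- c))
     \<longlonglongrightarrow> (LINT t|lborel. marchaud t * rmarchaud \<theta> T h' t) / (- c)"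
    by (intro tendsto_intros) (use c in auto)
  then have "(\<lambda>n. LINT u|lborel. indicator {0<..<T} u * (\<psi> n u * f u))
     \<longlonglongrightarrow> - (LINT t|lborel. marchaud t * rmarchaud \<theta> T h' t) / c"
    using c by simp
  also have "(\<lambda>n. LINT u|lborel. indicator {0<..<T} u * (\<psi> n u * f u))
    = (\<lambda>n. LINT u|lborel. indicator {0<..<T} u * (real (Suc n) * (g (u + 1 / real (Suc n)) - g u) * f u))"
    by (simp add: \<psi>_def \<delta>_def mult.commute[of _ "1 + real _"])
  finally show ?thesis
    by (rule that[rotated]) (simp add: pathwise_integral_eq_marchaud left h'_def[abs_def] c_def)
qed

end

section \<open>Integrands of local expansions\<close>

lemma W_one_cong:
  assumes "\<And>t. t \<in> {0<..<T} \<Longrightarrow> f t = f' t"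
  shows "f \<in> W_one \<theta> T \<longleftrightarrow> f' \<in> W_one \<theta> T"
proof -
  have 1: "indicator {0<..<T} t *\<^sub>R f t = indicator {0<..<T} t *\<^sub>R f' t" for t
    using assms by (simp add: indicator_def)
  have 2: "(\<integral>\<^sup>+t\<in>{0<..<T}. ennreal (\<bar>f t\<bar> / t powr \<theta>) \<partial>lborel) = (\<integral>\<^sup>+t\<in>{0<..<T}. ennreal (\<bar>f' t\<bar> / t powr \<theta>) \<partial>lborel)"
    by (intro nn_integral_cong) (simp add: indicator_def assms)
  have 3: "(\<integral>\<^sup>+t\<in>{0<..<T}. (\<integral>\<^sup>+s\<in>{0<..<t}. ennreal (\<bar>f t - f s\<bar> / \<bar>t - s\<bar> powr (1 + \<theta>)) \<partial>lborel) \<partial>lborel)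
    = (\<integral>\<^sup>+t\<in>{0<..<T}. (\<integral>\<^sup>+s\<in>{0<..<t}. ennreal (\<bar>f' t - f' s\<bar> / \<bar>t - s\<bar> powr (1 + \<theta>)) \<partial>lborel) \<partial>lborel)"
  proof (rule nn_integral_cong)
    fix t
    show "(\<integral>\<^sup>+s\<in>{0<..<t}. ennreal (\<bar>f t - f s\<bar> / \<bar>t - s\<bar> powr (1 + \<theta>)) \<partial>lborel) * indicator {0<..<T} t
      = (\<integral>\<^sup>+s\<in>{0<..<t}. ennreal (\<bar>f' t - f' s\<bar> / \<bar>t - s\<bar> powr (1 + \<theta>)) \<partial>lborel) * indicator {0<..<T} t"
    proof (cases "t \<in> {0<..<T}")
      case True
      have "(\<integral>\<^sup>+s\<in>{0<..<t}. ennreal (\<bar>f t - f s\<bar> / \<bar>t - s\<bar> powr (1 + \<theta>)) \<partial>lborel)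
        = (\<integral>\<^sup>+s\<in>{0<..<t}. ennreal (\<bar>f' t - f' s\<bar> / \<bar>t - s\<bar> powr (1 + \<theta>)) \<partial>lborel)"
        using True by (intro nn_integral_cong) (simp add: indicator_def assms)
      then show ?thesis by simp
    qed simp
  qed
  show ?thesis unfolding W_one_def set_borel_measurable_def mem_Collect_eq 1 2 3 ..
qed

lemma left_lim_cong:
  assumes "0 < T" "\<And>t. t \<in> {0<..<T} \<Longrightarrow> g t = g' t"
  shows "(g \<longlongrightarrow> l) (at_left T) \<longleftrightarrow> (g' \<longlongrightarrow> l) (at_left T)" "left_lim g T = left_lim g' T"
proof -
  have "\<forall>\<^sub>F t in at_left T. g t = g' t"
    using assms eventually_at_left_real[OF assms(1)] by (auto elim: eventually_mono)
  then show 1: "(g \<longlongrightarrow> l) (at_left T) \<longleftrightarrow> (g' \<longlongrightarrow> l) (at_left T)" for l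
    by (rule filterlim_cong[OF refl refl])
  \<comment> \<open>\<open>Lim\<close> is a definite description, so equivalence of the two limit
    statements for every l gives equality whether or not a limit exists.\<close>
  show "left_lim g T = left_lim g' T"
    unfolding left_lim_def Topological_Spaces.Lim_def 1 ..
qed

lemma W_infty_cong:
  assumes "0 < T" "\<And>t. t \<in> {0<..<T} \<Longrightarrow> g t = g' t"
  shows "g \<in> W_infty \<theta> T \<longleftrightarrow> g' \<in> W_infty \<theta> T"
proof -
  have 1: "indicator {0<..<T} t *\<^sub>R g t = indicator {0<..<T} t *\<^sub>R g' t" for t
    using assms by (simp add: indicator_def)
  have 2: "(SUP t\<in>{0<..<T}. ennreal (\<bar>left_lim g T - g t\<bar> / (T - t) powr \<theta>))
    = (SUP t\<in>{0<..<T}. ennreal (\<bar>left_lim g' T - g' t\<bar> / (T - t) powr \<theta>))"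
    using left_lim_cong(2)[OF assms] assms(2) by (intro SUP_cong) auto
  have 3: "(SUP t\<in>{0<..<T}. \<integral>\<^sup>+s\<in>{t<..<T}. ennreal (\<bar>g t - g s\<bar> / \<bar>t - s\<bar> powr (1 + \<theta>)) \<partial>lborel)
    = (SUP t\<in>{0<..<T}. \<integral>\<^sup>+s\<in>{t<..<T}. ennreal (\<bar>g' t - g' s\<bar> / \<bar>t - s\<bar> powr (1 + \<theta>)) \<partial>lborel)"
    using assms(2) by (intro SUP_cong nn_integral_cong) (auto simp: indicator_def)
  have 4: "(\<exists>l. (g \<longlongrightarrow> l) (at_left T)) \<longleftrightarrow> (\<exists>l. (g' \<longlongrightarrow> l) (at_left T))"
    using left_lim_cong(1)[OF assms] by simp
  show ?thesis
    unfolding W_infty_def set_borel_measurable_def mem_Collect_eq 1 2 3 4 ..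
qed

lemma pathwise_integral_cong:
  assumes "0 < T" and f: "\<And>t. t \<in> {0<..<T} \<Longrightarrow> f t = f' t" and g: "\<And>t. t \<in> {0<..<T} \<Longrightarrow> g t = g' t"
  shows "pathwise_integral \<theta> T f g = pathwise_integral \<theta> T f' g'"
proof -
  have "complex_of_real (D_left \<theta> f t) * D_right (1 - \<theta>) T (\<lambda>s. g s - left_lim g T) t
      = complex_of_real (D_left \<theta> f' t) * D_right (1 - \<theta>) T (\<lambda>s. g' s - left_lim g' T) t"
    if t: "t \<in> {0<..<T}" for t
  proof -
    have "(LINT s:{0<..<t}|lborel. (f t - f s) / (t - s) powr (\<theta> + 1)) = (LINT s:{0<..<t}|lborel. (f' t - f' s) / (t - s) powr (\<theta> + 1))"
      using t f by (intro set_lebesgue_integral_cong) auto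
    moreover have "(LINT s:{t<..<T}|lborel. (g t - left_lim g T - (g s - left_lim g T)) / (s - t) powr (1 - \<theta> + 1))
       = (LINT s:{t<..<T}|lborel. (g' t - left_lim g' T - (g' s - left_lim g' T)) / (s - t) powr (1 - \<theta> + 1))"
      using t g by (intro set_lebesgue_integral_cong) auto
    ultimately show ?thesis
      unfolding D_left_def D_right_def using f[OF t] g[OF t] left_lim_cong(2)[OF assms(1) g] by simp
  qed
  then show ?thesis unfolding pathwise_integral_def
    by (intro arg_cong2[where f="(*)"] refl set_lebesgue_integral_cong) auto
qed

text \<open>The gap \<alpha> - \<theta> > 0 turns both singular weights into the powers \<alpha> -
  \<theta> and \<alpha> - \<theta> - 1, the latter integrable at the diagonal.\<close>

lemma holder_in_W_infty:
  assumes T: "0 < T" and \<theta>: "0 < \<theta>" "\<theta> < \<alpha>" and H: "\<And>s t. \<bar>g t - g s\<bar> \<le> C * \<bar>t - s\<bar> powr \<alpha>"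
  shows "g \<in> W_infty \<theta> T"
proof -
  have C: "0 \<le> C" using H[of 1 0] by simp
  have cont: "continuous_on UNIV g" by (rule continuous_on_holder[OF H]) (use \<theta> in auto)
  then have [measurable]: "g \<in> borel_measurable borel" by (rule borel_measurable_continuous_onI)
  have lim: "(g \<longlongrightarrow> g T) (at_left T)"
    using cont by (auto simp: continuous_on_def filterlim_at_split)
  then have left: "left_lim g T = g T" unfolding left_lim_def by (intro tendsto_Lim) auto
  have le1: "(SUP t\<in>{0<..<T}. ennreal (\<bar>left_lim g T - g t\<bar> / (T - t) powr \<theta>)) \<le> ennreal (C * T powr (\<alpha> - \<theta>))"
  proof (rule SUP_least)
    fix t assume t: "t \<in> {0<..<T}"
    have "\<bar>g T - g t\<bar> / (T - t) powr \<theta> \<le> C * \<bar>T - t\<bar> powr \<alpha> / (T - t) powr \<theta>"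
      by (rule divide_right_mono[OF H]) simp
    also have "\<dots> = C * (T - t) powr (\<alpha> - \<theta>)" using t by (simp add: powr_diff)
    also have "\<dots> \<le> C * T powr (\<alpha> - \<theta>)" using t C \<theta> by (intro mult_left_mono powr_mono2) auto
    finally show "ennreal (\<bar>left_lim g T - g t\<bar> / (T - t) powr \<theta>) \<le> ennreal (C * T powr (\<alpha> - \<theta>))"
      unfolding left by (rule ennreal_leI)
  qed
  have le2: "(SUP t\<in>{0<..<T}. \<integral>\<^sup>+s\<in>{t<..<T}. ennreal (\<bar>g t - g s\<bar> / \<bar>t - s\<bar> powr (1 + \<theta>)) \<partial>lborel)
     \<le> ennreal (C * (T powr (\<alpha> - \<theta>) / (\<alpha> - \<theta>)))"
  proof (rule SUP_least)
    fix t assume t: "t \<in> {0<..<T}"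
    have "(\<integral>\<^sup>+s\<in>{t<..<T}. ennreal (\<bar>g t - g s\<bar> / \<bar>t - s\<bar> powr (1 + \<theta>)) \<partial>lborel)
      \<le> (\<integral>\<^sup>+s. ennreal \<bar>C * (indicator {t<..<T} s * (s - t) powr (\<alpha> - \<theta> - 1))\<bar> \<partial>lborel)"
    proof (rule nn_integral_mono)
      fix s
      show "ennreal (\<bar>g t - g s\<bar> / \<bar>t - s\<bar> powr (1 + \<theta>)) * indicator {t<..<T} s
        \<le> ennreal \<bar>C * (indicator {t<..<T} s * (s - t) powr (\<alpha> - \<theta> - 1))\<bar>"
      proof (cases "s \<in> {t<..<T}")
        case True
        have "\<bar>g t - g s\<bar> / \<bar>t - s\<bar> powr (1 + \<theta>) \<le> C * \<bar>t - s\<bar> powr \<alpha> / \<bar>t - s\<bar> powr (1 + \<theta>)"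
          by (rule divide_right_mono[OF H]) simp
        also have "\<dots> = C * (s - t) powr (\<alpha> - \<theta> - 1)"
          using True powr_diff[of "s - t" \<alpha> "1 + \<theta>"] by (simp add: abs_minus_commute diff_diff_eq add.commute)
        finally show ?thesis using True C by (auto intro!: ennreal_leI)
      qed simp
    qed
    also have "\<dots> = ennreal (\<bar>C\<bar> * ((T - t) powr (\<alpha> - \<theta> - 1 + 1) / (\<alpha> - \<theta> - 1 + 1)))"
      by (rule nn_integral_abs_cmult[OF has_bochner_integral_powr_right]) (use t \<theta> in auto)
    also have "\<dots> \<le> ennreal (C * (T powr (\<alpha> - \<theta>) / (\<alpha> - \<theta>)))"
      using t C \<theta> powr_mono2[of "\<alpha> - \<theta>" "T - t" T]
      by (auto intro!: ennreal_leI mult_left_mono divide_right_mono)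
    finally show "(\<integral>\<^sup>+s\<in>{t<..<T}. ennreal (\<bar>g t - g s\<bar> / \<bar>t - s\<bar> powr (1 + \<theta>)) \<partial>lborel)
       \<le> ennreal (C * (T powr (\<alpha> - \<theta>) / (\<alpha> - \<theta>)))" .
  qed
  have "(SUP t\<in>{0<..<T}. ennreal (\<bar>left_lim g T - g t\<bar> / (T - t) powr \<theta>))
    + (SUP t\<in>{0<..<T}. \<integral>\<^sup>+s\<in>{t<..<T}. ennreal (\<bar>g t - g s\<bar> / \<bar>t - s\<bar> powr (1 + \<theta>)) \<partial>lborel)
    \<le> ennreal (C * T powr (\<alpha> - \<theta>)) + ennreal (C * (T powr (\<alpha> - \<theta>) / (\<alpha> - \<theta>)))"
    by (rule add_mono[OF le1 le2])
  also have "\<dots> < \<infinity>" by simp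
  finally show ?thesis
    unfolding W_infty_def set_borel_measurable_def using lim by auto
qed

section \<open>Membership in the space of integrands\<close>

lemma bounded_in_W_one:
  assumes \<theta>: "0 < \<theta>" "\<theta> < 1" and T: "0 < T" and [measurable]: "f \<in> borel_measurable borel"
    and B: "\<And>x. \<bar>f x\<bar> \<le> B"
    and fin: "(\<integral>\<^sup>+t\<in>{0<..<T}. (\<integral>\<^sup>+s\<in>{0<..<t}. ennreal (\<bar>f t - f s\<bar> / \<bar>t - s\<bar> powr (1 + \<theta>)) \<partial>lborel) \<partial>lborel) < \<infinity>"
  shows "f \<in> W_one \<theta> T"
proof -
  have B0: "0 \<le> B" using B[of 0] by linarith
  have "(\<integral>\<^sup>+t\<in>{0<..<T}. ennreal (\<bar>f t\<bar> / t powr \<theta>) \<partial>lborel)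
      \<le> (\<integral>\<^sup>+t. ennreal \<bar>B * (indicator {0<..<T} t * t powr (-\<theta>))\<bar> \<partial>lborel)"
  proof (rule nn_integral_mono)
    fix t
    have "\<bar>f t\<bar> / t powr \<theta> \<le> B * t powr (-\<theta>)"
      using B[of t] by (simp add: powr_minus_divide divide_right_mono)
    then show "ennreal (\<bar>f t\<bar> / t powr \<theta>) * indicator {0<..<T} t \<le> ennreal \<bar>B * (indicator {0<..<T} t * t powr (-\<theta>))\<bar>"
      using B0 by (cases "t \<in> {0<..<T}") (auto intro!: ennreal_leI)
  qed
  also have "\<dots> = ennreal (\<bar>B\<bar> * (T powr (-\<theta> + 1) / (-\<theta> + 1)))"
    by (rule nn_integral_abs_cmult[OF has_bochner_integral_powr_Ioo_0]) (use \<theta> T in auto)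
  also have "\<dots> < \<infinity>" by simp
  finally show ?thesis
    unfolding W_one_def set_borel_measurable_def using fin by (auto simp: less_top)
qed

text \<open>The cut at \<tau> creates a jump of size at most B, felt only by pairs s < \<tau> < t.
  Integrating (t - s) powr (-\<theta>-1) over t beyond \<tau> leaves at most (\<tau> - s) powr
  (-\<theta>) / \<theta>, which is integrable in s because \<theta> < 1.\<close>

lemma indicator_mult_in_W_one:
  assumes \<theta>: "0 < \<theta>" "\<theta> < 1" and T: "0 < T" and [measurable]: "f \<in> borel_measurable borel"
    and B: "\<And>x. \<bar>f x\<bar> \<le> B" and f: "f \<in> W_one \<theta> T" and \<tau>: "\<tau> \<in> {0..T}"
  shows "(\<lambda>s. indicator {0..\<tau>} s * f s) \<in> W_one \<theta> T"
proof (rule bounded_in_W_one[OF \<theta> T, of _ B])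
  have B0: "0 \<le> B" using B[of 0] by linarith
  show "\<bar>indicator {0..\<tau>} x * f x\<bar> \<le> B" for x using B[of x] B0 by (simp add: indicator_def)
  define q where "q t s = B * (indicator {0<..<\<tau>} s * (indicator {\<tau>..<T} t * (t - s) powr (-\<theta>-1)))" for t s
  have [measurable]: "case_prod q \<in> borel_measurable (borel \<Otimes>\<^sub>M borel)" unfolding q_def by measurable
  let ?F = "\<lambda>f t. \<integral>\<^sup>+s\<in>{0<..<t}. ennreal (\<bar>f t - f s\<bar> / \<bar>t - s\<bar> powr (1 + \<theta>)) \<partial>lborel"
  have ineq: "?F (\<lambda>s. indicator {0..\<tau>} s * f s) t \<le> ?F f t + (\<integral>\<^sup>+s. ennreal \<bar>q t s\<bar> \<partial>lborel)"
    if t: "t \<in> {0<..<T}" for t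
  proof -
    have "?F (\<lambda>s. indicator {0..\<tau>} s * f s) t \<le>
      (\<integral>\<^sup>+s. ennreal (\<bar>f t - f s\<bar> / \<bar>t - s\<bar> powr (1 + \<theta>)) * indicator {0<..<t} s + ennreal \<bar>q t s\<bar> \<partial>lborel)"
    proof (rule nn_integral_mono_AE, rule AE_mp[OF AE_lborel_singleton[of \<tau>]], rule AE_I2, rule impI)
      fix s :: real assume "s \<noteq> \<tau>"
      \<comment> \<open>The point s = \<tau> is set aside because the indicator of
        \<open>{0..\<tau>}\<close> is 1 there while \<open>q t \<tau>\<close> is 0.\<close>
      then consider "s \<notin> {0<..<t}" | "s \<in> {0<..<t}" "t \<le> \<tau>" | "s \<in> {0<..<t}" "\<tau> < s" | "s \<in> {0<..<t}" "s < \<tau>" "\<tau> < t"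
        by linarith
      then show "ennreal (\<bar>indicator {0..\<tau>} t * f t - indicator {0..\<tau>} s * f s\<bar> / \<bar>t - s\<bar> powr (1 + \<theta>)) * indicator {0<..<t} s
        \<le> ennreal (\<bar>f t - f s\<bar> / \<bar>t - s\<bar> powr (1 + \<theta>)) * indicator {0<..<t} s + ennreal \<bar>q t s\<bar>"
      proof cases
        case 4
        have "\<bar>f s\<bar> / \<bar>t - s\<bar> powr (1 + \<theta>) \<le> B / \<bar>t - s\<bar> powr (1 + \<theta>)"
          by (intro divide_right_mono B) simp
        also have "\<dots> = \<bar>q t s\<bar>"
          using 4 t B0 powr_diff[of "t - s" "-\<theta>" 1] powr_add[of "t - s" 1 \<theta>]
          by (simp add: q_def powr_minus_divide)
        finally have "ennreal (\<bar>f s\<bar> / \<bar>t - s\<bar> powr (1 + \<theta>)) \<le> ennreal \<bar>q t s\<bar>" by (rule ennreal_leI)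
        then show ?thesis using 4 by (simp add: add_increasing)
      qed (auto simp: indicator_def)
    qed
    also have "\<dots> = ?F f t + (\<integral>\<^sup>+s. ennreal \<bar>q t s\<bar> \<partial>lborel)"
      by (rule nn_integral_add) measurable
    finally show ?thesis .
  qed
  have "(\<integral>\<^sup>+t\<in>{0<..<T}. ?F (\<lambda>s. indicator {0..\<tau>} s * f s) t \<partial>lborel)
    \<le> (\<integral>\<^sup>+t. ?F f t * indicator {0<..<T} t + (\<integral>\<^sup>+s. ennreal \<bar>q t s\<bar> \<partial>lborel) \<partial>lborel)"
  proof (rule nn_integral_mono)
    fix t
    show "?F (\<lambda>s. indicator {0..\<tau>} s * f s) t * indicator {0<..<T} t
      \<le> ?F f t * indicator {0<..<T} t + (\<integral>\<^sup>+s. ennreal \<bar>q t s\<bar> \<partial>lborel)"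
      using ineq[of t] by (cases "t \<in> {0<..<T}") auto
  qed
  also have "\<dots> = (\<integral>\<^sup>+t\<in>{0<..<T}. ?F f t \<partial>lborel) + (\<integral>\<^sup>+t. \<integral>\<^sup>+s. ennreal \<bar>q t s\<bar> \<partial>lborel \<partial>lborel)"
    by (rule nn_integral_add) measurable
  also have "\<dots> < \<infinity>"
  proof -
    have "(\<integral>\<^sup>+t. \<integral>\<^sup>+s. ennreal \<bar>q t s\<bar> \<partial>lborel \<partial>lborel) = (\<integral>\<^sup>+s. \<integral>\<^sup>+t. ennreal \<bar>q t s\<bar> \<partial>lborel \<partial>lborel)"
      by (rule lborel_pair.Fubini'[symmetric]) measurable
    also have "\<dots> \<le> (\<integral>\<^sup>+s. ennreal \<bar>B / \<theta> * (indicator {0<..<\<tau>} s * (\<tau> - s) powr (-\<theta>))\<bar> \<partial>lborel)"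
    proof (rule nn_integral_mono)
      fix s
      show "(\<integral>\<^sup>+t. ennreal \<bar>q t s\<bar> \<partial>lborel) \<le> ennreal \<bar>B / \<theta> * (indicator {0<..<\<tau>} s * (\<tau> - s) powr (-\<theta>))\<bar>"
      proof (cases "s \<in> {0<..<\<tau>}")
        case True
        have "(\<integral>\<^sup>+t. ennreal \<bar>q t s\<bar> \<partial>lborel) = (\<integral>\<^sup>+t. ennreal \<bar>B * (indicator {\<tau>..<T} t * (t - s) powr (-\<theta>-1))\<bar> \<partial>lborel)"
          using True by (simp add: q_def)
        also have "\<dots> = ennreal (\<bar>B\<bar> * (((T - s) powr (-\<theta>-1+1) - (\<tau> - s) powr (-\<theta>-1+1)) / (-\<theta>-1+1)))"
          by (rule nn_integral_abs_cmult[OF has_bochner_integral_powr_Ico_right]) (use True \<theta> \<tau> in auto)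
        also have "((T - s) powr (-\<theta>-1+1) - (\<tau> - s) powr (-\<theta>-1+1)) / (-\<theta>-1+1) = ((\<tau> - s) powr (-\<theta>) - (T - s) powr (-\<theta>)) / \<theta>"
          using \<theta> by (simp add: field_simps)
        also have "ennreal (\<bar>B\<bar> * \<dots>) \<le> ennreal (B * ((\<tau> - s) powr (-\<theta>) / \<theta>))"
          using B0 \<theta> by (auto intro!: ennreal_leI mult_left_mono divide_right_mono)
        finally show ?thesis using True B0 \<theta> by simp
      qed (simp add: q_def)
    qed
    also have "\<dots> = ennreal (\<bar>B / \<theta>\<bar> * ((\<tau> - 0) powr (-\<theta>+1) / (-\<theta>+1)))"
      by (rule nn_integral_abs_cmult[OF has_bochner_integral_powr_left]) (use \<theta> \<tau> in auto)
    also have "\<dots> < \<infinity>" by simp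
    finally show ?thesis using f by (simp add: W_one_def less_top)
  qed
  finally show "(\<integral>\<^sup>+t\<in>{0<..<T}. ?F (\<lambda>s. indicator {0..\<tau>} s * f s) t \<partial>lborel) < \<infinity>" .
qed measurable

text \<open>The weight \<open>J\<close> is evaluated at the outer variable t and so factors out of
  the inner integral. There \<kappa> > \<theta> leaves the integrable power (t - s) powr (\<kappa> -
  \<theta> - 1). \<open>J\<close> may be infinite on a null set, as a bound in the extended reals
  permits.\<close>

lemma W_one_of_local_bound:
  assumes \<theta>: "0 < \<theta>" "\<theta> < 1" "\<theta> < \<kappa>" and T: "0 < T" and [measurable]: "f \<in> borel_measurable borel"
    and B: "\<And>x. \<bar>f x\<bar> \<le> B" and K: "0 \<le> K"
    and [measurable]: "J \<in> borel_measurable borel" and J: "(\<integral>\<^sup>+t\<in>{0..T}. J t \<partial>lborel) < \<infinity>"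
    and fJ: "\<And>s t. s \<in> {0..T} \<Longrightarrow> t \<in> {0..T} \<Longrightarrow> ennreal \<bar>f t - f s\<bar> \<le> ennreal (K * \<bar>t - s\<bar> powr \<kappa>) * J t"
  shows "f \<in> W_one \<theta> T"
proof (rule bounded_in_W_one[OF \<theta>(1,2) T _ B])
  have "(\<integral>\<^sup>+t\<in>{0<..<T}. (\<integral>\<^sup>+s\<in>{0<..<t}. ennreal (\<bar>f t - f s\<bar> / \<bar>t - s\<bar> powr (1 + \<theta>)) \<partial>lborel) \<partial>lborel)
    \<le> (\<integral>\<^sup>+t. ennreal (K * (T powr (\<kappa> - \<theta>) / (\<kappa> - \<theta>))) * (J t * indicator {0..T} t) \<partial>lborel)"
  proof (rule nn_integral_mono)
    fix t
    show "(\<integral>\<^sup>+s\<in>{0<..<t}. ennreal (\<bar>f t - f s\<bar> / \<bar>t - s\<bar> powr (1 + \<theta>)) \<partial>lborel) * indicator {0<..<T} t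
      \<le> ennreal (K * (T powr (\<kappa> - \<theta>) / (\<kappa> - \<theta>))) * (J t * indicator {0..T} t)"
    proof (cases "t \<in> {0<..<T}")
      case True
      have "(\<integral>\<^sup>+s\<in>{0<..<t}. ennreal (\<bar>f t - f s\<bar> / \<bar>t - s\<bar> powr (1 + \<theta>)) \<partial>lborel)
        \<le> (\<integral>\<^sup>+s. ennreal \<bar>K * (indicator {0<..<t} s * (t - s) powr (\<kappa> - \<theta> - 1))\<bar> * J t \<partial>lborel)"
      proof (rule nn_integral_mono)
        fix s
        show "ennreal (\<bar>f t - f s\<bar> / \<bar>t - s\<bar> powr (1 + \<theta>)) * indicator {0<..<t} s
          \<le> ennreal \<bar>K * (indicator {0<..<t} s * (t - s) powr (\<kappa> - \<theta> - 1))\<bar> * J t"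
        proof (cases "s \<in> {0<..<t}")
          case s: True
          have "ennreal (\<bar>f t - f s\<bar> / \<bar>t - s\<bar> powr (1 + \<theta>)) = ennreal \<bar>f t - f s\<bar> * ennreal (1 / (t - s) powr (1 + \<theta>))"
            using s by (simp add: ennreal_mult[symmetric])
          also have "\<dots> \<le> (ennreal (K * \<bar>t - s\<bar> powr \<kappa>) * J t) * ennreal (1 / (t - s) powr (1 + \<theta>))"
            using fJ[of s t] s True by (intro mult_right_mono) auto
          also have "\<dots> = (ennreal (K * (t - s) powr \<kappa>) * ennreal (1 / (t - s) powr (1 + \<theta>))) * J t"
            using s by (simp add: mult_ac)
          also have "ennreal (K * (t - s) powr \<kappa>) * ennreal (1 / (t - s) powr (1 + \<theta>)) = ennreal (K * (t - s) powr (\<kappa> - \<theta> - 1))"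
          proof -
            have "(t - s) powr (\<kappa> - \<theta> - 1) = (t - s) powr \<kappa> / (t - s) powr (1 + \<theta>)"
              by (simp add: powr_diff[symmetric] algebra_simps)
            then show ?thesis using K by (simp add: ennreal_mult[symmetric])
          qed
          finally show ?thesis using s K by simp
        qed simp
      qed
      also have "\<dots> = (\<integral>\<^sup>+s. ennreal \<bar>K * (indicator {0<..<t} s * (t - s) powr (\<kappa> - \<theta> - 1))\<bar> \<partial>lborel) * J t"
        by (rule nn_integral_multc) measurable
      also have "(\<integral>\<^sup>+s. ennreal \<bar>K * (indicator {0<..<t} s * (t - s) powr (\<kappa> - \<theta> - 1))\<bar> \<partial>lborel)
          = ennreal (\<bar>K\<bar> * ((t - 0) powr (\<kappa> - \<theta> - 1 + 1) / (\<kappa> - \<theta> - 1 + 1)))"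
        by (rule nn_integral_abs_cmult[OF has_bochner_integral_powr_left]) (use True \<theta> in auto)
      also have "\<dots> * J t \<le> ennreal (K * (T powr (\<kappa> - \<theta>) / (\<kappa> - \<theta>))) * J t"
        using K True \<theta> powr_mono2[of "\<kappa> - \<theta>" t T]
        by (intro mult_right_mono ennreal_leI) (auto intro!: mult_left_mono divide_right_mono)
      finally show ?thesis using True by simp
    qed simp
  qed
  also have "\<dots> = ennreal (K * (T powr (\<kappa> - \<theta>) / (\<kappa> - \<theta>))) * (\<integral>\<^sup>+t\<in>{0..T}. J t \<partial>lborel)"
    by (rule nn_integral_cmult) measurable
  also have "\<dots> < \<infinity>" using J by (simp add: ennreal_mult_less_top)
  finally show "(\<integral>\<^sup>+t\<in>{0<..<T}. (\<integral>\<^sup>+s\<in>{0<..<t}. ennreal (\<bar>f t - f s\<bar> / \<bar>t - s\<bar> powr (1 + \<theta>)) \<partial>lborel) \<partial>lborel) < \<infinity>" .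
qed measurable

text \<open>With a primitive \<open>H\<close> of \<open>X\<close>, the integral telescopes into two
  difference quotients of \<open>H\<close>, at \<tau> and at 0, whose limits are
  \<open>X \<tau>\<close> and \<open>X 0\<close>.\<close>

lemma forward_average_LIMSEQ:
  fixes X :: "real \<Rightarrow> real"
  assumes cont: "continuous_on UNIV X" and "0 \<le> \<tau>"
  shows "(\<lambda>n. LINT u|lborel. indicator {0<..<\<tau>} u * (real (Suc n) * (X (u + 1 / real (Suc n)) - X u)))
    \<longlonglongrightarrow> X \<tau> - X 0"
proof -
  obtain H where H: "\<And>x. (H has_real_derivative X x) (at x)" using ex_antiderivative[OF cont] by blast
  have contx: "isCont X x" for x using cont by (simp add: continuous_on_eq_continuous_at)
  define \<delta> where "\<delta> n = 1 / real (Suc n)" for n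
  have \<delta>: "\<delta> n > 0" for n by (simp add: \<delta>_def)
  have \<delta>0: "\<delta> \<longlonglongrightarrow> 0" unfolding \<delta>_def by (rule LIMSEQ_Suc) (rule lim_1_over_n)
  have eq: "(LINT u|lborel. indicator {0<..<\<tau>} u * (real (Suc n) * (X (u + 1 / real (Suc n)) - X u)))
      = (H (\<tau> + \<delta> n) - H \<tau>) / \<delta> n - (H (0 + \<delta> n) - H 0) / \<delta> n" for n
  proof -
    have "(LINT u|lborel. ((X (u + \<delta> n) - X u) / \<delta> n) * indicator {0..\<tau>} u)
      = (H (\<tau> + \<delta> n) - H \<tau>) / \<delta> n - (H (0 + \<delta> n) - H 0) / \<delta> n"
    proof (rule integral_FTC_Icc_real)
      fix x
      have "((\<lambda>t. H (t + \<delta> n)) has_real_derivative X (x + \<delta> n)) (at x)"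
        using DERIV_shift[of H "X (x + \<delta> n)" x "\<delta> n"] H[of "x + \<delta> n"] by simp
      then show "((\<lambda>x. (H (x + \<delta> n) - H x) / \<delta> n) has_real_derivative (X (x + \<delta> n) - X x) / \<delta> n) (at x)"
        by (intro DERIV_cdivide DERIV_diff H)
      show "isCont (\<lambda>u. (X (u + \<delta> n) - X u) / \<delta> n) x"
        using \<delta>[of n] by (intro continuous_intros isCont_o2[OF _ contx] contx) auto
    qed fact
    moreover have "(LINT u|lborel. ((X (u + \<delta> n) - X u) / \<delta> n) * indicator {0..\<tau>} u)
      = (LINT u|lborel. indicator {0<..<\<tau>} u * (real (Suc n) * (X (u + 1 / real (Suc n)) - X u)))"
    proof (rule integral_cong_AE)
      have [measurable]: "X \<in> borel_measurable borel" by (rule borel_measurable_continuous_onI[OF cont])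
      show "(\<lambda>u. ((X (u + \<delta> n) - X u) / \<delta> n) * indicator {0..\<tau>} u) \<in> borel_measurable lborel"
        "(\<lambda>u. indicator {0<..<\<tau>} u * (real (Suc n) * (X (u + 1 / real (Suc n)) - X u))) \<in> borel_measurable lborel"
        by measurable
      show "AE u in lborel. ((X (u + \<delta> n) - X u) / \<delta> n) * indicator {0..\<tau>} u
          = indicator {0<..<\<tau>} u * (real (Suc n) * (X (u + 1 / real (Suc n)) - X u))"
        using AE_lborel_singleton[of 0] AE_lborel_singleton[of \<tau>]
        by eventually_elim (auto simp: indicator_def \<delta>_def mult.commute)
    qed
    ultimately show ?thesis by simp
  qed
  have "(\<lambda>n. (H (t + \<delta> n) - H t) / \<delta> n) \<longlonglongrightarrow> X t" for t
  proof -
    have "((\<lambda>d. (H (t + d) - H t) / d) \<longlongrightarrow> X t) (at 0)" using H[of t] by (simp add: DERIV_def)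
    moreover have "filterlim \<delta> (at 0) sequentially"
      using \<delta>0 \<delta> by (auto simp: filterlim_at less_imp_neq[symmetric] intro!: always_eventually)
    ultimately show ?thesis by (rule filterlim_compose)
  qed
  then show ?thesis unfolding eq by (intro tendsto_diff)
qed

text \<open>Forward averages of \<open>X\<close> converge to its increment, and those of
  \<open>f\<close> against \<open>Z\<close> to the pathwise integral. By the local expansion the two
  differ by at most a constant times \<delta> powr (\<kappa> + \<alpha> - 1), which tends to 0
  because \<kappa> + \<alpha> > \<theta> + (1 - \<theta>) = 1.\<close>

lemma pathwise_integral_of_local_expansion:
  assumes \<theta>: "0 < \<theta>" "\<theta> < 1" "\<theta> < \<kappa>" and T: "0 < T" and \<alpha>: "1 - \<theta> < \<alpha>"
    and [measurable]: "f \<in> borel_measurable borel" and B: "\<And>x. \<bar>f x\<bar> \<le> B" and K: "0 \<le> K"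
    and [measurable]: "J \<in> borel_measurable borel" and J: "(\<integral>\<^sup>+t\<in>{0..T}. J t \<partial>lborel) < \<infinity>"
    and fW: "f \<in> W_one \<theta> T"
    and Z: "\<And>s t. \<bar>Z t - Z s\<bar> \<le> C * \<bar>t - s\<bar> powr \<alpha>"
    and X: "continuous_on UNIV X" and after: "\<And>t. t \<ge> T \<Longrightarrow> X t = X T \<and> Z t = Z T"
    and XJ: "\<And>s t. s \<in> {0..T} \<Longrightarrow> t \<in> {0..T} \<Longrightarrow>
      ennreal \<bar>X t - X s - f s * (Z t - Z s)\<bar> \<le> ennreal (K * \<bar>t - s\<bar> powr (\<kappa> + \<alpha>)) * J s"
    and \<tau>: "\<tau> \<in> {0..T}"
  shows "pathwise_integral \<theta> T (\<lambda>s. indicator {0..\<tau>} s * f s) Z = of_real (X \<tau> - X 0)"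
proof -
  define \<delta> where "\<delta> n = 1 / real (Suc n)" for n
  have \<delta>: "\<delta> n > 0" for n by (simp add: \<delta>_def)
  have \<delta>0: "\<delta> \<longlonglongrightarrow> 0" unfolding \<delta>_def by (rule LIMSEQ_Suc) (rule lim_1_over_n)
  have B0: "0 \<le> B" using B[of 0] by linarith
  have C0: "0 \<le> C" using Z[of 1 0] by simp
  note \<kappa> = \<theta>(3)
  interpret bounded_W_one \<theta> T B "\<lambda>s. indicator {0..\<tau>} s * f s"
  proof
    show "(\<lambda>s. indicator {0..\<tau>} s * f s) \<in> W_one \<theta> T"
      by (rule indicator_mult_in_W_one[OF \<theta>(1,2) T _ B fW \<tau>]) simp
    show "\<bar>indicator {0..\<tau>} x * f x\<bar> \<le> B" for x using B[of x] B0 by (simp add: indicator_def)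
  qed (use \<theta> T in auto)
  obtain L where L: "pathwise_integral \<theta> T (\<lambda>s. indicator {0..\<tau>} s * f s) Z = of_real L"
    and Llim: "(\<lambda>n. LINT u|lborel. indicator {0<..<T} u * (real (Suc n) * (Z (u + 1 / real (Suc n)) - Z u) * (indicator {0..\<tau>} u * f u))) \<longlonglongrightarrow> L"
    by (rule pathwise_integral_LIMSEQ[OF \<alpha> Z])
  have [measurable]: "X \<in> borel_measurable borel" using X by (rule borel_measurable_continuous_onI)
  have "continuous_on UNIV Z" by (rule continuous_on_holder[OF Z]) (use \<alpha> \<theta> in auto)
  then have [measurable]: "Z \<in> borel_measurable borel" by (rule borel_measurable_continuous_onI)
  define a where "a n u = indicator {0<..<\<tau>} u * (real (Suc n) * (X (u + \<delta> n) - X u))" for n u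
  define b where "b n u = indicator {0<..<\<tau>} u * (real (Suc n) * (Z (u + \<delta> n) - Z u) * f u)" for n u
  have ia: "integrable lborel (a n)" for n
  proof -
    have "set_integrable lborel {0..\<tau>} (\<lambda>u. real (Suc n) * (X (u + \<delta> n) - X u))"
      unfolding set_integrable_def
      by (rule borel_integrable_compact) (auto intro!: continuous_intros continuous_on_compose2[OF X] continuous_on_subset[OF X])
    then have "set_integrable lborel {0<..<\<tau>} (\<lambda>u. real (Suc n) * (X (u + \<delta> n) - X u))"
      by (rule set_integrable_subset) auto
    then show ?thesis by (simp add: set_integrable_def a_def[abs_def])
  qed
  have ib: "integrable lborel (b n)" for n
  proof -
    have "integrable lborel (\<lambda>u. (real (Suc n) * (Z (u + \<delta> n) - Z u) * f u) * indicator {0<..<\<tau>} u)"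
    proof (rule integrable_mult_bounded)
      show "\<bar>real (Suc n) * (Z (u + \<delta> n) - Z u) * f u\<bar> \<le> real (Suc n) * (C * \<delta> n powr \<alpha>) * B" for u
        unfolding abs_mult using Z[of "u + \<delta> n" u] \<delta>[of n] B[of u] C0 by (intro mult_mono) auto
      show "integrable lborel (\<lambda>x. indicator {0<..<\<tau>} x :: real)"
        using \<tau> by (intro integrable_real_indicator) auto
    qed measurable
    then show ?thesis by (simp add: b_def[abs_def] mult.commute)
  qed
  obtain j where j: "(\<integral>\<^sup>+t\<in>{0..T}. J t \<partial>lborel) = ennreal j" "0 \<le> j"
    using J by (metis ennreal_cases infinity_ennreal_def less_irrefl)
  have diff: "\<bar>(LINT u|lborel. a n u) - (LINT u|lborel. b n u)\<bar> \<le> (K * j) * \<delta> n powr (\<kappa> + \<alpha> - 1)" for n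
  proof -
    \<comment> \<open>Dividing by the step length \<delta> costs one power, which is the reason for
      the exponent \<kappa> + \<alpha> - 1.\<close>
    have pow: "real (Suc n) * \<delta> n powr (\<kappa> + \<alpha>) = \<delta> n powr (\<kappa> + \<alpha> - 1)"
      using powr_diff[of "\<delta> n" "\<kappa> + \<alpha>" 1] \<delta>[of n] by (simp add: \<delta>_def mult.commute)
    have "ennreal (norm (LINT u|lborel. a n u - b n u)) \<le> (\<integral>\<^sup>+u. ennreal (norm (a n u - b n u)) \<partial>lborel)"
      by (rule integral_norm_bound_ennreal) (use ia ib in auto)
    also have "\<dots> \<le> (\<integral>\<^sup>+u. ennreal (K * \<delta> n powr (\<kappa> + \<alpha> - 1)) * (J u * indicator {0..T} u) \<partial>lborel)"
    proof (rule nn_integral_mono)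
      fix u
      show "ennreal (norm (a n u - b n u)) \<le> ennreal (K * \<delta> n powr (\<kappa> + \<alpha> - 1)) * (J u * indicator {0..T} u)"
      proof (cases "u \<in> {0<..<\<tau>}")
        case True
        \<comment> \<open>The shifted point u + \<delta> may lie beyond T, where the local expansion
          is not assumed. Both paths are frozen after T, so the increment is the one up to the
          truncated point v.\<close>
        define v where "v = min (u + \<delta> n) T"
        have v: "v \<in> {0..T}" "\<bar>v - u\<bar> \<le> \<delta> n" using True \<tau> \<delta>[of n] by (auto simp: v_def min_def)
        have Xv: "X (u + \<delta> n) = X v" "Z (u + \<delta> n) = Z v" using after[of "u + \<delta> n"] by (auto simp: v_def min_def)
        have "ennreal (norm (a n u - b n u)) = ennreal (real (Suc n)) * ennreal \<bar>X v - X u - f u * (Z v - Z u)\<bar>"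
        proof -
          have "a n u - b n u = real (Suc n) * (X v - X u - f u * (Z v - Z u))"
            using True by (simp add: a_def b_def Xv algebra_simps)
          then show ?thesis by (simp add: abs_mult ennreal_mult del: of_nat_Suc)
        qed
        also have "\<dots> \<le> ennreal (real (Suc n)) * (ennreal (K * \<bar>v - u\<bar> powr (\<kappa> + \<alpha>)) * J u)"
          using True \<tau> v by (intro mult_left_mono XJ) auto
        also have "\<dots> \<le> ennreal (real (Suc n)) * (ennreal (K * \<delta> n powr (\<kappa> + \<alpha>)) * J u)"
          using v K \<theta> \<alpha> \<kappa> by (intro mult_left_mono mult_right_mono ennreal_leI powr_mono2) auto
        also have "\<dots> = ennreal (K * (real (Suc n) * \<delta> n powr (\<kappa> + \<alpha>))) * J u"
        proof -
          have "ennreal (K * (real (Suc n) * \<delta> n powr (\<kappa> + \<alpha>))) = ennreal (real (Suc n)) * ennreal (K * \<delta> n powr (\<kappa> + \<alpha>))"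
            using K by (subst ennreal_mult[symmetric]) (auto simp: mult.left_commute simp del: of_nat_Suc)
          then show ?thesis by (simp only: mult.assoc)
        qed
        finally show ?thesis using True \<tau> unfolding pow by simp
      qed (simp add: a_def b_def)
    qed
    also have "\<dots> = ennreal (K * \<delta> n powr (\<kappa> + \<alpha> - 1)) * (\<integral>\<^sup>+t\<in>{0..T}. J t \<partial>lborel)"
      by (rule nn_integral_cmult) measurable
    also have "\<dots> = ennreal ((K * j) * \<delta> n powr (\<kappa> + \<alpha> - 1))"
      using K j by (simp add: ennreal_mult[symmetric] mult_ac)
    finally have "norm (LINT u|lborel. a n u - b n u) \<le> (K * j) * \<delta> n powr (\<kappa> + \<alpha> - 1)"
      using K j by (subst (asm) ennreal_le_iff) auto
    then show ?thesis using ia ib by simp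
  qed
  have "(\<lambda>n. (LINT u|lborel. a n u) - (LINT u|lborel. b n u)) \<longlonglongrightarrow> 0"
  proof (rule Lim_null_comparison)
    show "\<forall>\<^sub>F n in sequentially. norm ((LINT u|lborel. a n u) - (LINT u|lborel. b n u)) \<le> (K * j) * \<delta> n powr (\<kappa> + \<alpha> - 1)"
      using diff by simp
    have "(\<lambda>n. (K * j) * \<delta> n powr (\<kappa> + \<alpha> - 1)) \<longlonglongrightarrow> (K * j) * 0 powr (\<kappa> + \<alpha> - 1)"
    proof (intro tendsto_mult tendsto_const tendsto_powr2 \<delta>0)
      show "\<forall>\<^sub>F n in sequentially. 0 \<le> \<delta> n"
        using \<delta> by (intro always_eventually allI less_imp_le)
    qed (use \<theta> \<alpha> \<kappa> in auto)
    then show "(\<lambda>n. (K * j) * \<delta> n powr (\<kappa> + \<alpha> - 1)) \<longlonglongrightarrow> 0" by simp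
  qed
  moreover have "(\<lambda>n. LINT u|lborel. a n u) \<longlonglongrightarrow> X \<tau> - X 0"
    using forward_average_LIMSEQ[OF X, of \<tau>] \<tau> unfolding a_def \<delta>_def by simp
  moreover have "(LINT u|lborel. b n u) = (LINT u|lborel. indicator {0<..<T} u * (real (Suc n) * (Z (u + 1 / real (Suc n)) - Z u) * (indicator {0..\<tau>} u * f u)))" for n
    using AE_lborel_singleton[of \<tau>] \<tau>
    by (intro integral_cong_AE) (auto simp: b_def[abs_def] \<delta>_def indicator_def)
  with Llim have "(\<lambda>n. LINT u|lborel. b n u) \<longlonglongrightarrow> L" by simp
  ultimately have "(\<lambda>n. 0) \<longlonglongrightarrow> (X \<tau> - X 0 - L) - 0" 
    using tendsto_diff[OF tendsto_diff] by fastforce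
  then have "L = X \<tau> - X 0" by (simp add: LIMSEQ_const_iff)
  then show ?thesis using L by simp
qed

section \<open>Functions of bounded variation and the transform of the coefficient\<close>

text \<open>The majorant is the total variation over \<open>{a..x}\<close>, taken as the supremum
  \<open>Sup (S x)\<close> of partition sums. Prolonging a partition of \<open>{a..x}\<close> to y
  gains at least the jump of \<open>f\<close> from x to y.\<close>

lemma bounded_variation_monotone_majorant:
  assumes "bounded_variation_on a b f"
  obtains V where "\<And>x y. a \<le> x \<Longrightarrow> x \<le> y \<Longrightarrow> y \<le> b \<Longrightarrow> \<bar>f y - f x\<bar> \<le> V y - V x"
proof -
  define P where "P x n p \<longleftrightarrow> (\<forall>i\<le>n. p i \<in> {a..x}) \<and> (\<forall>i<n. p i \<le> p (Suc i))" for x and n :: nat and p :: "nat \<Rightarrow> real"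
  define S where "S x = {\<Sum>i<n. \<bar>f (p (Suc i)) - f (p i)\<bar> | n p. P x n p}" for x
  obtain W where W: "\<And>n p. P b n p \<Longrightarrow> (\<Sum>i<n. \<bar>f (p (Suc i)) - f (p i)\<bar>) \<le> W"
    using assms unfolding bounded_variation_on_def P_def by blast
  have bdd: "bdd_above (S x)" if "x \<le> b" for x
  proof (rule bdd_aboveI)
    fix v assume "v \<in> S x"
    then obtain n p where v: "v = (\<Sum>i<n. \<bar>f (p (Suc i)) - f (p i)\<bar>)" and "P x n p"
      unfolding S_def by blast
    then have "P b n p" using that unfolding P_def by force
    then show "v \<le> W" using W v by blast
  qed
  have "\<bar>f y - f x\<bar> \<le> Sup (S y) - Sup (S x)" if xy: "a \<le> x" "x \<le> y" "y \<le> b" for x y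
  proof -
    have "Sup (S x) \<le> Sup (S y) - \<bar>f y - f x\<bar>"
    proof (rule cSup_least)
      have "P x 0 (\<lambda>_. x)" using xy by (simp add: P_def)
      then show "S x \<noteq> {}" unfolding S_def by blast
      fix v assume "v \<in> S x"
      then obtain n p where v: "v = (\<Sum>i<n. \<bar>f (p (Suc i)) - f (p i)\<bar>)" and p: "P x n p"
        unfolding S_def by blast
      \<comment> \<open>After its last point \<open>p n\<close> the partition moves to x and only
        then to y; the stop at x isolates the summand for the pair x, y even if \<open>p n\<close>
        lies below x.\<close>
      define q where "q i = (if i \<le> n then p i else if i = Suc n then x else y)" for i
      have "P y (Suc (Suc n)) q"
        using p xy unfolding P_def q_def by (fastforce simp: less_Suc_eq_le le_Suc_eq)
      then have "(\<Sum>i<Suc (Suc n). \<bar>f (q (Suc i)) - f (q i)\<bar>) \<in> S y" unfolding S_def by blast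
      then have "(\<Sum>i<Suc (Suc n). \<bar>f (q (Suc i)) - f (q i)\<bar>) \<le> Sup (S y)"
        by (rule cSup_upper[OF _ bdd[OF xy(3)]])
      moreover have "(\<Sum>i<Suc (Suc n). \<bar>f (q (Suc i)) - f (q i)\<bar>) = v + \<bar>f x - f (p n)\<bar> + \<bar>f y - f x\<bar>"
      proof -
        have "(\<Sum>i<n. \<bar>f (q (Suc i)) - f (q i)\<bar>) = v" unfolding v by (rule sum.cong) (auto simp: q_def)
        then show ?thesis by (simp add: q_def)
      qed
      ultimately show "v \<le> Sup (S y) - \<bar>f y - f x\<bar>" by linarith
    qed
    then show ?thesis by linarith
  qed
  then show ?thesis by (rule that)
qed

lemma bounded_variation_bounded:
  assumes "bounded_variation_on a b f"
  obtains B where "\<And>x. x \<in> {a..b} \<Longrightarrow> \<bar>f x\<bar> \<le> B"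
proof -
  obtain V where V: "\<And>x y. a \<le> x \<Longrightarrow> x \<le> y \<Longrightarrow> y \<le> b \<Longrightarrow> \<bar>f y - f x\<bar> \<le> V y - V x"
    using bounded_variation_monotone_majorant[OF assms] by blast
  have "\<bar>f x\<bar> \<le> \<bar>f a\<bar> + (V b - V a)" if "x \<in> {a..b}" for x
    using V[of a x] V[of x b] that by auto
  then show ?thesis by (rule that)
qed

text \<open>By the Jordan decomposition, \<open>f\<close> is on the interval the difference of the
  increasing functions \<open>V\<close> and \<open>V - f\<close>.\<close>

lemma bounded_variation_measurable:
  fixes f :: "real \<Rightarrow> real"
  assumes "bounded_variation_on a b f"
  shows "(\<lambda>x. indicator {a..b} x * f x) \<in> borel_measurable borel"
proof -
  obtain V where V: "\<And>x y. a \<le> x \<Longrightarrow> x \<le> y \<Longrightarrow> y \<le> b \<Longrightarrow> \<bar>f y - f x\<bar> \<le> V y - V x"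
    using bounded_variation_monotone_majorant[OF assms] by blast
  have "mono_on {a..b} V" "mono_on {a..b} (\<lambda>x. V x - f x)"
    using V by (force intro!: mono_onI)+
  then have "(\<lambda>x. V x - (V x - f x)) \<in> borel_measurable (restrict_space borel {a..b})"
    by (intro borel_measurable_diff borel_measurable_mono_on_fnc)
  then have "f \<in> borel_measurable (restrict_space borel {a..b})" by simp
  then show ?thesis
    by (subst (asm) borel_measurable_restrict_space_iff) (simp_all add: mult.commute)
qed

text \<open>The measure is the image of Lebesgue measure under a generalised inverse of the
  variation function.\<close>

lemma bounded_variation_measure:
  fixes f :: "real \<Rightarrow> real"
  assumes "bounded_variation_on a b f" "a \<le> b"
  obtains \<mu> :: "real measure" where "finite_measure \<mu>" "sets \<mu> = sets borel"
    "\<And>u v. a \<le> u \<Longrightarrow> u \<le> v \<Longrightarrow> v \<le> b \<Longrightarrow> ennreal \<bar>f v - f u\<bar> \<le> emeasure \<mu> {u..v}"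
proof -
  obtain V where V: "\<And>x y. a \<le> x \<Longrightarrow> x \<le> y \<Longrightarrow> y \<le> b \<Longrightarrow> \<bar>f y - f x\<bar> \<le> V y - V x"
    using bounded_variation_monotone_majorant[OF assms(1)] by blast
  define S where "S r = {x \<in> {a..b}. V x \<le> r}" for r
  define y where "y r = Sup (S r)" for r
  define R where "R = restrict_space lborel {V a..V b}"
  have mono: "V u \<le> V v" if "a \<le> u" "u \<le> v" "v \<le> b" for u v
    using V[OF that] by linarith
  have bdd: "bdd_above (S r)" for r unfolding S_def by (rule bdd_aboveI[of _ b]) auto
  have ne: "a \<in> S r" if "V a \<le> r" for r using that assms(2) by (simp add: S_def)
  have "mono_on {V a..V b} y"
    unfolding y_def
  proof (intro mono_onI cSup_subset_mono bdd)
    fix r s assume "r \<in> {V a..V b}" "r \<le> s"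
    then show "S r \<noteq> {}" "S r \<subseteq> S s" using ne[of r] by (auto simp: S_def)
  qed
  then have y_meas [measurable]: "y \<in> borel_measurable R"
    unfolding R_def using borel_measurable_mono_on_fnc measurable_cong_sets[OF sets_restrict_space_cong[OF sets_lborel] refl] by blast
  show ?thesis
  proof (rule that[of "distr R borel y"])
    have "emeasure R (space R) = emeasure lborel {V a..V b}"
      by (simp add: R_def emeasure_restrict_space space_restrict_space)
    then have "finite_measure R" by (intro finite_measureI) (simp add: emeasure_lborel_Icc_eq)
    then show "finite_measure (distr R borel y)"
      by (rule finite_measure.finite_measure_distr) (rule y_meas)
    fix u v assume uv: "a \<le> u" "u \<le> v" "v \<le> b"
    \<comment> \<open>If V u \<le> r < V v, then u lies in the sublevel set \<open>S r\<close>,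
      while every point of \<open>S r\<close> is at most v; so its supremum \<open>y r\<close> lies
      in \<open>{u..v}\<close>. \<open>V\<close> may jump anywhere: an inequality for closed
      intervals takes the place of the Lebesgue-Stieltjes identity.\<close>
    have "{V u..<V v} \<subseteq> y -` {u..v} \<inter> space R"
    proof
      fix r assume r: "r \<in> {V u..<V v}"
      have "u \<le> y r" unfolding y_def
        by (rule cSup_upper[OF _ bdd]) (use r uv in \<open>auto simp: S_def\<close>)
      moreover have "y r \<le> v" unfolding y_def
      proof (rule cSup_least)
        have "u \<in> S r" using r uv by (simp add: S_def)
        then show "S r \<noteq> {}" by blast
        fix x assume "x \<in> S r"
        then show "x \<le> v" using r mono[of v x] uv by (force simp: S_def)
      qed
      ultimately show "r \<in> y -` {u..v} \<inter> space R"
        using r mono[of a u] mono[of v b] uv by (auto simp: R_def space_restrict_space)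
    qed
    moreover have "{V u..<V v} \<subseteq> {V a..V b}" using mono[of a u] mono[of v b] uv by auto
    then have "emeasure lborel {V u..<V v} = emeasure R {V u..<V v}"
      by (simp add: R_def emeasure_restrict_space)
    ultimately have "emeasure lborel {V u..<V v} \<le> emeasure R (y -` {u..v} \<inter> space R)"
      using measurable_sets[OF y_meas, of "{u..v}"] by (auto intro: emeasure_mono)
    moreover have "ennreal \<bar>f v - f u\<bar> \<le> emeasure lborel {V u..<V v}"
      using V[OF uv] mono[OF uv] by (simp add: ennreal_leI)
    ultimately show "ennreal \<bar>f v - f u\<bar> \<le> emeasure (distr R borel y) {u..v}"
      by (subst emeasure_distr) auto
  qed simp
qed

text \<open>Markov's inequality for the kernel y -> |z - y| powr (-p): every point between z and z'
  is within r of z, so the kernel is at least r powr (-p) there.\<close>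

lemma emeasure_interval_le:
  fixes \<nu> :: "real measure"
  assumes [measurable_cong]: "sets \<nu> = sets borel" and r: "0 < r" "\<bar>z - z'\<bar> \<le> r" and p: "0 < p"
  shows "emeasure \<nu> {min z z'..max z z'}
    \<le> ennreal (r powr p) * (\<integral>\<^sup>+y. inverse (ennreal (\<bar>z - y\<bar> powr p)) \<partial>\<nu>)"
proof -
  have "emeasure \<nu> {min z z'..max z z'} = (\<integral>\<^sup>+y. indicator {min z z'..max z z'} y \<partial>\<nu>)"
    using assms(1) by simp
  also have "\<dots> \<le> (\<integral>\<^sup>+y. ennreal (r powr p) * inverse (ennreal (\<bar>z - y\<bar> powr p)) \<partial>\<nu>)"
  proof (rule nn_integral_mono)
    fix y
    show "indicator {min z z'..max z z'} y \<le> ennreal (r powr p) * inverse (ennreal (\<bar>z - y\<bar> powr p))"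
    proof (cases "y \<in> {min z z'..max z z'}")
      case True
      then have y: "\<bar>z - y\<bar> \<le> r" using r by auto
      show ?thesis
      proof (cases "y = z")
        \<comment> \<open>At y = z the kernel is infinite, and r > 0 keeps its product with r powr p
          infinite.\<close>
        case True
        then show ?thesis using r p by (simp add: ennreal_mult_top)
      next
        case False
        then have "\<bar>z - y\<bar> powr p > 0" by simp
        moreover have "\<bar>z - y\<bar> powr p \<le> r powr p" using y p by (intro powr_mono2) auto
        ultimately have "1 \<le> r powr p * inverse (\<bar>z - y\<bar> powr p)" by (simp add: field_simps)
        then have "1 \<le> ennreal (r powr p * inverse (\<bar>z - y\<bar> powr p))" by simp
        also have "\<dots> = ennreal (r powr p) * inverse (ennreal (\<bar>z - y\<bar> powr p))"
          using \<open>\<bar>z - y\<bar> powr p > 0\<close> by (subst ennreal_mult) (auto simp: inverse_ennreal)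
        finally show ?thesis using \<open>y \<in> {min z z'..max z z'}\<close> by simp
      qed
    qed simp
  qed
  also have "\<dots> = ennreal (r powr p) * (\<integral>\<^sup>+y. inverse (ennreal (\<bar>z - y\<bar> powr p)) \<partial>\<nu>)"
    by (rule nn_integral_cmult) measurable
  finally show ?thesis .
qed

section \<open>The transform \<open>Lam\<close>, its inverse and its first-order expansion\<close>

locale sde_coefficient =
  fixes \<sigma> :: "real \<Rightarrow> real" and a :: real
  assumes bv: "locally_bounded_variation \<sigma>"
    and sign: "(\<forall>x. 0 \<le> \<sigma> x) \<or> (\<forall>x. \<sigma> x \<le> 0)"
    and reciprocal: "locally_integrable_reciprocal \<sigma>"
begin

lemma reciprocal_integrable: "set_integrable lborel {u..v} (\<lambda>y. 1 / \<sigma> y)"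
  using reciprocal by (simp add: locally_integrable_reciprocal_def)

lemma \<sigma>_nonzero: "AE y in lborel. \<sigma> y \<noteq> 0"
  using reciprocal by (simp add: locally_integrable_reciprocal_def)

lemma Lam_diff:
  assumes "u \<le> v"
  shows "Lam \<sigma> a v - Lam \<sigma> a u = (LINT y:{u..v}|lborel. 1 / \<sigma> y)"
proof -
  have "(LBINT y=ereal a..ereal u. 1 / \<sigma> y) + (LBINT y=ereal u..ereal v. 1 / \<sigma> y) = (LBINT y=ereal a..ereal v. 1 / \<sigma> y)"
  proof (rule interval_integral_sum)
    have "set_integrable lborel {min a (min u v)<..<max a (max u v)} (\<lambda>y. 1 / \<sigma> y)"
      by (rule set_integrable_subset[OF reciprocal_integrable[of "min a (min u v)" "max a (max u v)"]]) auto
    then show "interval_lebesgue_integrable lborel (min (ereal a) (min (ereal u) (ereal v)))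
        (max (ereal a) (max (ereal u) (ereal v))) (\<lambda>y. 1 / \<sigma> y)"
      unfolding interval_lebesgue_integrable_def by (simp add: ereal_min[symmetric] ereal_max[symmetric] del: ereal_min ereal_max)
  qed
  then show ?thesis using assms by (simp add: Lam_def interval_integral_Icc)
qed

text \<open>As \<sigma> has one sign, the integral of its reciprocal admits no cancellation, so
  absolute values may be moved inside.\<close>

lemma abs_Lam_diff:
  assumes "u \<le> v"
  shows "\<bar>Lam \<sigma> a v - Lam \<sigma> a u\<bar> = (LINT y:{u..v}|lborel. \<bar>1 / \<sigma> y\<bar>)"
  using sign
proof
  assume pos: "\<forall>x. 0 \<le> \<sigma> x"
  have "(LINT y:{u..v}|lborel. \<bar>1 / \<sigma> y\<bar>) = (LINT y:{u..v}|lborel. 1 / \<sigma> y)"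
    using pos by simp
  moreover have "(LINT y:{u..v}|lborel. \<bar>1 / \<sigma> y\<bar>) \<ge> 0"
    unfolding set_lebesgue_integral_def by (rule integral_nonneg_AE) simp
  ultimately show ?thesis using Lam_diff[OF assms] by simp
next
  assume neg: "\<forall>x. \<sigma> x \<le> 0"
  have "(LINT y:{u..v}|lborel. \<bar>1 / \<sigma> y\<bar>) = (LINT y:{u..v}|lborel. - (1 / \<sigma> y))"
    using neg by (simp add: abs_of_nonpos)
  also have "\<dots> = - (LINT y:{u..v}|lborel. 1 / \<sigma> y)"
    by (rule set_integral_uminus[OF reciprocal_integrable])
  finally have 1: "(LINT y:{u..v}|lborel. \<bar>1 / \<sigma> y\<bar>) = - (LINT y:{u..v}|lborel. 1 / \<sigma> y)" .
  moreover have "(LINT y:{u..v}|lborel. \<bar>1 / \<sigma> y\<bar>) \<ge> 0"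
    unfolding set_lebesgue_integral_def by (rule integral_nonneg_AE) simp
  ultimately show ?thesis using Lam_diff[OF assms] by simp
qed

lemma Lam_mono_or_antimono: "mono (Lam \<sigma> a) \<or> antimono (Lam \<sigma> a)"
  using sign
proof (elim disj_forward)
  assume pos: "\<forall>x. 0 \<le> \<sigma> x"
  show "mono (Lam \<sigma> a)"
  proof
    fix u v :: real assume "u \<le> v"
    moreover have "0 \<le> (LINT y:{u..v}|lborel. 1 / \<sigma> y)"
      unfolding set_lebesgue_integral_def using pos by (intro integral_nonneg_AE) simp
    ultimately show "Lam \<sigma> a u \<le> Lam \<sigma> a v" using Lam_diff[of u v] by simp
  qed
next
  assume neg: "\<forall>x. \<sigma> x \<le> 0"
  show "antimono (Lam \<sigma> a)"
  proof
    fix u v :: real assume "u \<le> v"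
    moreover have "0 \<le> (LINT y:{u..v}|lborel. - (1 / \<sigma> y))"
      unfolding set_lebesgue_integral_def using neg
      by (intro integral_nonneg_AE) (simp add: divide_nonneg_nonpos mult_nonneg_nonpos)
    ultimately show "Lam \<sigma> a v \<le> Lam \<sigma> a u"
      using Lam_diff[of u v] set_integral_uminus[OF reciprocal_integrable, of u v] by simp
  qed
qed

lemma Lam_between:
  assumes "u \<le> y" "y \<le> v"
  shows "Lam \<sigma> a y \<in> {min (Lam \<sigma> a u) (Lam \<sigma> a v)..max (Lam \<sigma> a u) (Lam \<sigma> a v)}"
  using Lam_mono_or_antimono
proof
  assume "mono (Lam \<sigma> a)"
  from monoD[OF this assms(1)] monoD[OF this assms(2)] show ?thesis by auto
next
  assume "antimono (Lam \<sigma> a)"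
  from antimonoD[OF this assms(1)] antimonoD[OF this assms(2)] show ?thesis by auto
qed

text \<open>Write v - u as the integral of 1. Almost everywhere 1 - \<sigma> w / \<sigma> y =
  (\<sigma> y - \<sigma> w) / \<sigma> y, because \<sigma> vanishes only on a null set, and this is
  at most m times |1 / \<sigma> y|. No derivative of \<open>Lam\<close> is taken at any point. The
  base point w is arbitrary, so either end of the interval can serve.\<close>

lemma Lam_expansion:
  assumes uv: "u \<le> v" and m: "\<And>y. y \<in> {u..v} \<Longrightarrow> \<bar>\<sigma> y - \<sigma> w\<bar> \<le> m"
  shows "\<bar>v - u - \<sigma> w * (Lam \<sigma> a v - Lam \<sigma> a u)\<bar> \<le> m * \<bar>Lam \<sigma> a v - Lam \<sigma> a u\<bar>"
proof -
  have one: "set_integrable lborel {u..v} (\<lambda>_. 1 :: real)"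
    unfolding set_integrable_def by (simp add: integrable_real_indicator emeasure_lborel_Icc_eq)
  have r: "set_integrable lborel {u..v} (\<lambda>y. \<sigma> w * (1 / \<sigma> y))"
    by (rule set_integrable_mult_right[OF reciprocal_integrable])
  have "v - u - \<sigma> w * (Lam \<sigma> a v - Lam \<sigma> a u)
      = (LINT y:{u..v}|lborel. 1) - (LINT y:{u..v}|lborel. \<sigma> w * (1 / \<sigma> y))"
    unfolding Lam_diff[OF uv] set_integral_mult_right
    using uv by (simp add: set_lebesgue_integral_def)
  also have "\<dots> = (LINT y:{u..v}|lborel. 1 - \<sigma> w * (1 / \<sigma> y))"
    by (rule set_integral_diff(2)[OF one r, symmetric])
  finally have eq: "v - u - \<sigma> w * (Lam \<sigma> a v - Lam \<sigma> a u) = \<dots>" .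
  have "\<bar>LINT y:{u..v}|lborel. 1 - \<sigma> w * (1 / \<sigma> y)\<bar> \<le> (LINT y:{u..v}|lborel. \<bar>1 - \<sigma> w * (1 / \<sigma> y)\<bar>)"
    using integral_abs_bound[of lborel "\<lambda>y. indicator {u..v} y * (1 - \<sigma> w * (1 / \<sigma> y))"]
    by (simp add: set_lebesgue_integral_def abs_mult)
  also have "\<dots> \<le> (LINT y:{u..v}|lborel. m * \<bar>1 / \<sigma> y\<bar>)"
  proof (rule set_integral_mono_AE)
    show "set_integrable lborel {u..v} (\<lambda>y. \<bar>1 - \<sigma> w * (1 / \<sigma> y)\<bar>)"
      by (intro set_integrable_abs set_integral_diff(1) one r)
    show "set_integrable lborel {u..v} (\<lambda>y. m * \<bar>1 / \<sigma> y\<bar>)"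
      by (intro set_integrable_mult_right set_integrable_abs reciprocal_integrable)
    show "AE y\<in>{u..v} in lborel. \<bar>1 - \<sigma> w * (1 / \<sigma> y)\<bar> \<le> m * \<bar>1 / \<sigma> y\<bar>"
      using \<sigma>_nonzero
    proof eventually_elim
      case (elim y)
      show ?case
      proof
        assume "y \<in> {u..v}"
        have "1 - \<sigma> w * (1 / \<sigma> y) = (\<sigma> y - \<sigma> w) * (1 / \<sigma> y)"
          using elim by (simp add: field_simps)
        then show "\<bar>1 - \<sigma> w * (1 / \<sigma> y)\<bar> \<le> m * \<bar>1 / \<sigma> y\<bar>"
          using mult_right_mono[OF m[OF \<open>y \<in> {u..v}\<close>], of "\<bar>1 / \<sigma> y\<bar>"] by (simp only: abs_mult abs_ge_zero)
      qed
    qed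
  qed
  also have "\<dots> = m * \<bar>Lam \<sigma> a v - Lam \<sigma> a u\<bar>"
    unfolding abs_Lam_diff[OF uv] by (rule set_integral_mult_right)
  finally show ?thesis unfolding eq .
qed

lemma \<sigma>_bounded:
  obtains B where "0 \<le> B" "\<And>x. x \<in> {u..v} \<Longrightarrow> \<bar>\<sigma> x\<bar> \<le> B"
proof -
  obtain B where B: "\<And>x. x \<in> {u..v} \<Longrightarrow> \<bar>\<sigma> x\<bar> \<le> B"
    using bounded_variation_bounded[of u v \<sigma>] bv unfolding locally_bounded_variation_def by blast
  then have "\<bar>\<sigma> x\<bar> \<le> max B 0" if "x \<in> {u..v}" for x using that by (meson max.coboundedI1)
  then show ?thesis by (intro that[of "max B 0"]) auto
qed

text \<open>This makes the inverse of \<open>Lam\<close> Lipschitz over bounded sets. If B bounds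
  |\<sigma>|, the oscillation of \<sigma> is at most 2 B, and the linear term \<sigma> y times the
  increment of \<open>Lam\<close> adds another B; hence the factor 3 B.\<close>

lemma Lam_expanding:
  obtains B where "0 \<le> B" "\<And>x y. x \<in> {u..v} \<Longrightarrow> y \<in> {u..v} \<Longrightarrow> \<bar>x - y\<bar> \<le> B * \<bar>Lam \<sigma> a x - Lam \<sigma> a y\<bar>"
proof -
  obtain B where B: "0 \<le> B" "\<And>x. x \<in> {u..v} \<Longrightarrow> \<bar>\<sigma> x\<bar> \<le> B" using \<sigma>_bounded by blast
  have le: "\<bar>x - y\<bar> \<le> (3 * B) * \<bar>Lam \<sigma> a x - Lam \<sigma> a y\<bar>" if xy: "x \<in> {u..v}" "y \<in> {u..v}" "y \<le> x" for x y
  proof -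
    have "\<bar>\<sigma> z - \<sigma> y\<bar> \<le> 2 * B" if "z \<in> {y..x}" for z
      using B(2)[of z] B(2)[of y] that xy by auto
    then have "\<bar>x - y - \<sigma> y * (Lam \<sigma> a x - Lam \<sigma> a y)\<bar> \<le> (2 * B) * \<bar>Lam \<sigma> a x - Lam \<sigma> a y\<bar>"
      by (rule Lam_expansion[OF xy(3)])
    moreover have "\<bar>\<sigma> y * (Lam \<sigma> a x - Lam \<sigma> a y)\<bar> \<le> B * \<bar>Lam \<sigma> a x - Lam \<sigma> a y\<bar>"
      unfolding abs_mult by (intro mult_right_mono B xy) simp
    ultimately show ?thesis by linarith
  qed
  have "\<bar>x - y\<bar> \<le> (3 * B) * \<bar>Lam \<sigma> a x - Lam \<sigma> a y\<bar>" if "x \<in> {u..v}" "y \<in> {u..v}" for x y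
    using le[of x y] le[of y x] that by (cases "y \<le> x") (auto simp: abs_minus_commute)
  then show ?thesis using B(1) by (intro that[of "3 * B"]) auto
qed

lemma inj_Lam: "inj (Lam \<sigma> a)"
proof (rule injI)
  fix x y assume eq: "Lam \<sigma> a x = Lam \<sigma> a y"
  show "x = y"
  proof (rule Lam_expanding[of "min x y" "max x y"])
    fix B assume "\<And>x' y'. x' \<in> {min x y..max x y} \<Longrightarrow> y' \<in> {min x y..max x y} \<Longrightarrow> \<bar>x' - y'\<bar> \<le> B * \<bar>Lam \<sigma> a x' - Lam \<sigma> a y'\<bar>"
    from this[of x y] show "x = y" using eq by simp
  qed
qed

lemma continuous_on_Lam: "continuous_on UNIV (Lam \<sigma> a)"
proof -
  have "isCont (Lam \<sigma> a) x" for x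
  proof -
    have "(\<lambda>y. 1 / \<sigma> y) integrable_on {x-1..x+1}"
      by (rule set_borel_integral_eq_integral(1)[OF reciprocal_integrable])
    then have cont: "continuous_on {x-1..x+1} (\<lambda>y. Lam \<sigma> a (x - 1) + integral {x-1..y} (\<lambda>y. 1 / \<sigma> y))"
      by (intro continuous_intros indefinite_integral_continuous_1)
    have "Lam \<sigma> a y = Lam \<sigma> a (x - 1) + integral {x-1..y} (\<lambda>y. 1 / \<sigma> y)" if "y \<in> {x-1..x+1}" for y
      using Lam_diff[of "x - 1" y] set_borel_integral_eq_integral(2)[OF reciprocal_integrable] that by simp
    then have "continuous_on {x-1..x+1} (Lam \<sigma> a)"
      using continuous_on_cong[THEN iffD2, OF refl _ cont] by blast
    then show ?thesis by (rule continuous_on_interior) simp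
  qed
  then show ?thesis by (simp add: continuous_on_eq_continuous_at)
qed

lemma Lam_measurable [measurable]: "Lam \<sigma> a \<in> borel_measurable borel"
  by (rule borel_measurable_continuous_onI[OF continuous_on_Lam])

lemma inv_Lam_measurable [measurable]: "inv (Lam \<sigma> a) \<in> borel_measurable borel"
proof -
  define R where "R = range (Lam \<sigma> a)"
  have "is_interval R"
    unfolding R_def is_interval_connected_1 by (rule connected_continuous_image[OF continuous_on_Lam connected_UNIV])
  then have R: "R \<in> sets borel" by (rule real_interval_borel_measurable)
  have inv: "inv (Lam \<sigma> a) (Lam \<sigma> a x) = x" for x using inj_Lam by simp
  have on_R: "inv (Lam \<sigma> a) \<in> borel_measurable (restrict_space borel R)"
    using Lam_mono_or_antimono
  proof
    assume "mono (Lam \<sigma> a)"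
    then have "strict_mono (Lam \<sigma> a)" using inj_Lam by (simp add: strict_mono_iff_mono)
    then have "mono_on R (inv (Lam \<sigma> a))"
      unfolding R_def by (intro mono_onI) (auto simp: inv strict_mono_less_eq)
    then show ?thesis by (rule borel_measurable_mono_on_fnc)
  next
    assume "antimono (Lam \<sigma> a)"
    have "mono_on R (\<lambda>z. - inv (Lam \<sigma> a) z)"
    proof (rule mono_onI)
      fix r s assume "r \<in> R" "s \<in> R" "r \<le> s"
      then obtain x y where xy: "r = Lam \<sigma> a x" "s = Lam \<sigma> a y" by (auto simp: R_def)
      have "y \<le> x"
      proof (rule ccontr)
        assume "\<not> y \<le> x"
        then have "s \<le> r" using antimonoD[OF \<open>antimono (Lam \<sigma> a)\<close>, of x y] xy by simp
        then show False using \<open>r \<le> s\<close> \<open>\<not> y \<le> x\<close> xy inj_Lam by (auto dest: injD)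
      qed
      then show "- inv (Lam \<sigma> a) r \<le> - inv (Lam \<sigma> a) s" by (simp add: xy inv)
    qed
    then have "(\<lambda>z. - (- inv (Lam \<sigma> a) z)) \<in> borel_measurable (restrict_space borel R)"
      by (intro borel_measurable_uminus borel_measurable_mono_on_fnc)
    then show ?thesis by simp
  qed
  \<comment> \<open>Off the range no point satisfies the choice predicate, so \<open>inv\<close>
    returns one and the same unspecified value for all such z.\<close>
  have "inv (Lam \<sigma> a) z = (SOME x. False)" if "z \<notin> R" for z
  proof -
    have "Lam \<sigma> a x = z \<longleftrightarrow> False" for x using that by (auto simp: R_def)
    then show ?thesis by (simp add: inv_def inv_into_def)
  qed
  then have "(\<lambda>z. if z \<in> R then inv (Lam \<sigma> a) z else (SOME x. False)) = inv (Lam \<sigma> a)" by auto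
  moreover have "(\<lambda>z. if z \<in> R then inv (Lam \<sigma> a) z else (SOME x. False)) \<in> borel_measurable borel"
    using on_R R by (subst measurable_If_restrict_space_iff) (auto simp: space_restrict_space)
  ultimately show ?thesis by simp
qed

text \<open>The variation measure of \<sigma> is pushed forward along \<open>Lam\<close>. By
  monotonicity \<open>{x..y}\<close> lies in the preimage of the interval between the images of its
  end points; min and max cover increasing and decreasing \<open>Lam\<close> alike.\<close>

lemma variation_measure:
  assumes "u \<le> v"
  obtains \<nu> :: "real measure" where "finite_measure \<nu>" "sets \<nu> = sets borel"
    "\<And>x y. x \<in> {u..v} \<Longrightarrow> y \<in> {u..v} \<Longrightarrow> ennreal \<bar>\<sigma> x - \<sigma> y\<bar>
      \<le> emeasure \<nu> {min (Lam \<sigma> a x) (Lam \<sigma> a y)..max (Lam \<sigma> a x) (Lam \<sigma> a y)}"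
proof -
  have "bounded_variation_on u v \<sigma>" using bv by (simp add: locally_bounded_variation_def)
  then obtain \<mu> :: "real measure" where \<mu>: "finite_measure \<mu>" and s[measurable_cong]: "sets \<mu> = sets borel"
    and le: "\<And>x y. u \<le> x \<Longrightarrow> x \<le> y \<Longrightarrow> y \<le> v \<Longrightarrow> ennreal \<bar>\<sigma> y - \<sigma> x\<bar> \<le> emeasure \<mu> {x..y}"
    using bounded_variation_measure[OF _ assms] by blast
  have le': "ennreal \<bar>\<sigma> x - \<sigma> y\<bar> \<le> emeasure (distr \<mu> borel (Lam \<sigma> a)) {min (Lam \<sigma> a x) (Lam \<sigma> a y)..max (Lam \<sigma> a x) (Lam \<sigma> a y)}"
    if "x \<in> {u..v}" "y \<in> {u..v}" "x \<le> y" for x y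
  proof -
    let ?I = "{min (Lam \<sigma> a x) (Lam \<sigma> a y)..max (Lam \<sigma> a x) (Lam \<sigma> a y)}"
    have "ennreal \<bar>\<sigma> x - \<sigma> y\<bar> \<le> emeasure \<mu> {x..y}"
      using le[of x y] that by (simp add: abs_minus_commute)
    also have "\<dots> \<le> emeasure \<mu> (Lam \<sigma> a -` ?I \<inter> space \<mu>)"
    proof (rule emeasure_mono)
      have "space \<mu> = UNIV" using sets_eq_imp_space_eq[OF s] by simp
      then show "{x..y} \<subseteq> Lam \<sigma> a -` ?I \<inter> space \<mu>" using Lam_between[of x _ y] by auto
      show "Lam \<sigma> a -` ?I \<inter> space \<mu> \<in> sets \<mu>" by measurable
    qed
    finally show ?thesis by (subst emeasure_distr) auto
  qed
  show ?thesis
  proof (rule that[of "distr \<mu> borel (Lam \<sigma> a)"])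
    show "finite_measure (distr \<mu> borel (Lam \<sigma> a))"
      by (rule finite_measure.finite_measure_distr[OF \<mu>]) measurable
    fix x y assume "x \<in> {u..v}" "y \<in> {u..v}"
    then show "ennreal \<bar>\<sigma> x - \<sigma> y\<bar> \<le> emeasure (distr \<mu> borel (Lam \<sigma> a)) {min (Lam \<sigma> a x) (Lam \<sigma> a y)..max (Lam \<sigma> a x) (Lam \<sigma> a y)}"
      using le'[of x y] le'[of y x] by (cases "x \<le> y") (auto simp: abs_minus_commute min.commute max.commute)
  qed simp
qed

text \<open>For z between x and y, the interval between the images of z and x is part of that
  between the images of x and y. One number m, the \<nu>-measure of the latter, therefore controls
  \<sigma> z - \<sigma> x for all such z at once.\<close>

lemma Lam_expansion_measure:
  assumes \<nu>: "finite_measure \<nu>" "sets \<nu> = sets borel"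
    and le: "\<And>x y. x \<in> {u..v} \<Longrightarrow> y \<in> {u..v} \<Longrightarrow> ennreal \<bar>\<sigma> x - \<sigma> y\<bar>
      \<le> emeasure \<nu> {min (Lam \<sigma> a x) (Lam \<sigma> a y)..max (Lam \<sigma> a x) (Lam \<sigma> a y)}"
    and xy: "x \<in> {u..v}" "y \<in> {u..v}"
  shows "ennreal \<bar>y - x - \<sigma> x * (Lam \<sigma> a y - Lam \<sigma> a x)\<bar>
    \<le> ennreal \<bar>Lam \<sigma> a y - Lam \<sigma> a x\<bar> * emeasure \<nu> {min (Lam \<sigma> a x) (Lam \<sigma> a y)..max (Lam \<sigma> a x) (Lam \<sigma> a y)}"
proof -
  interpret finite_measure \<nu> by fact
  let ?I = "\<lambda>x y. {min (Lam \<sigma> a x) (Lam \<sigma> a y)..max (Lam \<sigma> a x) (Lam \<sigma> a y)}"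
  define m where "m = measure \<nu> (?I x y)"
  have m: "\<bar>\<sigma> z - \<sigma> x\<bar> \<le> m" if z: "z \<in> {min x y..max x y}" for z
  proof -
    have "Lam \<sigma> a z \<in> ?I x y" using Lam_between[of x z y] Lam_between[of y z x] z
      by (auto simp: min_def max_def split: if_splits)
    then have sub: "?I z x \<subseteq> ?I x y" by auto
    have "ennreal \<bar>\<sigma> z - \<sigma> x\<bar> \<le> emeasure \<nu> (?I z x)" using xy z by (intro le) auto
    also have "\<dots> \<le> emeasure \<nu> (?I x y)" by (rule emeasure_mono[OF sub]) (simp add: \<nu>)
    finally show ?thesis unfolding m_def emeasure_eq_measure by (subst (asm) ennreal_le_iff) auto
  qed
  have "\<bar>y - x - \<sigma> x * (Lam \<sigma> a y - Lam \<sigma> a x)\<bar> \<le> m * \<bar>Lam \<sigma> a y - Lam \<sigma> a x\<bar>"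
  proof (cases "x \<le> y")
    case True
    then show ?thesis using m by (intro Lam_expansion) auto
  next
    case False
    \<comment> \<open>The base value is still \<sigma> x, now taken at the right end of
      \<open>{y..x}\<close>; this uses the free base point of \<open>Lam_expansion\<close>.\<close>
    then have "\<bar>x - y - \<sigma> x * (Lam \<sigma> a x - Lam \<sigma> a y)\<bar> \<le> m * \<bar>Lam \<sigma> a x - Lam \<sigma> a y\<bar>"
      using m by (intro Lam_expansion) auto
    moreover have "y - x - \<sigma> x * (Lam \<sigma> a y - Lam \<sigma> a x) = - (x - y - \<sigma> x * (Lam \<sigma> a x - Lam \<sigma> a y))"
      by (simp add: algebra_simps)
    ultimately show ?thesis by (simp only: abs_minus_cancel abs_minus_commute[of "Lam \<sigma> a y"])
  qed
  then have "ennreal \<bar>y - x - \<sigma> x * (Lam \<sigma> a y - Lam \<sigma> a x)\<bar> \<le> ennreal (\<bar>Lam \<sigma> a y - Lam \<sigma> a x\<bar> * m)"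
    by (intro ennreal_leI) (simp add: mult.commute)
  then show ?thesis unfolding emeasure_eq_measure m_def[symmetric] by (simp add: ennreal_mult m_def)
qed

end

section \<open>Existence of a solution\<close>

text \<open>Redefining the process on a null set makes all its paths continuous, hence the process
  jointly measurable, without completeness of the underlying measure.\<close>

lemma AE_occupation_integral_finite:
  fixes M :: "'w measure" and T :: real and k :: "real \<Rightarrow> ennreal" and \<nu> :: "real measure"
  assumes M: "prob_space M" and T: "0 < T"
    and Z: "\<And>t. t \<in> {0..T} \<Longrightarrow> Z t \<in> borel_measurable M"
    and cont: "AE \<omega> in M. continuous_on {0..T} (\<lambda>t. Z t \<omega>)"
    and \<nu>: "finite_measure \<nu>" and [measurable_cong]: "sets \<nu> = sets borel"
    and [measurable]: "k \<in> borel_measurable borel"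
    and fin: "(SUP y. \<integral>\<^sup>+\<omega>. (\<integral>\<^sup>+t\<in>{0..T}. k (Z t \<omega> - y) \<partial>lborel) \<partial>M) < \<infinity>"
  shows "AE \<omega> in M. (\<integral>\<^sup>+t\<in>{0..T}. (\<integral>\<^sup>+y. k (Z t \<omega> - y) \<partial>\<nu>) \<partial>lborel) < \<infinity>"
proof -
  interpret M: prob_space M by fact
  interpret \<nu>: finite_measure \<nu> by fact
  interpret M\<nu>: pair_sigma_finite M \<nu> ..
  interpret L\<nu>: pair_sigma_finite lborel \<nu> ..
  obtain N where N: "{\<omega> \<in> space M. \<not> continuous_on {0..T} (\<lambda>t. Z t \<omega>)} \<subseteq> N" "emeasure M N = 0" "N \<in> sets M"
    using AE_E[OF cont] by blast
  have notN: "AE \<omega> in M. \<omega> \<notin> N" using N by (intro AE_not_in) (auto simp: null_sets_def)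
  \<comment> \<open>Freezing the time outside \<open>{0..T}\<close> extends the modified paths to
    continuous functions on the line.\<close>
  define cl where "cl t = max 0 (min T t)" for t
  define W where "W t \<omega> = (if \<omega> \<in> N then 0 else Z (cl t) \<omega>)" for t \<omega>
  have cl: "cl t \<in> {0..T}" for t using T by (auto simp: cl_def min_def max_def)
  have W_eq: "W t \<omega> = Z t \<omega>" if "\<omega> \<notin> N" "t \<in> {0..T}" for t \<omega>
  proof -
    have "cl t = t" using that(2) by (simp add: cl_def)
    then show ?thesis using that(1) by (simp add: W_def)
  qed
  have W_t: "W t \<in> borel_measurable M" for t
    unfolding W_def[abs_def] using N(3) Z[OF cl] by simp
  have W_cont: "isCont (\<lambda>t. W t \<omega>) t" if "\<omega> \<in> space M" for t \<omega>
  proof (cases "\<omega> \<in> N")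
    case False
    then have "continuous_on {0..T} (\<lambda>t. Z t \<omega>)" using N(1) that by auto
    then have "continuous_on UNIV (\<lambda>t. Z (cl t) \<omega>)"
      by (rule continuous_on_compose2) (use cl in \<open>auto simp: cl_def[abs_def] intro!: continuous_intros\<close>)
    then show ?thesis using False by (simp add: W_def continuous_on_eq_continuous_at)
  qed (simp add: W_def)
  have "(\<lambda>x. W (fst x) (snd x)) \<in> borel_measurable (borel \<Otimes>\<^sub>M M)"
  proof (rule borel_measurable_LIMSEQ_real)
    \<comment> \<open>Time is rounded down to the grid of mesh 1/(n+1). The rounded process takes
      its times from a countable set, hence is jointly measurable, and it converges to
      \<open>W\<close> because all paths of \<open>W\<close> are continuous.\<close>
    let ?d = "\<lambda>n t. real_of_int \<lfloor>real (Suc n) * t\<rfloor> / real (Suc n)"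
    fix x :: "real \<times> 'w" assume "x \<in> space (borel \<Otimes>\<^sub>M M)"
    then have \<omega>: "snd x \<in> space M" by (auto simp: space_pair_measure)
    have "(\<lambda>n. ?d n (fst x) - fst x) \<longlonglongrightarrow> 0"
    proof (rule Lim_null_comparison)
      show "\<forall>\<^sub>F n in sequentially. norm (?d n (fst x) - fst x) \<le> 1 / real (Suc n)"
      proof (intro always_eventually allI)
        fix n
        have "?d n (fst x) - fst x = (real_of_int \<lfloor>real (Suc n) * fst x\<rfloor> - real (Suc n) * fst x) / real (Suc n)"
          by (simp add: diff_divide_distrib del: of_nat_Suc)
        moreover have "\<bar>real_of_int \<lfloor>real (Suc n) * fst x\<rfloor> - real (Suc n) * fst x\<bar> \<le> 1" by linarith
        ultimately show "norm (?d n (fst x) - fst x) \<le> 1 / real (Suc n)"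
          by (simp only: real_norm_def abs_divide abs_of_nat divide_right_mono of_nat_0_le_iff)
      qed
    qed (rule LIMSEQ_Suc[OF lim_1_over_n])
    then have "(\<lambda>n. ?d n (fst x)) \<longlonglongrightarrow> fst x" by (rule LIM_zero_cancel)
    then show "(\<lambda>n. W (?d n (fst x)) (snd x)) \<longlonglongrightarrow> W (fst x) (snd x)"
      by (rule isCont_tendsto_compose[OF W_cont[OF \<omega>]])
  next
    fix n
    have [measurable]: "(\<lambda>x. W t (snd x)) \<in> borel_measurable (borel \<Otimes>\<^sub>M M)" for t
      using W_t by (rule measurable_compose[OF measurable_snd])
    show "(\<lambda>x. W (real_of_int \<lfloor>real (Suc n) * fst x\<rfloor> / real (Suc n)) (snd x)) \<in> borel_measurable (borel \<Otimes>\<^sub>M M)"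
      by (rule measurable_compose_countable[where f="\<lambda>i x. W (real_of_int i / real (Suc n)) (snd x)"
            and g="\<lambda>x. \<lfloor>real (Suc n) * fst x\<rfloor>"]) measurable
  qed
  from measurable_compose[OF measurable_Pair this]
  have W_joint [measurable (raw)]: "(\<lambda>x. W (f x) (g x)) \<in> borel_measurable K"
    if "f \<in> borel_measurable K" "g \<in> measurable K M" for f g and K :: "'c measure"
    using that by simp
  \<comment> \<open>The expected occupation integral is at most \<open>S\<close> for every y.
    Averaging over y against \<nu> gives at most \<open>S\<close> times the total mass; a finite
    expectation forces finiteness almost surely.\<close>
  define S where "S = (SUP y. \<integral>\<^sup>+\<omega>. (\<integral>\<^sup>+t\<in>{0..T}. k (Z t \<omega> - y) \<partial>lborel) \<partial>M)"
  have "(\<integral>\<^sup>+\<omega>. (\<integral>\<^sup>+y. (\<integral>\<^sup>+t\<in>{0..T}. k (W t \<omega> - y) \<partial>lborel) \<partial>\<nu>) \<partial>M)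
    = (\<integral>\<^sup>+y. (\<integral>\<^sup>+\<omega>. (\<integral>\<^sup>+t\<in>{0..T}. k (W t \<omega> - y) \<partial>lborel) \<partial>M) \<partial>\<nu>)"
    by (rule M\<nu>.Fubini'[symmetric]) measurable
  also have "\<dots> \<le> (\<integral>\<^sup>+y. S \<partial>\<nu>)"
  proof (rule nn_integral_mono)
    fix y
    have "(\<integral>\<^sup>+\<omega>. (\<integral>\<^sup>+t\<in>{0..T}. k (W t \<omega> - y) \<partial>lborel) \<partial>M)
       = (\<integral>\<^sup>+\<omega>. (\<integral>\<^sup>+t\<in>{0..T}. k (Z t \<omega> - y) \<partial>lborel) \<partial>M)"
    proof (rule nn_integral_cong_AE)
      show "AE \<omega> in M. (\<integral>\<^sup>+t\<in>{0..T}. k (W t \<omega> - y) \<partial>lborel) = (\<integral>\<^sup>+t\<in>{0..T}. k (Z t \<omega> - y) \<partial>lborel)"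
        using notN by eventually_elim (auto intro!: nn_integral_cong simp: W_eq indicator_def)
    qed
    also have "\<dots> \<le> S" unfolding S_def by (rule SUP_upper) simp
    finally show "(\<integral>\<^sup>+\<omega>. (\<integral>\<^sup>+t\<in>{0..T}. k (W t \<omega> - y) \<partial>lborel) \<partial>M) \<le> S" .
  qed
  also have "\<dots> = S * emeasure \<nu> (space \<nu>)" by simp
  also have "\<dots> < \<infinity>"
  proof -
    have "emeasure \<nu> (space \<nu>) < top" using \<nu>.emeasure_finite less_top by blast
    moreover have "S < top" using fin by (simp add: S_def)
    ultimately show ?thesis by (simp add: ennreal_mult_less_top)
  qed
  finally have "(\<integral>\<^sup>+\<omega>. (\<integral>\<^sup>+y. (\<integral>\<^sup>+t\<in>{0..T}. k (W t \<omega> - y) \<partial>lborel) \<partial>\<nu>) \<partial>M) \<noteq> \<infinity>"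
    by simp
  then have "AE \<omega> in M. (\<integral>\<^sup>+y. (\<integral>\<^sup>+t\<in>{0..T}. k (W t \<omega> - y) \<partial>lborel) \<partial>\<nu>) \<noteq> \<infinity>"
    by (rule nn_integral_PInf_AE[rotated]) measurable
  then show ?thesis
    using notN AE_space
  proof eventually_elim
    case (elim \<omega>)
    have [measurable]: "(\<lambda>x. W (f x) \<omega>) \<in> borel_measurable K" if "f \<in> borel_measurable K" for f and K :: "'c measure"
    proof -
      have "continuous_on UNIV (\<lambda>t. W t \<omega>)" using W_cont[OF elim(3)] by (simp add: continuous_on_eq_continuous_at)
      from measurable_compose[OF that borel_measurable_continuous_onI[OF this]] show ?thesis .
    qed
    have "(\<integral>\<^sup>+t\<in>{0..T}. (\<integral>\<^sup>+y. k (Z t \<omega> - y) \<partial>\<nu>) \<partial>lborel) = (\<integral>\<^sup>+t. (\<integral>\<^sup>+y. k (W t \<omega> - y) * indicator {0..T} t \<partial>\<nu>) \<partial>lborel)"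
    proof (rule nn_integral_cong)
      fix t
      show "(\<integral>\<^sup>+y. k (Z t \<omega> - y) \<partial>\<nu>) * indicator {0..T} t = (\<integral>\<^sup>+y. k (W t \<omega> - y) * indicator {0..T} t \<partial>\<nu>)"
        by (cases "t \<in> {0..T}") (simp_all add: W_eq[OF elim(2)])
    qed
    \<comment> \<open>For a fixed path the time and space integrals are exchanged once more, so that
      the finite quantity becomes a time integral of the \<nu>-potential along the path.\<close>
    also have "\<dots> = (\<integral>\<^sup>+y. (\<integral>\<^sup>+t\<in>{0..T}. k (W t \<omega> - y) \<partial>lborel) \<partial>\<nu>)"
      by (rule L\<nu>.Fubini'[symmetric]) measurable
    finally show ?case using elim(1) by (simp add: less_top)
  qed
qed

section \<open>The equation along a single path\<close>

context sde_coefficient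
begin

text \<open>The inverse of \<open>Lam\<close> can blow up at the ends of the range. By compactness
  the path attains its extremes at times p and q, where its values are still in the range, so
  monotonicity confines all of X between X p and X q. On that bounded set
  \<open>Lam_expanding\<close> applies, and X inherits the Hoelder exponent.\<close>

lemma inv_Lam_path:
  assumes T: "0 < T" and \<alpha>: "0 < \<alpha>"
    and H: "\<And>s t. \<bar>Z t - Z s\<bar> \<le> C * \<bar>t - s\<bar> powr \<alpha>"
    and clamp: "\<And>t. Z t = Z (max 0 (min T t))"
    and range: "\<And>t. Z t \<in> range (Lam \<sigma> a)"
  obtains n :: nat where "\<And>t. inv (Lam \<sigma> a) (Z t) \<in> {- real n..real n}"
    "continuous_on UNIV (\<lambda>t. inv (Lam \<sigma> a) (Z t))"
proof -
  define X where "X t = inv (Lam \<sigma> a) (Z t)" for t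
  have LX: "Lam \<sigma> a (X t) = Z t" for t unfolding X_def by (rule f_inv_into_f[OF range])
  have contZ: "continuous_on UNIV Z" by (rule continuous_on_holder[OF H \<alpha>])
  then have "continuous_on {0..T} Z" by (rule continuous_on_subset) simp
  then obtain p q where pq: "\<And>t. t \<in> {0..T} \<Longrightarrow> Z p \<le> Z t \<and> Z t \<le> Z q"
    using continuous_attains_inf[of "{0..T}" Z] continuous_attains_sup[of "{0..T}" Z] T
    by (metis atLeastAtMost_iff compact_Icc empty_iff less_imp_le order_refl)
  have between: "Z p \<le> Z t \<and> Z t \<le> Z q" for t
    using pq[of "max 0 (min T t)"] clamp[of t] T by auto
  have ordered: "x \<le> y" if "mono (Lam \<sigma> a)" "Lam \<sigma> a x \<le> Lam \<sigma> a y" for x y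
  proof (rule ccontr)
    assume "\<not> x \<le> y"
    then have "Lam \<sigma> a x = Lam \<sigma> a y" using monoD[OF that(1), of y x] that(2) by simp
    then show False using injD[OF inj_Lam] \<open>\<not> x \<le> y\<close> by blast
  qed
  have ordered': "y \<le> x" if "antimono (Lam \<sigma> a)" "Lam \<sigma> a x \<le> Lam \<sigma> a y" for x y
  proof (rule ccontr)
    assume "\<not> y \<le> x"
    then have "Lam \<sigma> a x = Lam \<sigma> a y" using antimonoD[OF that(1), of x y] that(2) by simp
    then show False using injD[OF inj_Lam] \<open>\<not> y \<le> x\<close> by blast
  qed
  \<comment> \<open>The bound is rounded up to an integer, so that one of the countably many
    measures \<nu> n serves the path.\<close>
  define n where "n = nat \<lceil>max \<bar>X p\<bar> \<bar>X q\<bar>\<rceil>"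
  have n: "\<bar>X p\<bar> \<le> real n" "\<bar>X q\<bar> \<le> real n" unfolding n_def by linarith+
  have mem: "X t \<in> {- real n..real n}" for t
    using Lam_mono_or_antimono
  proof
    assume m: "mono (Lam \<sigma> a)"
    have "X p \<le> X t" "X t \<le> X q" using ordered[OF m, of "X p" "X t"] ordered[OF m, of "X t" "X q"] between[of t] by (simp_all add: LX)
    then show ?thesis using n by auto
  next
    assume m: "antimono (Lam \<sigma> a)"
    have "X q \<le> X t" "X t \<le> X p" using ordered'[OF m, of "X p" "X t"] ordered'[OF m, of "X t" "X q"] between[of t] by (simp_all add: LX)
    then show ?thesis using n by auto
  qed
  obtain B where B: "0 \<le> B" "\<And>x y. x \<in> {-real n..real n} \<Longrightarrow> y \<in> {-real n..real n} \<Longrightarrow>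
      \<bar>x - y\<bar> \<le> B * \<bar>Lam \<sigma> a x - Lam \<sigma> a y\<bar>"
    using Lam_expanding by blast
  have "continuous_on UNIV X"
  proof (rule continuous_on_holder[OF _ \<alpha>])
    fix s t
    have "\<bar>X t - X s\<bar> \<le> B * \<bar>Z t - Z s\<bar>" using B(2)[OF mem mem] by (simp add: LX)
    also have "\<dots> \<le> B * (C * \<bar>t - s\<bar> powr \<alpha>)" by (intro mult_left_mono H B)
    finally show "\<bar>X t - X s\<bar> \<le> B * C * \<bar>t - s\<bar> powr \<alpha>" by (simp only: mult.assoc)
  qed
  then show ?thesis using mem by (intro that) (simp_all add: X_def[abs_def])
qed

text \<open>The index n of the relevant measure is found only after the path is given, which is why
  the conditions on \<nu> are stated for all n. The subtracted constant c allows Y itself as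
  integrator.\<close>

lemma pathwise_solution_clamped:
  fixes \<nu> :: "nat \<Rightarrow> real measure"
  assumes T: "0 < T" and \<beta>: "1 - \<alpha> < \<beta>" "\<beta> < \<alpha>" "\<alpha> < 1" and \<epsilon>: "0 < \<epsilon>"
    and H: "\<And>s t. \<bar>Z t - Z s\<bar> \<le> C * \<bar>t - s\<bar> powr \<alpha>"
    and clamp: "\<And>t. Z t = Z (max 0 (min T t))"
    and range: "\<And>t. Z t \<in> range (Lam \<sigma> a)"
    and \<nu>: "\<And>n. finite_measure (\<nu> n)" "\<And>n. sets (\<nu> n) = sets borel"
    and \<nu>_le: "\<And>n x y. x \<in> {- real n..real n} \<Longrightarrow> y \<in> {- real n..real n} \<Longrightarrow> ennreal \<bar>\<sigma> x - \<sigma> y\<bar>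
      \<le> emeasure (\<nu> n) {min (Lam \<sigma> a x) (Lam \<sigma> a y)..max (Lam \<sigma> a x) (Lam \<sigma> a y)}"
    and J_fin: "\<And>n. (\<integral>\<^sup>+t\<in>{0..T}. (\<integral>\<^sup>+y. inverse (ennreal (\<bar>Z t - y\<bar> powr ((\<beta> + \<epsilon>) / \<alpha>))) \<partial>\<nu> n) \<partial>lborel) < \<infinity>"
    and \<tau>: "\<tau> \<in> {0..T}"
  shows "(\<lambda>s. \<sigma> (inv (Lam \<sigma> a) (Z s))) \<in> W_one \<beta> T"
    and "(\<lambda>s. indicator {0..\<tau>} s * \<sigma> (inv (Lam \<sigma> a) (Z s))) \<in> W_one \<beta> T"
    and "pathwise_integral \<beta> T (\<lambda>s. indicator {0..\<tau>} s * \<sigma> (inv (Lam \<sigma> a) (Z s))) (\<lambda>s. Z s - c)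
      = of_real (inv (Lam \<sigma> a) (Z \<tau>) - inv (Lam \<sigma> a) (Z 0))"
proof -
  define X where "X t = inv (Lam \<sigma> a) (Z t)" for t
  have LX: "Lam \<sigma> a (X t) = Z t" for t unfolding X_def by (rule f_inv_into_f[OF range])
  have \<alpha>: "0 < \<alpha>" and \<beta>0: "0 < \<beta>" "\<beta> < 1" using \<beta> by auto
  obtain n :: nat where mem: "\<And>t. X t \<in> {- real n..real n}" and X_cont: "continuous_on UNIV X"
    using inv_Lam_path[OF T \<alpha> H clamp range] unfolding X_def[abs_def] by blast
  obtain B where B: "0 \<le> B" "\<And>x. x \<in> {- real n..real n} \<Longrightarrow> \<bar>\<sigma> x\<bar> \<le> B" using \<sigma>_bounded by blast
  define f where "f t = \<sigma> (X t)" for t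
  have f_bounded: "\<bar>f t\<bar> \<le> B" for t unfolding f_def by (rule B(2)[OF mem])
  have f_meas: "f \<in> borel_measurable borel"
  proof -
    have "f = (\<lambda>t. indicator {- real n..real n} (X t) * \<sigma> (X t))"
    proof
      fix t show "f t = indicator {- real n..real n} (X t) * \<sigma> (X t)" using mem[of t] by (simp add: f_def)
    qed
    moreover have "(\<lambda>x. indicator {- real n..real n} x * \<sigma> x) \<in> borel_measurable borel"
      using bv by (intro bounded_variation_measurable) (simp add: locally_bounded_variation_def)
    ultimately show ?thesis
      using measurable_compose[OF borel_measurable_continuous_onI[OF X_cont],
          of "\<lambda>x. indicator {- real n..real n} x * \<sigma> x"] by simp
  qed
  have contZ: "continuous_on UNIV Z" by (rule continuous_on_holder[OF H \<alpha>])
  have [measurable]: "Z \<in> borel_measurable borel" by (rule borel_measurable_continuous_onI[OF contZ])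
  interpret \<nu>: finite_measure "\<nu> n" by (rule \<nu>)
  note [measurable_cong] = \<nu>(2)
  \<comment> \<open>Z moves by a multiple of |t - s| powr \<alpha>, so the spatial exponent p turns
    into the temporal exponent p \<alpha> = \<beta> + \<epsilon>.\<close>
  define p where "p = (\<beta> + \<epsilon>) / \<alpha>"
  define J where "J t = (\<integral>\<^sup>+y. inverse (ennreal (\<bar>Z t - y\<bar> powr p)) \<partial>\<nu> n)" for t
  have J_meas: "J \<in> borel_measurable borel" unfolding J_def[abs_def] by measurable
  have J: "(\<integral>\<^sup>+t\<in>{0..T}. J t \<partial>lborel) < \<infinity>" unfolding J_def p_def by (rule J_fin)
  have p: "0 < p" using \<beta>0 \<epsilon> \<alpha> by (simp add: p_def)
  have C: "0 \<le> C" using H[of 1 0] by simp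
  \<comment> \<open>Adding 1 keeps the radius in the Markov estimate positive for s \<noteq> t even
    if C = 0, and D \<ge> 1 lets K dominate \<open>D powr p\<close>.\<close>
  define D where "D = C + 1"
  have D: "1 \<le> D" "C \<le> D" using C by (auto simp: D_def)
  \<comment> \<open>The increments of f need the factor \<open>D powr p\<close>; the expansion of X
    has a further D from the increment of Z. One constant covers both.\<close>
  define K where "K = D powr p * D"
  have K: "0 \<le> K" "D powr p \<le> K" using D by (auto simp: K_def mult_le_cancel_left1)
  let ?I = "\<lambda>s t. {min (Z s) (Z t)..max (Z s) (Z t)}"
  have I: "emeasure (\<nu> n) (?I s t) \<le> ennreal (D powr p * \<bar>t - s\<bar> powr (\<beta> + \<epsilon>)) * J s" if "s \<noteq> t" for s t
  proof -
    have "\<bar>Z s - Z t\<bar> \<le> C * \<bar>t - s\<bar> powr \<alpha>" using H[of t s] by (simp add: abs_minus_commute)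
    also have "\<dots> \<le> D * \<bar>t - s\<bar> powr \<alpha>" using D by (intro mult_right_mono) auto
    finally have "emeasure (\<nu> n) (?I s t) \<le> ennreal ((D * \<bar>t - s\<bar> powr \<alpha>) powr p) * J s"
      unfolding J_def using D that by (intro emeasure_interval_le \<nu> p) auto
    also have "(D * \<bar>t - s\<bar> powr \<alpha>) powr p = D powr p * \<bar>t - s\<bar> powr (\<beta> + \<epsilon>)"
      using D \<alpha> by (simp add: powr_mult powr_powr p_def)
    finally show ?thesis .
  qed
  have fJ: "ennreal \<bar>f t - f s\<bar> \<le> ennreal (K * \<bar>t - s\<bar> powr (\<beta> + \<epsilon>)) * J t" for s t
  proof (cases "s = t")
    case False
    have "ennreal \<bar>f t - f s\<bar> \<le> emeasure (\<nu> n) (?I t s)"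
      using \<nu>_le[OF mem mem, of t s] by (simp add: f_def LX)
    also have "\<dots> \<le> ennreal (D powr p * \<bar>s - t\<bar> powr (\<beta> + \<epsilon>)) * J t" using False by (intro I) simp
    also have "\<dots> \<le> ennreal (K * \<bar>t - s\<bar> powr (\<beta> + \<epsilon>)) * J t"
      unfolding abs_minus_commute[of s t] using K by (intro mult_right_mono ennreal_leI) auto
    finally show ?thesis .
  qed simp
  have XJ: "ennreal \<bar>X t - X s - f s * ((Z t - c) - (Z s - c))\<bar> \<le> ennreal (K * \<bar>t - s\<bar> powr (\<beta> + \<epsilon> + \<alpha>)) * J s" for s t
  proof (cases "s = t")
    case False
    have "ennreal \<bar>X t - X s - f s * (Z t - Z s)\<bar> \<le> ennreal \<bar>Z t - Z s\<bar> * emeasure (\<nu> n) (?I s t)"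
      using Lam_expansion_measure[OF \<nu> \<nu>_le mem mem, of n t s] by (simp add: f_def LX)
    \<comment> \<open>The increment of Z contributes the exponent \<alpha> and the measure of the
      crossed interval \<beta> + \<epsilon>, with the weight J taken at the base time s.\<close>
    also have "\<dots> \<le> ennreal (D * \<bar>t - s\<bar> powr \<alpha>) * (ennreal (D powr p * \<bar>t - s\<bar> powr (\<beta> + \<epsilon>)) * J s)"
      using D by (intro mult_mono I ennreal_leI False order_trans[OF H] mult_right_mono) auto
    also have "\<dots> = ennreal ((D * \<bar>t - s\<bar> powr \<alpha>) * (D powr p * \<bar>t - s\<bar> powr (\<beta> + \<epsilon>))) * J s"
      using D by (subst ennreal_mult) (auto simp: mult.assoc)
    also have "(D * \<bar>t - s\<bar> powr \<alpha>) * (D powr p * \<bar>t - s\<bar> powr (\<beta> + \<epsilon>)) = K * \<bar>t - s\<bar> powr (\<beta> + \<epsilon> + \<alpha>)"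
      by (simp add: K_def powr_add)
    finally show ?thesis by simp
  qed simp
  have fW: "f \<in> W_one \<beta> T"
    by (rule W_one_of_local_bound[OF \<beta>0 _ T f_meas f_bounded K(1) J_meas J fJ]) (use \<epsilon> in auto)
  then show "(\<lambda>s. \<sigma> (inv (Lam \<sigma> a) (Z s))) \<in> W_one \<beta> T" by (simp add: f_def[abs_def] X_def)
  show "(\<lambda>s. indicator {0..\<tau>} s * \<sigma> (inv (Lam \<sigma> a) (Z s))) \<in> W_one \<beta> T"
    using indicator_mult_in_W_one[OF \<beta>0 T f_meas f_bounded fW \<tau>] by (simp add: f_def[abs_def] X_def)
  have after: "X t = X T \<and> Z t - c = Z T - c" if "t \<ge> T" for t
  proof -
    have e: "max 0 (min T t) = T" using that T by simp
    have "Z t = Z T" using clamp[of t] unfolding e .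
    then show ?thesis by (simp add: X_def)
  qed
  have "pathwise_integral \<beta> T (\<lambda>s. indicator {0..\<tau>} s * f s) (\<lambda>s. Z s - c) = of_real (X \<tau> - X 0)"
    by (rule pathwise_integral_of_local_expansion[OF \<beta>0 _ T _ f_meas f_bounded K(1) J_meas J fW _ X_cont after XJ \<tau>])
       (use \<epsilon> \<beta> H in auto)
  then show "pathwise_integral \<beta> T (\<lambda>s. indicator {0..\<tau>} s * \<sigma> (inv (Lam \<sigma> a) (Z s))) (\<lambda>s. Z s - c)
      = of_real (inv (Lam \<sigma> a) (Z \<tau>) - inv (Lam \<sigma> a) (Z 0))"
    by (simp add: f_def X_def)
qed

text \<open>The path is frozen outside \<open>{0..T}\<close> to obtain a globally Hoelder path. The
  spaces and the integral see only (0,T), so the congruence lemmas carry the result back.\<close>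

lemma pathwise_solution:
  fixes \<nu> :: "nat \<Rightarrow> real measure"
  assumes T: "0 < T" and \<beta>: "1 - \<alpha> < \<beta>" "\<beta> < \<alpha>" "\<alpha> < 1" and \<epsilon>: "0 < \<epsilon>"
    and H: "holder_path \<alpha> T Z"
    and range: "\<And>t. t \<in> {0..T} \<Longrightarrow> Z t \<in> range (Lam \<sigma> a)"
    and \<nu>: "\<And>n. finite_measure (\<nu> n)" "\<And>n. sets (\<nu> n) = sets borel"
    and \<nu>_le: "\<And>n x y. x \<in> {- real n..real n} \<Longrightarrow> y \<in> {- real n..real n} \<Longrightarrow> ennreal \<bar>\<sigma> x - \<sigma> y\<bar>
      \<le> emeasure (\<nu> n) {min (Lam \<sigma> a x) (Lam \<sigma> a y)..max (Lam \<sigma> a x) (Lam \<sigma> a y)}"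
    and J_fin: "\<And>n. (\<integral>\<^sup>+t\<in>{0..T}. (\<integral>\<^sup>+y. inverse (ennreal (\<bar>Z t - y\<bar> powr ((\<beta> + \<epsilon>) / \<alpha>))) \<partial>\<nu> n) \<partial>lborel) < \<infinity>"
    and Y: "\<And>t. Y t = Z t - c"
    and X: "\<And>t. X t = inv (Lam \<sigma> a) (Z t)"
    and \<tau>: "\<tau> \<in> {0..T}"
  shows "pathwise_integrable \<beta> T (\<lambda>s. \<sigma> (X s)) Y"
    and "pathwise_integrable \<beta> T (\<lambda>s. indicator {0..\<tau>} s * \<sigma> (X s)) Y"
    and "pathwise_integral \<beta> T (\<lambda>s. indicator {0..\<tau>} s * \<sigma> (X s)) Y = of_real (X \<tau> - X 0)"
proof -
  define cl where "cl t = max 0 (min T t)" for t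
  have cl: "cl t \<in> {0..T}" "t \<in> {0..T} \<Longrightarrow> cl t = t" for t using T by (auto simp: cl_def min_def max_def)
  have cl_cl: "cl (max 0 (min T t)) = cl t" for t using T by (auto simp: cl_def min_def max_def)
  define Z' where "Z' t = Z (cl t)" for t
  have Z': "Z' t = Z t" if "t \<in> {0..T}" for t using cl(2)[OF that] by (simp add: Z'_def)
  have \<alpha>: "0 < \<alpha>" and \<beta>0: "0 < \<beta>" "\<beta> < 1" using \<beta> by auto
  obtain C where C: "\<And>s t. s \<in> {0..T} \<Longrightarrow> t \<in> {0..T} \<Longrightarrow> \<bar>Z t - Z s\<bar> \<le> C * \<bar>t - s\<bar> powr \<alpha>"
    using H unfolding holder_path_def by blast
  \<comment> \<open>The sign of C is read off from the pair 0, T, whose distance is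
    positive.\<close>
  have "0 \<le> C * \<bar>T - 0\<bar> powr \<alpha>" by (rule order_trans[OF abs_ge_zero C]) (use T in auto)
  then have C0: "0 \<le> C" using T by (simp add: zero_le_mult_iff)
  have H': "\<bar>Z' t - Z' s\<bar> \<le> C * \<bar>t - s\<bar> powr \<alpha>" for s t
  proof -
    have "\<bar>Z' t - Z' s\<bar> \<le> C * \<bar>cl t - cl s\<bar> powr \<alpha>" unfolding Z'_def by (intro C cl)
    \<comment> \<open>The truncation \<open>cl\<close> does not increase distances, so the Hoelder
      constant is kept.\<close>
    also have "\<dots> \<le> C * \<bar>t - s\<bar> powr \<alpha>"
      using C0 \<alpha> by (intro mult_left_mono powr_mono2) (auto simp: cl_def)
    finally show ?thesis .
  qed
  have clamp: "Z' t = Z' (max 0 (min T t))" for t unfolding Z'_def cl_cl ..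
  have range': "Z' t \<in> range (Lam \<sigma> a)" for t unfolding Z'_def by (rule range[OF cl(1)])
  have J': "(\<integral>\<^sup>+t\<in>{0..T}. (\<integral>\<^sup>+y. inverse (ennreal (\<bar>Z' t - y\<bar> powr ((\<beta> + \<epsilon>) / \<alpha>))) \<partial>\<nu> n) \<partial>lborel) < \<infinity>" for n
  proof -
    have "(\<integral>\<^sup>+t\<in>{0..T}. (\<integral>\<^sup>+y. inverse (ennreal (\<bar>Z' t - y\<bar> powr ((\<beta> + \<epsilon>) / \<alpha>))) \<partial>\<nu> n) \<partial>lborel)
      = (\<integral>\<^sup>+t\<in>{0..T}. (\<integral>\<^sup>+y. inverse (ennreal (\<bar>Z t - y\<bar> powr ((\<beta> + \<epsilon>) / \<alpha>))) \<partial>\<nu> n) \<partial>lborel)"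
      by (rule nn_integral_cong) (auto simp: Z' indicator_def)
    then show ?thesis using J_fin by simp
  qed
  note sol = pathwise_solution_clamped[OF T \<beta> \<epsilon> H' clamp range' \<nu> \<nu>_le J' \<tau>]
  have Y': "Y t = Z' t - c" if "t \<in> {0<..<T}" for t using that by (simp add: Y Z')
  have X': "X t = inv (Lam \<sigma> a) (Z' t)" if "t \<in> {0..T}" for t using that by (simp add: X Z')
  have "(\<lambda>s. Z' s - c) \<in> W_infty (1 - \<beta>) T"
    by (rule holder_in_W_infty[OF T, of _ \<alpha> _ C]) (use \<beta> \<beta>0 H' in auto)
  then have Yinf: "Y \<in> W_infty (1 - \<beta>) T"
    using W_infty_cong[OF T, of Y "\<lambda>s. Z' s - c"] Y' by blast
  have "(\<lambda>s. \<sigma> (X s)) \<in> W_one \<beta> T"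
    using W_one_cong[of T "\<lambda>s. \<sigma> (X s)" "\<lambda>s. \<sigma> (inv (Lam \<sigma> a) (Z' s))" \<beta>] sol(1) X' by simp
  then show "pathwise_integrable \<beta> T (\<lambda>s. \<sigma> (X s)) Y"
    unfolding pathwise_integrable_def using \<beta>0 Yinf by simp
  have "(\<lambda>s. indicator {0..\<tau>} s * \<sigma> (X s)) \<in> W_one \<beta> T"
    using W_one_cong[of T "\<lambda>s. indicator {0..\<tau>} s * \<sigma> (X s)" "\<lambda>s. indicator {0..\<tau>} s * \<sigma> (inv (Lam \<sigma> a) (Z' s))" \<beta>] sol(2) X' by simp
  then show "pathwise_integrable \<beta> T (\<lambda>s. indicator {0..\<tau>} s * \<sigma> (X s)) Y"
    unfolding pathwise_integrable_def using \<beta>0 Yinf by simp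
  have "pathwise_integral \<beta> T (\<lambda>s. indicator {0..\<tau>} s * \<sigma> (X s)) Y
    = pathwise_integral \<beta> T (\<lambda>s. indicator {0..\<tau>} s * \<sigma> (inv (Lam \<sigma> a) (Z' s))) (\<lambda>s. Z' s - c)"
    using X' Y' by (intro pathwise_integral_cong[OF T]) auto
  also have "\<dots> = of_real (X \<tau> - X 0)" using sol(3)[where c=c] X'[OF \<tau>] X'[of 0] T by simp
  finally show "pathwise_integral \<beta> T (\<lambda>s. indicator {0..\<tau>} s * \<sigma> (X s)) Y = of_real (X \<tau> - X 0)" .
qed

end

text \<open>If 1 / \<sigma> is integrable near plus or minus infinity, \<open>Lam\<close> maps onto
  a proper part of the line, outside of which its inverse has no meaning and \<open>inv\<close>
  returns an arbitrary value. \<open>Lam_inverse_defined\<close> expresses that the solution formula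
  makes sense along almost every path.\<close>

theorem theorem2p1:
  fixes M :: "'w measure" and T a :: real
    and \<sigma> :: "real \<Rightarrow> real"
    and Y :: "real \<Rightarrow> 'w \<Rightarrow> real" and X0 :: "'w \<Rightarrow> real"
  assumes "prob_space M"
    and "0 < T"
    and "locally_bounded_variation \<sigma>"
    and "(\<forall>x. 0 \<le> \<sigma> x) \<or> (\<forall>x. \<sigma> x \<le> 0)"
    and "locally_integrable_reciprocal \<sigma>"
    and "stochastic_process M T Y"
    and "X0 \<in> borel_measurable M"
    and "variability_assumption M T (\<lambda>t \<omega>. Lam \<sigma> a (X0 \<omega>) + Y t \<omega> - Y 0 \<omega>)"
    and Lam_inverse_defined:
      "AE \<omega> in M. \<forall>t\<in>{0..T}. Lam \<sigma> a (X0 \<omega>) + Y t \<omega> - Y 0 \<omega> \<in> range (Lam \<sigma> a)"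
  shows "sde_solution M T \<sigma> Y X0
           (\<lambda>t \<omega>. inv (Lam \<sigma> a) (Lam \<sigma> a (X0 \<omega>) + Y t \<omega> - Y 0 \<omega>))"
proof -
  interpret sde_coefficient \<sigma> a using assms by unfold_locales auto
  define Z where "Z t \<omega> = Lam \<sigma> a (X0 \<omega>) + Y t \<omega> - Y 0 \<omega>" for t \<omega>
  define X where "X t \<omega> = inv (Lam \<sigma> a) (Z t \<omega>)" for t \<omega>
  note T = \<open>0 < T\<close> and [measurable] = \<open>X0 \<in> borel_measurable M\<close>
  have Y: "Y t \<in> borel_measurable M" if "t \<in> {0..T}" for t
    using assms(6) that by (simp add: stochastic_process_def)
  have Y0 [measurable]: "Y 0 \<in> borel_measurable M" using Y[of 0] T by simp
  have Z: "Z t \<in> borel_measurable M" if "t \<in> {0..T}" for t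
  proof -
    note [measurable] = Y[OF that]
    show ?thesis unfolding Z_def[abs_def] by measurable
  qed
  have X_process: "stochastic_process M T X"
    unfolding stochastic_process_def
  proof
    fix t assume "t \<in> {0..T}"
    note [measurable] = Z[OF this]
    show "X t \<in> borel_measurable M" unfolding X_def[abs_def] by measurable
  qed
  obtain \<alpha> \<beta> \<epsilon> where \<alpha>: "1/2 < \<alpha>" "\<alpha> < 1" and H: "AE \<omega> in M. holder_path \<alpha> T (\<lambda>t. Z t \<omega>)"
    and \<beta>: "1 - \<alpha> < \<beta>" "\<beta> < \<alpha>" and \<epsilon>: "0 < \<epsilon>"
    and fin: "(SUP y. \<integral>\<^sup>+\<omega>. (\<integral>\<^sup>+t\<in>{0..T}. inverse (ennreal (\<bar>Z t \<omega> - y\<bar> powr ((\<beta> + \<epsilon>) / \<alpha>))) \<partial>lborel) \<partial>M) < \<infinity>"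
    using assms(8) unfolding variability_assumption_def Z_def[symmetric] by blast
  have cont: "AE \<omega> in M. continuous_on {0..T} (\<lambda>t. Z t \<omega>)"
    using H
  proof eventually_elim
    case (elim \<omega>)
    then obtain C where C: "\<And>s t. s \<in> {0..T} \<Longrightarrow> t \<in> {0..T} \<Longrightarrow> \<bar>Z t \<omega> - Z s \<omega>\<bar> \<le> C * \<bar>t - s\<bar> powr \<alpha>"
      unfolding holder_path_def by blast
    show ?case
      by (rule continuous_on_holder[OF C]) (use \<alpha> in auto)
  qed
  \<comment> \<open>The measures are fixed before \<omega>: they depend on \<sigma> and n only, so
    averaging over them can be combined with the expectation.\<close>
  have "\<exists>\<nu> :: real measure. finite_measure \<nu> \<and> sets \<nu> = sets borel \<and>
      (\<forall>x\<in>{- real n..real n}. \<forall>y\<in>{- real n..real n}. ennreal \<bar>\<sigma> x - \<sigma> y\<bar>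
        \<le> emeasure \<nu> {min (Lam \<sigma> a x) (Lam \<sigma> a y)..max (Lam \<sigma> a x) (Lam \<sigma> a y)})" for n :: nat
    by (rule variation_measure[of "- real n" "real n"]) (simp, blast)
  then obtain \<nu> :: "nat \<Rightarrow> real measure" where \<nu>: "\<And>n. finite_measure (\<nu> n)" "\<And>n. sets (\<nu> n) = sets borel"
    and \<nu>_le: "\<And>n x y. x \<in> {- real n..real n} \<Longrightarrow> y \<in> {- real n..real n} \<Longrightarrow> ennreal \<bar>\<sigma> x - \<sigma> y\<bar>
      \<le> emeasure (\<nu> n) {min (Lam \<sigma> a x) (Lam \<sigma> a y)..max (Lam \<sigma> a x) (Lam \<sigma> a y)}"
    by metis
  have "AE \<omega> in M. (\<integral>\<^sup>+t\<in>{0..T}. (\<integral>\<^sup>+y. inverse (ennreal (\<bar>Z t \<omega> - y\<bar> powr ((\<beta> + \<epsilon>) / \<alpha>))) \<partial>\<nu> n) \<partial>lborel) < \<infinity>" for n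
    by (rule AE_occupation_integral_finite[OF \<open>prob_space M\<close> T Z cont \<nu>(1,2) _ fin]) measurable
  \<comment> \<open>Countability of the intervals yields one null set outside which every n is
    admissible, as required by an n that depends on \<omega>.\<close>
  then have J_fin: "AE \<omega> in M. \<forall>n. (\<integral>\<^sup>+t\<in>{0..T}. (\<integral>\<^sup>+y. inverse (ennreal (\<bar>Z t \<omega> - y\<bar> powr ((\<beta> + \<epsilon>) / \<alpha>))) \<partial>\<nu> n) \<partial>lborel) < \<infinity>"
    by (simp add: AE_all_countable)
  have "AE \<omega> in M. \<exists>\<theta>. pathwise_integrable \<theta> T (\<lambda>s. \<sigma> (X s \<omega>)) (\<lambda>s. Y s \<omega>) \<and>
      (\<forall>t\<in>{0..T}. pathwise_integrable \<theta> T (\<lambda>s. indicator {0..t} s * \<sigma> (X s \<omega>)) (\<lambda>s. Y s \<omega>) \<and>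
        complex_of_real (X t \<omega>) = complex_of_real (X0 \<omega>) +
          pathwise_integral \<theta> T (\<lambda>s. indicator {0..t} s * \<sigma> (X s \<omega>)) (\<lambda>s. Y s \<omega>))"
    using H J_fin Lam_inverse_defined[folded Z_def]
  proof eventually_elim
    case (elim \<omega>)
    have X0: "X 0 \<omega> = X0 \<omega>" using inj_Lam by (simp add: X_def Z_def)
    have Y_eq: "Y t \<omega> = Z t \<omega> - (Lam \<sigma> a (X0 \<omega>) - Y 0 \<omega>)" for t by (simp add: Z_def)
    have sol: "pathwise_integrable \<beta> T (\<lambda>s. \<sigma> (X s \<omega>)) (\<lambda>s. Y s \<omega>)"
      "pathwise_integrable \<beta> T (\<lambda>s. indicator {0..t} s * \<sigma> (X s \<omega>)) (\<lambda>s. Y s \<omega>)"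
      "pathwise_integral \<beta> T (\<lambda>s. indicator {0..t} s * \<sigma> (X s \<omega>)) (\<lambda>s. Y s \<omega>) = of_real (X t \<omega> - X 0 \<omega>)"
      if "t \<in> {0..T}" for t
      by (rule pathwise_solution[where Z="\<lambda>t. Z t \<omega>", OF T \<beta> \<alpha>(2) \<epsilon> elim(1) elim(3)[rule_format] \<nu>
          \<nu>_le elim(2)[rule_format] Y_eq X_def that]; assumption)+
    show ?case
      using sol(1)[of 0] sol(2,3) T by (intro exI[of _ \<beta>]) (simp add: X0)
  qed
  then show ?thesis
    unfolding sde_solution_def Z_def[symmetric] X_def[symmetric] using X_process by blast
qed

end
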